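(* Let $(\mathbb{S}^{2},\Phi)$ be a two-sphere endowed with a reversible continuous Finsler metric, let $\mathcal{A}$ be any ($2$-dimensional) Finsler volume, and let $c>0$ be such that $\mathcal{A}([0,d_{1}]\times [0,d_{2}],\|\cdot\|_{\infty}) = c\,d_{1}d_{2}$ for all $d_{1},d_2>0$. Then for any $\varepsilon>0$ there exists a closed curve $\gamma$ dividing $(\mathbb{S}^{2},\Phi)$ into two disks $D_{1}$ and $D_{2}$, each of area at least $\frac{\mathcal{A}(\mathbb{S}^{2},\Phi)}{4}$, whose length satisfies $$\mathrm{length}(\gamma) \leq 2\sqrt{\frac{3}{c}\,\mathcal{A}(\mathbb{S}^{2},\Phi)} + \varepsilon.$$
   Context: A continuous Finsler metric on a manifold $M$ (possibly with boundary and corners) is a continuous function $\Phi:TM\to[0,+\infty)$ whose restriction to every tangent space is an asymmetric norm (positive definite, positively homogeneous, subadditive). It is reversible if $\Phi(-u)=\Phi(u)$ for every tangent vector $u$. The length of a piecewise-$\mathcal{C}^1$ curve $\gamma:[0,1]\to M$ is $\mathrm{length}_\Phi(\gamma)=\int_0^1\Phi(\gamma'(t))\,dt$, and $d_\Phi(x,y)$ is the infimum of $\mathrm{length}_\Phi(\gamma)$ over piecewise-$\mathcal{C}^1$ curves in $M$ from $x$ to $y$. Lengths in the claim are with respect to $\Phi$. An $n$-dimensional Finsler volume $v$ assigns to every $n$-dimensional manifold $(M,\Phi)$ with a reversible continuous Finsler metric a Borel measure on $M$, written $v(A,\Phi)$ for Borel $A\subset M$, compatible with restriction to subdomains, and such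 that: (i) it is the Riemannian volume when $\Phi$ comes from a Riemannian metric; (ii) it is monotonous: for every short map $f:(M,\Phi)\to(N,\Psi)$ (i.e. $d_\Psi(f(x),f(y))\le d_\Phi(x,y)$ for all $x,y\in M$) between $n$-dimensional Finsler manifolds, $v(f(M),\Psi)\leq v(M,\Phi)$. In particular isometric manifolds have equal volume. Areas of subsets of $\mathbb{S}^2$ are measured by $\mathcal{A}$ for $\Phi$; $\|\cdot\|_\infty$ denotes the constant Finsler metric on $\mathbb{R}^2$ given by the sup norm. That a closed curve $\gamma$ divides $\mathbb{S}^2$ into two disks $D_1,D_2$ means that $\mathbb{S}^2\setminus\gamma$ is the disjoint union of two open topological disks $D_1$ and $D_2$. *)

theory Defs
  imports "HOL-Analysis.Analysis"
begin

section \<open>Smooth maps\<close>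

fun Ck_on :: "nat \<Rightarrow> ('a::euclidean_space \<Rightarrow> 'b::real_normed_vector) \<Rightarrow> 'a set \<Rightarrow> bool" where
  "Ck_on 0 f U \<longleftrightarrow> continuous_on U f"
| "Ck_on (Suc k) f U \<longleftrightarrow>
     f differentiable_on U \<and> (\<forall>b\<in>Basis. Ck_on k (\<lambda>x. frechet_derivative f (at x) b) U)"

text \<open>Smoothness on an arbitrary set \<open>S\<close> means local extendability to a \<open>C\<^sup>\<infinity>\<close> map on an open set;
  this is the usual notion for (relatively open subsets of) sectors.\<close>

definition smooth_on :: "'a::euclidean_space set \<Rightarrow> ('a \<Rightarrow> 'b::real_normed_vector) \<Rightarrow> bool" where
  "smooth_on S f \<longleftrightarrow>
     (\<forall>x\<in>S. \<exists>U g. open U \<and> x \<in> U \<and> (\<forall>k. Ck_on k g U) \<and> (\<forall>y\<in>S \<inter> U. g y = f y))"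


section \<open>Manifolds with boundary and corners\<close>

text \<open>A chart is a pair \<open>(U, \<phi>)\<close>; only the values of \<open>\<phi>\<close> on \<open>U\<close> matter.\<close>

type_synonym ('p, 'n) chart = "'p set \<times> ('p \<Rightarrow> real^'n)"

definition sector :: "'n set \<Rightarrow> (real^'n::finite) set" where
  "sector I = {x. \<forall>i\<in>I. 0 \<le> x $ i}"

definition is_chart :: "'p topology \<Rightarrow> ('p, 'n::finite) chart \<Rightarrow> bool" where
  "is_chart X = (\<lambda>(U, \<phi>).
     openin X U \<and>
     (\<exists>I. openin (top_of_set (sector I)) (\<phi> ` U)) \<and>
     homeomorphic_map (subtopology X U) (top_of_set (\<phi> ` U)) \<phi>)"

definition transition :: "('p, 'n::finite) chart \<Rightarrow> ('p, 'n) chart \<Rightarrow> real^'n \<Rightarrow> real^'n" where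
  "transition = (\<lambda>(U, \<phi>) (V, \<psi>). \<psi> \<circ> inv_into U \<phi>)"

definition transition_dom :: "('p, 'n::finite) chart \<Rightarrow> ('p, 'n) chart \<Rightarrow> (real^'n) set" where
  "transition_dom = (\<lambda>(U, \<phi>) (V, \<psi>). \<phi> ` (U \<inter> V))"

definition compatible :: "('p, 'n::finite) chart \<Rightarrow> ('p, 'n) chart \<Rightarrow> bool" where
  "compatible c c' \<longleftrightarrow>
     smooth_on (transition_dom c c') (transition c c') \<and>
     smooth_on (transition_dom c' c) (transition c' c)"

record ('p, 'n) mfd =
  mtop :: "'p topology"
  atlas :: "('p, 'n::finite) chart set"

abbreviation points :: "('p, 'n::finite) mfd \<Rightarrow> 'p set" where
  "points M \<equiv> topspace (mtop M)"

definition second_countable_top :: "'p topology \<Rightarrow> bool" where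
  "second_countable_top X \<longleftrightarrow>
     (\<exists>\<B>. countable \<B> \<and> (\<forall>B\<in>\<B>. openin X B) \<and>
          (\<forall>U x. openin X U \<and> x \<in> U \<longrightarrow> (\<exists>B\<in>\<B>. x \<in> B \<and> B \<subseteq> U)))"

text \<open>Smooth manifold with boundary and corners, of dimension \<open>CARD('n)\<close>. The atlas need not be
  maximal.\<close>

definition manifold :: "('p, 'n::finite) mfd \<Rightarrow> bool" where
  "manifold M \<longleftrightarrow>
     Hausdorff_space (mtop M) \<and> second_countable_top (mtop M) \<and>
     (\<forall>c\<in>atlas M. is_chart (mtop M) c) \<and>
     points M = (\<Union>c\<in>atlas M. fst c) \<and>
     (\<forall>c\<in>atlas M. \<forall>c'\<in>atlas M. compatible c c')"


section \<open>Tangent bundle and continuous Finsler metrics\<close>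

text \<open>A tangent vector at \<open>p\<close> is \<open>p\<close> together with a class of pairs (chart around \<open>p\<close>, coordinate
  vector), identified by the differentials of the transition maps.\<close>

type_synonym ('p, 'n) tangent = "'p \<times> (('p, 'n) chart \<times> (real^'n)) set"

text \<open>\<open>tvec M c p v\<close> is the tangent vector of \<open>M\<close> at \<open>p\<close> with coordinates \<open>v\<close> in the chart \<open>c\<close>.
  The chart \<open>c\<close> need not belong to the atlas of \<open>M\<close>: for a chart \<open>c\<close> of a subdomain \<open>N\<close> of \<open>M\<close>,
  \<open>tvec M c p v\<close> is the image of \<open>tvec N c p v\<close> under the differential of the inclusion.\<close>

definition tvec ::
    "('p, 'n::finite) mfd \<Rightarrow> ('p, 'n) chart \<Rightarrow> 'p \<Rightarrow> real^'n \<Rightarrow> ('p, 'n) tangent" where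
  "tvec M c p v =
     (p, {(c', v'). c' \<in> atlas M \<and> p \<in> fst c' \<and>
            (\<exists>D. (transition c c' has_derivative D) (at (snd c p) within transition_dom c c') \<and>
                 v' = D v)})"

definition tangent_bundle :: "('p, 'n::finite) mfd \<Rightarrow> ('p, 'n) tangent set" where
  "tangent_bundle M = {tvec M c p v | c p v. c \<in> atlas M \<and> p \<in> fst c}"

definition asymmetric_norm :: "('v::real_vector \<Rightarrow> real) \<Rightarrow> bool" where
  "asymmetric_norm F \<longleftrightarrow>
     (\<forall>u. 0 \<le> F u) \<and> (\<forall>u. F u = 0 \<longleftrightarrow> u = 0) \<and>
     (\<forall>r>0. \<forall>u. F (r *\<^sub>R u) = r * F u) \<and> (\<forall>u v. F (u + v) \<le> F u + F v)"

text \<open>Metrics are functions on the whole type of tangent vectors of which only the values on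
  \<^const>\<open>tangent_bundle\<close> matter. Continuity is with respect to the bundle charts
  \<open>(x, v) \<in> \<phi>(U) \<times> \<real>\<^sup>n\<close>.\<close>

definition finsler_metric :: "('p, 'n::finite) mfd \<Rightarrow> (('p, 'n) tangent \<Rightarrow> real) \<Rightarrow> bool" where
  "finsler_metric M \<Phi> \<longleftrightarrow>
     (\<forall>(U, \<phi>)\<in>atlas M.
        continuous_on (\<phi> ` U \<times> UNIV) (\<lambda>(x, v). \<Phi> (tvec M (U, \<phi>) (inv_into U \<phi> x) v)) \<and>
        (\<forall>p\<in>U. asymmetric_norm (\<lambda>v. \<Phi> (tvec M (U, \<phi>) p v))))"

definition reversible :: "('p, 'n::finite) mfd \<Rightarrow> (('p, 'n) tangent \<Rightarrow> real) \<Rightarrow> bool" where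
  "reversible M \<Phi> \<longleftrightarrow>
     (\<forall>c\<in>atlas M. \<forall>p\<in>fst c. \<forall>v. \<Phi> (tvec M c p (- v)) = \<Phi> (tvec M c p v))"

definition reversible_finsler_manifold ::
    "('p, 'n::finite) mfd \<Rightarrow> (('p, 'n) tangent \<Rightarrow> real) \<Rightarrow> bool" where
  "reversible_finsler_manifold M \<Phi> \<longleftrightarrow> manifold M \<and> finsler_metric M \<Phi> \<and> reversible M \<Phi>"


section \<open>Length and distance\<close>

definition C1_curve_on :: "('p, 'n::finite) mfd \<Rightarrow> real \<Rightarrow> real \<Rightarrow> (real \<Rightarrow> 'p) \<Rightarrow> bool" where
  "C1_curve_on M a b \<gamma> \<longleftrightarrow>
     continuous_map (top_of_set {a..b}) (mtop M) \<gamma> \<and>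
     (\<forall>(U, \<phi>)\<in>atlas M. \<exists>\<gamma>'.
        continuous_on ({a..b} \<inter> \<gamma> -` U) \<gamma>' \<and>
        (\<forall>t\<in>{a..b} \<inter> \<gamma> -` U.
           ((\<phi> \<circ> \<gamma>) has_vector_derivative \<gamma>' t) (at t within {a..b})))"

text \<open>\<open>T\<close> is the set of subdivision points. Unlike with \<^const>\<open>piecewise_C1_differentiable_on\<close>, the
  curve is \<open>C\<^sup>1\<close> up to the end points of each piece, so that its length is finite.\<close>

definition piecewise_C1_curve :: "('p, 'n::finite) mfd \<Rightarrow> (real \<Rightarrow> 'p) \<Rightarrow> bool" where
  "piecewise_C1_curve M \<gamma> \<longleftrightarrow>
     continuous_map (top_of_set {0..1}) (mtop M) \<gamma> \<and>
     (\<exists>T. finite T \<and> {0, 1} \<subseteq> T \<and> T \<subseteq> {0..1} \<and>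
        (\<forall>a\<in>T. \<forall>b\<in>T. a < b \<and> {a<..<b} \<inter> T = {} \<longrightarrow> C1_curve_on M a b \<gamma>))"

text \<open>The velocity is meaningful wherever \<open>\<gamma>\<close> is differentiable; the finitely many remaining
  parameters do not contribute to the length.\<close>

definition velocity :: "('p, 'n::finite) mfd \<Rightarrow> (real \<Rightarrow> 'p) \<Rightarrow> real \<Rightarrow> ('p, 'n) tangent" where
  "velocity M \<gamma> t =
     (THE w. \<exists>c\<in>atlas M. \<gamma> t \<in> fst c \<and>
        (\<exists>v. ((snd c \<circ> \<gamma>) has_vector_derivative v) (at t) \<and> w = tvec M c (\<gamma> t) v))"

definition curve_length ::
    "('p, 'n::finite) mfd \<Rightarrow> (('p, 'n) tangent \<Rightarrow> real) \<Rightarrow> (real \<Rightarrow> 'p) \<Rightarrow> real" where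
  "curve_length M \<Phi> \<gamma> = integral {0..1} (\<lambda>t. \<Phi> (velocity M \<gamma> t))"

text \<open>The distance is \<open>\<infinity>\<close> between points in different components.\<close>

definition finsler_dist ::
    "('p, 'n::finite) mfd \<Rightarrow> (('p, 'n) tangent \<Rightarrow> real) \<Rightarrow> 'p \<Rightarrow> 'p \<Rightarrow> ennreal" where
  "finsler_dist M \<Phi> x y =
     (INF \<gamma>\<in>{\<gamma>. piecewise_C1_curve M \<gamma> \<and> \<gamma> 0 = x \<and> \<gamma> 1 = y}. ennreal (curve_length M \<Phi> \<gamma>))"

definition short_map ::
    "('p, 'n::finite) mfd \<Rightarrow> (('p, 'n) tangent \<Rightarrow> real) \<Rightarrow>
     ('q, 'm::finite) mfd \<Rightarrow> (('q, 'm) tangent \<Rightarrow> real) \<Rightarrow> ('p \<Rightarrow> 'q) \<Rightarrow> bool" where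
  "short_map M \<Phi> N \<Psi> f \<longleftrightarrow>
     f ` points M \<subseteq> points N \<and>
     (\<forall>x\<in>points M. \<forall>y\<in>points M. finsler_dist N \<Psi> (f x) (f y) \<le> finsler_dist M \<Phi> x y)"


section \<open>Riemannian metrics and Finsler volumes\<close>

definition gram ::
    "('p, 'n::finite) mfd \<Rightarrow> (('p, 'n) tangent \<Rightarrow> ('p, 'n) tangent \<Rightarrow> real) \<Rightarrow>
     ('p, 'n) chart \<Rightarrow> 'p \<Rightarrow> real^'n^'n" where
  "gram M g c p = (\<chi> i j. g (tvec M c p (axis i 1)) (tvec M c p (axis j 1)))"

definition riemannian_metric ::
    "('p, 'n::finite) mfd \<Rightarrow> (('p, 'n) tangent \<Rightarrow> ('p, 'n) tangent \<Rightarrow> real) \<Rightarrow> bool" where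
  "riemannian_metric M g \<longleftrightarrow>
     (\<forall>(U, \<phi>)\<in>atlas M.
        smooth_on (\<phi> ` U) (\<lambda>x. gram M g (U, \<phi>) (inv_into U \<phi> x)) \<and>
        (\<forall>p\<in>U. let b = (\<lambda>u v. g (tvec M (U, \<phi>) p u) (tvec M (U, \<phi>) p v)) in
           bilinear b \<and> (\<forall>u v. b u v = b v u) \<and> (\<forall>u. u \<noteq> 0 \<longrightarrow> 0 < b u u)))"

definition induced_by ::
    "('p, 'n::finite) mfd \<Rightarrow> (('p, 'n) tangent \<Rightarrow> real) \<Rightarrow>
     (('p, 'n) tangent \<Rightarrow> ('p, 'n) tangent \<Rightarrow> real) \<Rightarrow> bool" where
  "induced_by M \<Phi> g \<longleftrightarrow> (\<forall>w\<in>tangent_bundle M. \<Phi> w = sqrt (g w w))"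

definition borel_sets :: "'p topology \<Rightarrow> 'p set set" where
  "borel_sets X = sigma_sets (topspace X) {U. openin X U}"

definition is_riemannian_volume ::
    "('p, 'n::finite) mfd \<Rightarrow> (('p, 'n) tangent \<Rightarrow> ('p, 'n) tangent \<Rightarrow> real) \<Rightarrow>
     'p measure \<Rightarrow> bool" where
  "is_riemannian_volume M g \<mu> \<longleftrightarrow>
     (\<forall>(U, \<phi>)\<in>atlas M. \<forall>A\<in>borel_sets (mtop M). A \<subseteq> U \<longrightarrow>
        emeasure \<mu> A =
          (\<integral>\<^sup>+x\<in>\<phi> ` A. ennreal (sqrt (det (gram M g (U, \<phi>) (inv_into U \<phi> x)))) \<partial>lborel))"

text \<open>\<open>N\<close> is an embedded submanifold of \<open>M\<close> of the same dimension, possibly with boundary and corners: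
  it carries the induced topology, and the inclusion and its inverse are smooth in charts.\<close>

definition subdomain :: "('p, 'n::finite) mfd \<Rightarrow> ('p, 'n) mfd \<Rightarrow> bool" where
  "subdomain N M \<longleftrightarrow>
     points N \<subseteq> points M \<and> mtop N = subtopology (mtop M) (points N) \<and>
     (\<forall>c\<in>atlas N. \<forall>c'\<in>atlas M. compatible c c')"

definition restricts_to ::
    "('p, 'n::finite) mfd \<Rightarrow> (('p, 'n) tangent \<Rightarrow> real) \<Rightarrow>
     ('p, 'n) mfd \<Rightarrow> (('p, 'n) tangent \<Rightarrow> real) \<Rightarrow> bool" where
  "restricts_to M \<Phi> N \<Psi> \<longleftrightarrow>
     (\<forall>c\<in>atlas N. \<forall>p\<in>fst c. \<forall>v. \<Psi> (tvec N c p v) = \<Phi> (tvec M c p v))"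

text \<open>A volume in dimension \<open>CARD('n)\<close> assigns measures to the manifolds whose points are taken from
  the universe \<open>'p\<close>. Hausdorff second countable manifolds have at most continuum many points, so
  with \<open>'p = real^3\<close> every manifold occurs up to isomorphism.\<close>

definition finsler_volume ::
    "(('p, 'n::finite) mfd \<Rightarrow> (('p, 'n) tangent \<Rightarrow> real) \<Rightarrow> 'p measure) \<Rightarrow> bool" where
  "finsler_volume v \<longleftrightarrow>
     (\<forall>M \<Phi>. reversible_finsler_manifold M \<Phi> \<longrightarrow>
        space (v M \<Phi>) = points M \<and> sets (v M \<Phi>) = borel_sets (mtop M)) \<and>
     (\<forall>M \<Phi> N \<Psi>. reversible_finsler_manifold M \<Phi> \<and> reversible_finsler_manifold N \<Psi> \<and>
        subdomain N M \<and> restricts_to M \<Phi> N \<Psi> \<longrightarrow>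
        (\<forall>A\<in>borel_sets (mtop N). emeasure (v N \<Psi>) A = emeasure (v M \<Phi>) A)) \<and>
     (\<forall>M \<Phi> g. reversible_finsler_manifold M \<Phi> \<and> riemannian_metric M g \<and> induced_by M \<Phi> g \<longrightarrow>
        is_riemannian_volume M g (v M \<Phi>)) \<and>
     (\<forall>M \<Phi> N \<Psi> f. reversible_finsler_manifold M \<Phi> \<and> reversible_finsler_manifold N \<Psi> \<and>
        short_map M \<Phi> N \<Psi> f \<longrightarrow>
        emeasure (v N \<Psi>) (f ` points M) \<le> emeasure (v M \<Phi>) (points M))"


section \<open>The two-sphere\<close>

definition stereo :: "real \<Rightarrow> real^3 \<Rightarrow> real^2" where
  "stereo s x = vector [x $ 1 / (1 - s * x $ 3), x $ 2 / (1 - s * x $ 3)]"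

text \<open>The unit sphere with the stereographic charts from the poles \<open>(0, 0, 1)\<close> and \<open>(0, 0, -1)\<close>.\<close>

definition sphere2 :: "(real^3, 2) mfd" where
  "sphere2 = \<lparr> mtop = top_of_set (sphere 0 1),
     atlas = {(sphere 0 1 - {axis 3 1}, stereo 1), (sphere 0 1 - {axis 3 (-1)}, stereo (-1))} \<rparr>"

definition divides_into_disks ::
    "(real \<Rightarrow> real^3) \<Rightarrow> (real^3) set \<Rightarrow> (real^3) set \<Rightarrow> bool" where
  "divides_into_disks \<gamma> D1 D2 \<longleftrightarrow>
     sphere 0 1 - \<gamma> ` {0..1} = D1 \<union> D2 \<and> D1 \<inter> D2 = {} \<and>
     (\<forall>D\<in>{D1, D2}. openin (top_of_set (sphere 0 1)) D \<and> D homeomorphic (ball 0 1 :: (real^2) set))"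


section \<open>The plane with the sup norm\<close>

text \<open>\<open>\<real>\<^sup>2\<close> is realised as \<open>\<real>\<^sup>2 \<times> {0}\<close>, so that its points belong to the same universe \<open>real^3\<close> as
  those of the sphere.\<close>

definition plane_chart :: "(real^3, 2) chart" where
  "plane_chart = ({x. x $ 3 = 0}, \<lambda>x. vector [x $ 1, x $ 2])"

definition plane :: "(real^3, 2) mfd" where
  "plane = \<lparr> mtop = top_of_set {x. x $ 3 = 0}, atlas = {plane_chart} \<rparr>"

definition sup_metric :: "(real^3, 2) tangent \<Rightarrow> real" where
  "sup_metric w = infnorm (THE v. (plane_chart, v) \<in> snd w)"

definition rectangle :: "real \<Rightarrow> real \<Rightarrow> (real^3) set" where
  "rectangle d1 d2 = {x. x $ 1 \<in> {0..d1} \<and> x $ 2 \<in> {0..d2} \<and> x $ 3 = 0}"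

end

(* The curves are polygons of the stereographic plane, whose missing pole is a null set. Among those with at
   least a quarter of the area on either side take one, C, of almost minimal length L, and let D be a side
   with at least half of the area. A chord of D divides D into two parts, and one of them has at least a
   quarter of the area; by almost minimality the chord is, up to a small error, at least as long as the
   shorter of the two arcs of C between its ends. Therefore the distance functions in D from two consecutive
   quarters of C, completed by arc length along C, give a short map from D to the sup-norm plane which on the
   boundary almost is the arc length parametrization of the square of side L/4. It covers almost the whole
   square, as otherwise the closed disc would retract onto its boundary. By monotonicity
   c (L/4)^2 <= area(D) <= 3/4 area(S^2), up to a small error (Besicovitch's inequality). *)

theory Submission
  imports Defs "HOL-Complex_Analysis.Complex_Analysis"
begin

section \<open>Plane topology\<close>

text \<open>The areas, not the lengths, decide which arc of C survives when a chord replaces the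
  other one, so a chord can only be compared with the shorter arc. This is enough: if ending at a
  point of C costs the value of a function that is 1-Lipschitz for arc length, the inner distance of
  D has this function as boundary values, up to the error. The two coordinates of the square are
  such functions, and a pair of 1-Lipschitz functions is a short map into the sup norm. Only open
  sides become manifolds, because a reentrant corner of a polygon has no chart in a sector. The
  price is that the map need not extend to the frontier, so an interpolation precedes the
  no-retraction theorem. The side with the pole is unbounded in the plane. Inversions make it
  bounded, and Lipschitz functions extend to the pole by a limit; this costs one value of the map,
  and points are null. Nullity of segments and finiteness of the area also come from monotonicity,
  applied to scaled rectangles of the sup-norm plane that are mapped into a chart.\<close>

text \<open>Near the frontier \<open>f\<close> is only known to be close to \<open>k\<close>, up to
  \<delta>. The passage from \<open>f\<close> to \<open>k\<close> is therefore made inside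
  \<open>D\<close>, in a collar where moving straight from \<open>f x\<close> to an extension of
  \<open>k\<close> cannot meet \<open>y\<close>; the depth of \<open>y\<close> in \<open>Q\<close>
  provides the room.\<close>

lemma covers_of_almost_homeomorphism_on_frontier:
  fixes D Q :: "complex set" and f k :: "complex \<Rightarrow> complex"
  assumes D: "open D" "bounded D" "D \<noteq> {}" and f: "continuous_on D f"
    and Q: "convex Q" "bounded Q"
    and hom: "homeomorphism (frontier D) (frontier Q) k k'"
    and near: "\<And>w. w \<in> frontier D \<Longrightarrow> \<exists>r>0. \<forall>x\<in>D. dist x w < r \<longrightarrow> dist (f x) (k w) < \<delta>"
    and \<delta>: "\<delta> < \<delta>'" and y: "y \<in> interior Q" "\<And>q. q \<in> frontier Q \<Longrightarrow> \<delta>' < dist q y"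
  shows "y \<in> f ` D"
proof (rule ccontr)
  assume ny: "y \<notin> f ` D"
  let ?C = "frontier D"
  have contk: "continuous_on ?C k" using hom by (simp add: homeomorphism_def)
  obtain U where U: "continuous_on UNIV U" "\<And>x. x \<in> ?C \<Longrightarrow> U x = k x"
    using Tietze_unbounded[OF contk, of UNIV] by (auto simp: frontier_closed)
  \<comment> \<open>At a good point the segment from \<open>U x\<close> to \<open>f x\<close> stays
    within \<delta>' of \<open>U x\<close>, while \<open>y\<close> is farther away, so interpolation
    along it avoids \<open>y\<close>.\<close>
  define good where "good x \<longleftrightarrow> dist (f x) (U x) < \<delta>' \<and> \<delta>' < dist (U x) y" for x
  have "\<exists>r>0. \<forall>x\<in>D. dist x w < r \<longrightarrow> good x" if w: "w \<in> ?C" for w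
  proof -
    obtain r where r: "r > 0" "\<And>x. x \<in> D \<Longrightarrow> dist x w < r \<Longrightarrow> dist (f x) (k w) < \<delta>"
      using near[OF w] by blast
    have kw: "k w \<in> frontier Q" using hom w by (auto simp: homeomorphism_def)
    \<comment> \<open>Two margins: \<delta>' - \<delta> pays for replacing \<open>k w\<close> by
      \<open>U x\<close>, the other one keeps \<open>U x\<close> away from \<open>y\<close>.\<close>
    define e where "e = min (\<delta>' - \<delta>) (dist (k w) y - \<delta>')"
    have e: "e > 0" using \<delta> y(2)[OF kw] by (simp add: e_def)
    obtain r' where r': "r' > 0" "\<And>x. dist x w < r' \<Longrightarrow> dist (U x) (U w) < e"
      using U(1) e unfolding continuous_on_iff by (metis UNIV_I)
    have "good x" if "x \<in> D" "dist x w < min r r'" for x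
    proof -
      have "dist (f x) (k w) < \<delta>" "dist (U x) (k w) < e"
        using r(2)[OF that(1)] r'(2)[of x] that U(2)[OF w] by auto
      moreover have "dist (f x) (U x) \<le> dist (f x) (k w) + dist (U x) (k w)"
        "dist (k w) y \<le> dist (U x) (k w) + dist (U x) y"
        by (metis dist_triangle2, metis dist_triangle3)
      ultimately show ?thesis by (auto simp: good_def e_def)
    qed
    then show ?thesis using r(1) r'(1) by (intro exI[of _ "min r r'"]) auto
  qed
  then obtain r where r: "\<And>w. w \<in> ?C \<Longrightarrow> r w > 0"
    "\<And>w x. w \<in> ?C \<Longrightarrow> x \<in> D \<Longrightarrow> dist x w < r w \<Longrightarrow> good x"
    by metis
  define V where "V = {x\<in>D. good x} \<union> (\<Union>w\<in>?C. ball w (r w))"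
  have cl: "closure D = D \<union> ?C" using D(1) closure_Un_frontier by blast
  have disj: "D \<inter> ?C = {}" using D(1) by (simp add: frontier_def interior_open)
  have contU: "continuous_on S U" for S using U(1) continuous_on_subset by blast
  have "{x\<in>D. good x} = (D \<inter> (\<lambda>x. \<delta>' - dist (f x) (U x)) -` {0<..}) \<inter> (D \<inter> (\<lambda>x. dist (U x) y - \<delta>') -` {0<..})"
    by (auto simp: good_def)
  moreover have "open \<dots>"
    using D(1) by (intro open_Int continuous_open_preimage continuous_intros f contU) auto
  ultimately have "open V" unfolding V_def by auto
  then have clB: "closed (closure D - V)" by auto
  have CV: "?C \<subseteq> V" using r(1) by (auto simp: V_def)
  have goodV: "good x" if "x \<in> D" "x \<in> V" for x
    using that r(2) by (auto simp: V_def dist_commute)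
  obtain l :: "complex \<Rightarrow> real" where l: "continuous_on UNIV l" "\<And>x. l x \<in> closed_segment 0 1"
      "\<And>x. x \<in> closure D - V \<Longrightarrow> l x = 0" "\<And>x. x \<in> ?C \<Longrightarrow> l x = 1"
  proof -
    have "closedin (top_of_set UNIV) (closure D - V)" "closedin (top_of_set UNIV) ?C"
      "(closure D - V) \<inter> ?C = {}"
      using clB CV by (auto simp: frontier_closed)
    from Urysohn_local[OF this, of "0::real" 1] show ?thesis using that by (metis UNIV_I)
  qed
  have l01: "0 \<le> l x" "l x \<le> 1" for x using l(2)[of x] by (auto simp: closed_segment_eq_real_ivl)
  txt \<open>The map \<open>h = U + E\<close> is \<open>f\<close> away from the frontier and \<open>k\<close> on it, and it avoids \<open>y\<close>; composed with a
    retraction onto \<open>frontier Q\<close> and with \<open>k'\<close>, it would retract \<open>closure D\<close> onto \<open>frontier D\<close>.\<close>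
  define E where "E x = (if x \<in> ?C then 0 else (1 - l x) *\<^sub>R (f x - U x))" for x
  have contE: "continuous_on (closure D) E"
    unfolding continuous_on_eq_continuous_within
  proof
    fix x assume "x \<in> closure D"
    then consider "x \<in> D" | "x \<in> ?C" using cl by blast
    then show "continuous (at x within closure D) E"
    proof cases
      case 1
      have "continuous_on D (\<lambda>x. (1 - l x) *\<^sub>R (f x - U x))"
        by (intro continuous_intros f contU continuous_on_subset[OF l(1)]) auto
      then have "continuous_on D E"
        by (rule continuous_on_eq) (use disj in \<open>auto simp: E_def\<close>)
      then show ?thesis
        using 1 D(1) continuous_on_eq_continuous_at continuous_at_imp_continuous_at_within by blast
    next
      case 2
      \<comment> \<open>\<open>f\<close> may oscillate at a frontier point, but \<open>f - U\<close>
        is bounded by \<delta>' at good points and the factor \<open>1 - l\<close> tends to 0. This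
        makes \<open>E\<close> continuous there.\<close>
      have "((\<lambda>z. (1 - l z) * \<delta>') \<longlongrightarrow> (1 - l x) * \<delta>') (at x within closure D)"
        using l(1) by (intro tendsto_intros) (meson UNIV_I continuous_on_def tendsto_within_subset subset_UNIV)
      then have lim: "((\<lambda>z. (1 - l z) * \<delta>') \<longlongrightarrow> 0) (at x within closure D)"
        using l(4)[OF 2] by simp
      have "eventually (\<lambda>z. norm (E z) \<le> (1 - l z) * \<delta>') (at x within closure D)"
        unfolding eventually_at
      proof (intro exI[of _ "r x"] conjI ballI impI r(1)[OF 2])
        fix z assume z: "z \<in> closure D" "z \<noteq> x \<and> dist z x < r x"
        show "norm (E z) \<le> (1 - l z) * \<delta>'"
        proof (cases "z \<in> ?C")
          case True then show ?thesis using l(4) by (simp add: E_def)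
        next
          case False
          then have "good z" using r(2)[OF 2, of z] z cl by auto
          then have "norm (f z - U z) \<le> \<delta>'" by (simp add: good_def dist_norm)
          then show ?thesis using False l01[of z] by (simp add: E_def mult_left_mono)
        qed
      qed
      then have "(E \<longlongrightarrow> 0) (at x within closure D)"
        using lim by (rule Lim_null_comparison)
      then show ?thesis using 2 by (simp add: continuous_within E_def)
    qed
  qed
  define h where "h x = U x + E x" for x
  have conth: "continuous_on (closure D) h"
    unfolding h_def by (intro continuous_intros contE contU)
  have hC: "h x = k x" if "x \<in> ?C" for x using that U(2) by (simp add: h_def E_def)
  have hy: "h x \<noteq> y" if x: "x \<in> closure D" for x
  proof -
    consider "x \<in> ?C" | "x \<in> D" "x \<notin> ?C" "x \<in> V" | "x \<in> D" "x \<notin> ?C" "x \<notin> V" using x cl by blast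
    then show ?thesis
    proof cases
      case 1
      then have "k x \<in> frontier Q" using hom by (auto simp: homeomorphism_def)
      then show ?thesis using hC[OF 1] y(1) by (auto simp: frontier_def)
    next
      case 2
      then have g: "good x" using goodV by blast
      have "dist (h x) (U x) = (1 - l x) * dist (f x) (U x)"
        using 2 l01[of x] by (simp add: h_def E_def dist_norm)
      also have "\<dots> \<le> dist (f x) (U x)" using l01[of x] by (simp add: mult_left_le_one_le)
      finally show ?thesis using g by (auto simp: good_def dist_commute)
    next
      case 3
      then have "l x = 0" using l(3)[of x] x by blast
      then have "h x = f x" using 3 by (simp add: h_def E_def)
      then show ?thesis using ny 3 by blast
    qed
  qed
  obtain \<rho> where \<rho>: "retraction (- {y}) (frontier Q) \<rho>"
    using frontier_retract_of_punctured_universe[OF Q y(1)] by (auto simp: retract_of_def)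
  have "D \<subseteq> ?C"
  proof (rule frontier_subset_retraction[OF D(2) order_refl])
    show "continuous_on (closure D) (k' \<circ> (\<rho> \<circ> h))"
    proof (intro continuous_on_compose conth)
      show "continuous_on (h ` closure D) \<rho>"
        by (rule continuous_on_subset[of "- {y}"]) (use \<rho> hy in \<open>auto simp: retraction_def\<close>)
      show "continuous_on ((\<rho> \<circ> h) ` closure D) k'"
        by (rule continuous_on_subset[of "frontier Q"])
          (use \<rho> hy hom in \<open>auto simp: retraction_def homeomorphism_def Pi_iff\<close>)
    qed
    show "k' \<circ> (\<rho> \<circ> h) \<in> D \<rightarrow> ?C"
    proof
      fix x assume "x \<in> D"
      then have "\<rho> (h x) \<in> frontier Q" using hy[of x] \<rho> cl by (auto simp: retraction_def Pi_iff)
      then show "(k' \<circ> (\<rho> \<circ> h)) x \<in> ?C" using hom by (auto simp: homeomorphism_def)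
    qed
    show "(k' \<circ> (\<rho> \<circ> h)) x = x" if x: "x \<in> ?C" for x
    proof -
      have "\<rho> (k x) = k x" using \<rho> hom x by (auto simp: retraction_def homeomorphism_def)
      then show ?thesis using hC[OF x] hom x by (simp add: homeomorphism_def)
    qed
  qed
  then show False using D(3) disj by blast
qed

section \<open>Inversions and the two sides of a Jordan curve\<close>

text \<open>Since \<open>1 / 0 = 0\<close>, the centre \<open>a\<close> goes to 0 and the map is
  injective on the whole plane. But 0 is also the limit at infinity, which is why \<open>{a}\<close>
  and \<open>{0}\<close> are taken out in the statements about sides.\<close>

definition minv :: "complex \<Rightarrow> complex \<Rightarrow> complex" where
  "minv a z = 1 / (z - a)"

lemma minv_inverse: "z \<noteq> a \<Longrightarrow> a + 1 / minv a z = z"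
  by (simp add: minv_def)

lemma inj_on_minv: "inj_on (minv a) A"
  by (auto simp: inj_on_def minv_def)

lemma continuous_on_minv: "a \<notin> A \<Longrightarrow> continuous_on A (minv a)"
  unfolding minv_def by (intro continuous_intros) auto

lemma minv_image_punctured_plane: "minv a ` (- {a}) = - {0}"
proof -
  have "\<zeta> \<in> minv a ` (- {a})" if "\<zeta> \<noteq> 0" for \<zeta>
    using that by (intro image_eqI[of _ _ "a + 1 / \<zeta>"]) (auto simp: minv_def)
  then show ?thesis by (auto simp: minv_def)
qed

lemma connected_subset_cases:
  assumes "connected A" "open P" "open Q" "P \<inter> Q = {}" "A \<subseteq> P \<union> Q"
  shows "A \<subseteq> P \<or> A \<subseteq> Q"
  using connectedD[OF assms(1-3)] assms(4,5) by blast

text \<open>A connected open set of the plane stays connected without a point, so each punctured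
  side is carried into a single side of the image curve. Together the images fill both punctured
  sides, which are nonempty; hence they fill different ones.\<close>

lemma minv_jordan_sides:
  assumes c: "simple_path c" "pathfinish c = pathstart c" and J: "J = path_image c" and a: "a \<notin> J"
  shows "(minv a ` (inside J - {a}) = inside (minv a ` J) - {0} \<and>
          minv a ` (outside J - {a}) = outside (minv a ` J) - {0}) \<or>
         (minv a ` (inside J - {a}) = outside (minv a ` J) - {0} \<and>
          minv a ` (outside J - {a}) = inside (minv a ` J) - {0})"
proof -
  let ?J = "minv a ` J" and ?A = "minv a ` (inside J - {a})" and ?B = "minv a ` (outside J - {a})"
  have c': "simple_path (minv a \<circ> c)"
    using c a J by (intro simple_path_continuous_image continuous_on_minv inj_on_minv) auto
  have pi: "path_image (minv a \<circ> c) = ?J" by (simp add: path_image_compose J)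
  have lp: "pathfinish (minv a \<circ> c) = pathstart (minv a \<circ> c)"
    using c(2) by (simp add: pathfinish_compose pathstart_compose)
  note j = Jordan_inside_outside[OF c, folded J] and j' = Jordan_inside_outside[OF c' lp, unfolded pi]
  have un: "?A \<union> ?B = - ?J - {0}"
  proof -
    have "?A \<union> ?B = minv a ` ((inside J \<union> outside J) - {a})" by blast
    also have "\<dots> = minv a ` (- {a} - J)" using j by (intro arg_cong[where f = "image (minv a)"]) auto
    also have "\<dots> = minv a ` (- {a}) - ?J"
      by (rule inj_on_image_set_diff[OF inj_on_minv[of a UNIV]]) auto
    also have "\<dots> = - {0} - ?J" by (simp only: minv_image_punctured_plane)
    finally show ?thesis by blast
  qed
  have "?A \<inter> ?B = minv a ` ((inside J - {a}) \<inter> (outside J - {a}))"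
    by (rule inj_on_image_Int[OF inj_on_minv[of a UNIV], symmetric]) auto
  moreover have "(inside J - {a}) \<inter> (outside J - {a}) = {}" using j by (metis Diff_disjoint Int_Diff Int_commute Int_empty_left)
  ultimately have dj: "?A \<inter> ?B = {}" by simp
  have conn: "connected (minv a ` (S - {a}))" if "open S" "connected S" for S
    using connected_open_delete[OF that, of a]
    by (intro connected_continuous_image continuous_on_minv) auto
  have ne: "S - {0} \<noteq> {}" if "open S" "S \<noteq> {}" for S :: "complex set"
    using that not_open_singleton[of "0::complex"] by (metis Diff_eq_empty_iff subset_singletonD)
  have e: "inside ?J \<union> outside ?J = - ?J" "inside ?J \<inter> outside ?J = {}"
    and o: "open (inside ?J)" "open (outside ?J)" and n: "inside ?J \<noteq> {}" "outside ?J \<noteq> {}"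
    using j' by simp_all
  have o': "open (inside J)" "open (outside J)" "connected (inside J)" "connected (outside J)"
    using j by simp_all
  have sub: "?A \<subseteq> inside ?J \<union> outside ?J" "?B \<subseteq> inside ?J \<union> outside ?J" unfolding e using un by blast+
  have a1: "?A \<subseteq> inside ?J \<or> ?A \<subseteq> outside ?J"
    by (rule connected_subset_cases[OF conn[OF o'(1,3)] o e(2) sub(1)])
  have b1: "?B \<subseteq> inside ?J \<or> ?B \<subseteq> outside ?J"
    by (rule connected_subset_cases[OF conn[OF o'(2,4)] o e(2) sub(2)])
  have n1: "inside ?J - {0} \<noteq> {}" "outside ?J - {0} \<noteq> {}" using ne o n by auto
  have "(A = P - {0} \<and> B = Q - {0}) \<or> (A = Q - {0} \<and> B = P - {0})"
    if "A \<subseteq> P \<or> A \<subseteq> Q" "B \<subseteq> P \<or> B \<subseteq> Q" "A \<union> B = (P \<union> Q) - {0}" "P \<inter> Q = {}"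
      "P - {0} \<noteq> {}" "Q - {0} \<noteq> {}" for A B P Q :: "complex set"
    using that by blast
  from this[OF a1 b1 _ e(2) n1] show ?thesis unfolding e un by blast
qed

text \<open>Only properties shared by the two sides are collected, so the unordered equation for
  \<open>{D, E}\<close> leaves open which of them is bounded.\<close>

lemma jordan_sides:
  fixes c :: "real \<Rightarrow> complex"
  assumes c: "simple_path c" "pathfinish c = pathstart c" and J: "J = path_image c"
    and DE: "{D, E} = {inside J, outside J}"
  shows "open D" "open E" "connected D" "connected E" "D \<inter> E = {}" "D \<union> E = - J" "D \<noteq> {}" "E \<noteq> {}"
    "frontier D = J" "frontier E = J"
proof -
  note j = Jordan_inside_outside[OF c, folded J]
  have "(D = inside J \<and> E = outside J) \<or> (D = outside J \<and> E = inside J)"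
    using DE by (simp add: doubleton_eq_iff)
  then show "open D" "open E" "connected D" "connected E" "D \<inter> E = {}" "D \<union> E = - J" "D \<noteq> {}" "E \<noteq> {}"
    "frontier D = J" "frontier E = J"
    by (elim disjE conjE; simp add: j Int_commute Un_commute)+
qed

text \<open>Inversion at a point of the other side makes either side of a Jordan curve the inside of one, up to
  the image \<open>0\<close> of \<open>\<infinity>\<close>. Hence the bounded and the unbounded side can be treated alike.\<close>

lemma minv_jordan_side:
  assumes c: "simple_path c" "pathfinish c = pathstart c" and J: "J = path_image c"
    and DE: "{D, E} = {inside J, outside J}" and a: "a \<in> E"
  shows "minv a ` D = inside (minv a ` J) - {0}" "minv a ` (E - {a}) = outside (minv a ` J) - {0}"
proof -
  note j = jordan_sides[OF c J DE]
  have aJ: "a \<notin> J" and aD: "a \<notin> D" and oE: "open E" and ED: "E \<inter> D = {}"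
    using a j(2,5,6) by blast+
  obtain e where e: "e > 0" "ball a e \<subseteq> E" using oE a by (meson open_contains_ball)
  \<comment> \<open>\<open>D\<close> keeps a positive distance from \<open>a\<close>, so its image
    is bounded and cannot be the punctured outside.\<close>
  have "norm (minv a z) \<le> 1 / e" if "z \<in> D" for z
  proof -
    have "e \<le> norm (z - a)" using e ED that by (force simp: dist_norm norm_minus_commute)
    then have "1 / norm (z - a) \<le> 1 / e" using e(1) by (intro divide_left_mono mult_pos_pos) auto
    then show ?thesis by (simp add: minv_def norm_divide)
  qed
  then have bD: "bounded (minv a ` D)" by (auto intro: boundedI)
  have "path_image (minv a \<circ> c) = minv a ` J" by (simp add: path_image_compose J)
  moreover have "simple_path (minv a \<circ> c)"
    using c aJ J by (intro simple_path_continuous_image continuous_on_minv inj_on_minv) auto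
  moreover have "pathfinish (minv a \<circ> c) = pathstart (minv a \<circ> c)"
    using c(2) by (simp add: pathfinish_compose pathstart_compose)
  ultimately have "\<not> bounded (outside (minv a ` J))" using Jordan_inside_outside by metis
  then have "\<not> bounded (outside (minv a ` J) - {0})"
    using bounded_Un[of "outside (minv a ` J) - {0}" "{0}"] by (auto intro: bounded_subset)
  then have nd: "minv a ` D \<noteq> outside (minv a ` J) - {0}" using bD by metis
  have DD: "D - {a} = D" using aD by blast
  have "(D = inside J \<and> E = outside J) \<or> (D = outside J \<and> E = inside J)"
    using DE by (simp add: doubleton_eq_iff)
  with minv_jordan_sides[OF c J aJ] nd DD
  show "minv a ` D = inside (minv a ` J) - {0}" "minv a ` (E - {a}) = outside (minv a ` J) - {0}"
    by metis+
qed

text \<open>An inversion centred at a point \<open>a\<close> of \<open>E\<close> turns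
  \<open>D\<close> into an inside, to which \<open>split_inside_simple_closed_curve\<close> applies;
  the pieces are then pulled back. The centre stays exceptional because its image 0 also stands for
  infinity. Inclusions suffice, as they are only used to compare areas.\<close>

lemma theta_curve_sides:
  fixes c1 c2 \<kappa> :: "real \<Rightarrow> complex"
  assumes arcs: "arc c1" "arc c2" "arc \<kappa>"
    and ends: "pathstart c1 = p" "pathfinish c1 = q" "pathstart c2 = p" "pathfinish c2 = q"
      "pathstart \<kappa> = p" "pathfinish \<kappa> = q"
    and i12: "path_image c1 \<inter> path_image c2 = {p, q}"
    and DE: "{D, E} = {inside (path_image c1 \<union> path_image c2), outside (path_image c1 \<union> path_image c2)}"
    and K: "path_image \<kappa> - {p, q} \<subseteq> D"
  obtains X1 Y1 X2 Y2 a where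
    "{X1, Y1} = {inside (path_image c1 \<union> path_image \<kappa>), outside (path_image c1 \<union> path_image \<kappa>)}"
    "{X2, Y2} = {inside (path_image c2 \<union> path_image \<kappa>), outside (path_image c2 \<union> path_image \<kappa>)}"
    "D \<subseteq> X1 \<union> X2 \<union> path_image \<kappa>" "E - {a} \<subseteq> Y1" "E - {a} \<subseteq> Y2"
proof -
  let ?C1 = "path_image c1" and ?C2 = "path_image c2" and ?K = "path_image \<kappa>"
  have pq: "p \<noteq> q" using arcs(1) ends arc_distinct_ends by metis
  have inC: "p \<in> ?C1" "q \<in> ?C1" "p \<in> ?C2" "q \<in> ?C2" "p \<in> ?K" "q \<in> ?K"
    using ends pathstart_in_path_image pathfinish_in_path_image by metis+
  have loop: "simple_path (f +++ reversepath g) \<and> pathfinish (f +++ reversepath g) = pathstart (f +++ reversepath g)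
      \<and> path_image (f +++ reversepath g) = path_image f \<union> path_image g"
    if "arc f" "arc g" "pathstart f = p" "pathfinish f = q" "pathstart g = p" "pathfinish g = q"
      "path_image f \<inter> path_image g = {p, q}" for f g :: "real \<Rightarrow> complex"
  proof -
    have "simple_path (f +++ reversepath g)"
      using that by (intro simple_path_join_loop) (auto simp: arc_reversepath)
    then show ?thesis using that by (simp add: path_image_join)
  qed
  let ?J = "?C1 \<union> ?C2"
  obtain c where c: "simple_path c" "pathfinish c = pathstart c" "?J = path_image c"
    using loop[of c1 c2] arcs ends i12 by metis
  note jc = jordan_sides[OF c DE]
  have DJ: "D \<inter> ?J = {}" "E \<inter> ?J = {}" "D \<inter> E = {}" "E \<noteq> {}" using jc(5,6,8) by blast+
  have iK: "?C1 \<inter> ?K = {p, q}" "?C2 \<inter> ?K = {p, q}"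
    using K DJ inC by blast+
  obtain a where a: "a \<in> E" using DJ by blast
  have aJ: "a \<notin> ?C1" "a \<notin> ?C2" using a DJ by blast+
  have aK: "a \<notin> ?K" using a DJ K inC aJ by blast
  let ?m = "minv a"
  have am: "arc (?m \<circ> f) \<and> path_image (?m \<circ> f) = ?m ` path_image f \<and> pathstart (?m \<circ> f) = ?m (pathstart f)
       \<and> pathfinish (?m \<circ> f) = ?m (pathfinish f)"
    if "arc f" "a \<notin> path_image f" for f
    using that inj_on_minv[of a "path_image f"] continuous_on_minv[OF that(2)]
    by (simp add: arc_simple_path simple_path_continuous_image path_image_compose pathfinish_compose
        pathstart_compose) (metis inj_on_minv inj_on_contraD UNIV_I)
  note m1 = am[OF arcs(1) aJ(1)] and m2 = am[OF arcs(2) aJ(2)] and mk = am[OF arcs(3) aK]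
  have int: "?m ` S \<inter> ?m ` T = ?m ` (S \<inter> T)" for S T
    using inj_on_image_Int[OF inj_on_minv[of a UNIV], of S T] by auto
  have minvne: "?m p \<noteq> ?m q" using pq inj_on_minv[of a UNIV] by (auto simp: inj_on_def)
  note side = minv_jordan_side[OF c(1,2,3) DE a]
  have uni: "?m ` (S \<union> T) = ?m ` S \<union> ?m ` T" for S T by blast
  have "p \<noteq> a" "q \<noteq> a" using inC aJ by auto
  \<comment> \<open>An arc has more than two points. An inner point of the chord shows that its
    image meets the inside, as the splitting theorem demands.\<close>
  obtain x where x: "x \<in> ?K" "x \<noteq> p" "x \<noteq> q"
  proof -
    have "infinite ?K" using arcs(3) arc_image_uncountable uncountable_infinite by blast
    then have "\<not> ?K \<subseteq> {p, q}" using finite_subset by blast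
    then show ?thesis using that by blast
  qed
  have ne: "path_image (?m \<circ> \<kappa>) \<inter> inside (path_image (?m \<circ> c1) \<union> path_image (?m \<circ> c2)) \<noteq> {}"
  proof -
    have "?m x \<in> ?m ` D" using x K by blast
    then have "?m x \<in> inside (?m ` ?C1 \<union> ?m ` ?C2)" using side(1) uni by (metis DiffD1)
    then show ?thesis using x(1) m1 m2 mk by auto
  qed
  have split: "inside (?m ` ?C1 \<union> ?m ` ?K) \<inter> inside (?m ` ?C2 \<union> ?m ` ?K) = {}"
    "inside (?m ` ?C1 \<union> ?m ` ?K) \<union> inside (?m ` ?C2 \<union> ?m ` ?K) \<union> (?m ` ?K - {?m p, ?m q})
       = inside (?m ` ?C1 \<union> ?m ` ?C2)"
    using split_inside_simple_closed_curve[of "?m \<circ> c1" "?m p" "?m q" "?m \<circ> c2" "?m \<circ> \<kappa>"]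
      m1 m2 mk ends minvne int i12 iK ne by (auto simp: arc_imp_simple_path)
  have X: "\<exists>X Y. {X, Y} = {inside (S \<union> ?K), outside (S \<union> ?K)} \<and>
      ?m ` (X - {a}) = inside (?m ` S \<union> ?m ` ?K) - {0} \<and> ?m ` (Y - {a}) = outside (?m ` S \<union> ?m ` ?K) - {0}"
    if "arc f" "pathstart f = p" "pathfinish f = q" "S = path_image f" "S \<inter> ?K = {p, q}" "a \<notin> S" for f S
  proof -
    note f = that
    obtain g where g: "simple_path g" "pathfinish g = pathstart g" "S \<union> ?K = path_image g"
      using loop[of f \<kappa>] arcs ends f by metis
    have "a \<notin> S \<union> ?K" using that aK by blast
    from minv_jordan_sides[OF g this] show ?thesis unfolding uni
    proof (elim disjE conjE)
      assume "?m ` (inside (S \<union> ?K) - {a}) = inside (?m ` S \<union> ?m ` ?K) - {0}"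
        "?m ` (outside (S \<union> ?K) - {a}) = outside (?m ` S \<union> ?m ` ?K) - {0}"
      then show ?thesis by (intro exI[of _ "inside (S \<union> ?K)"] exI[of _ "outside (S \<union> ?K)"]) simp
    next
      assume "?m ` (inside (S \<union> ?K) - {a}) = outside (?m ` S \<union> ?m ` ?K) - {0}"
        "?m ` (outside (S \<union> ?K) - {a}) = inside (?m ` S \<union> ?m ` ?K) - {0}"
      then show ?thesis by (intro exI[of _ "outside (S \<union> ?K)"] exI[of _ "inside (S \<union> ?K)"]) (simp add: insert_commute)
    qed
  qed
  obtain X1 Y1 where X1: "{X1, Y1} = {inside (?C1 \<union> ?K), outside (?C1 \<union> ?K)}"
    "?m ` (X1 - {a}) = inside (?m ` ?C1 \<union> ?m ` ?K) - {0}" "?m ` (Y1 - {a}) = outside (?m ` ?C1 \<union> ?m ` ?K) - {0}"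
    using X[OF arcs(1) ends(1,2) refl iK(1) aJ(1)] by (elim exE conjE)
  obtain X2 Y2 where X2: "{X2, Y2} = {inside (?C2 \<union> ?K), outside (?C2 \<union> ?K)}"
    "?m ` (X2 - {a}) = inside (?m ` ?C2 \<union> ?m ` ?K) - {0}" "?m ` (Y2 - {a}) = outside (?m ` ?C2 \<union> ?m ` ?K) - {0}"
    using X[OF arcs(2) ends(3,4) refl iK(2) aJ(2)] by (elim exE conjE)
  have mem: "?m z \<in> ?m ` S \<longleftrightarrow> z \<in> S" for z S using inj_on_minv[of a UNIV] by (auto simp: inj_on_def)
  have nz: "?m z \<noteq> 0" if "z \<noteq> a" for z using that by (simp add: minv_def)
  show ?thesis
  proof
    show "D \<subseteq> X1 \<union> X2 \<union> ?K"
    proof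
      fix z assume z: "z \<in> D"
      then have za: "z \<noteq> a" using a DJ by blast
      have "?m z \<in> inside (?m ` ?C1 \<union> ?m ` ?C2)" using z side(1) uni by (metis DiffD1 imageI)
      then consider "?m z \<in> inside (?m ` ?C1 \<union> ?m ` ?K)" | "?m z \<in> inside (?m ` ?C2 \<union> ?m ` ?K)" | "?m z \<in> ?m ` ?K"
        unfolding split(2)[symmetric] by blast
      then show "z \<in> X1 \<union> X2 \<union> ?K"
      proof cases
        case 1
        then have "?m z \<in> ?m ` (X1 - {a})" using X1(2) nz[OF za] by simp
        then have "z \<in> X1 - {a}" by (simp only: mem)
        then show ?thesis by simp
      next
        case 2
        then have "?m z \<in> ?m ` (X2 - {a})" using X2(2) nz[OF za] by simp
        then have "z \<in> X2 - {a}" by (simp only: mem)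
        then show ?thesis by simp
      next
        case 3
        then have "z \<in> ?K" by (simp only: mem)
        then show ?thesis by simp
      qed
    qed
    have out: "E - {a} \<subseteq> Y" if Y: "?m ` (Y - {a}) = outside (?m ` S \<union> ?m ` ?K) - {0}"
      and S: "S = ?C1 \<or> S = ?C2" for Y S
    proof
      fix z assume z: "z \<in> E - {a}"
      then have "?m z \<in> outside (?m ` ?C1 \<union> ?m ` ?C2)" using side(2) uni by (metis DiffD1 imageI)
      then have "?m z \<notin> inside (?m ` ?C1 \<union> ?m ` ?C2)" by (auto simp: inside_outside)
      then have "?m z \<notin> inside (?m ` S \<union> ?m ` ?K)" unfolding split(2)[symmetric] using S by auto
      moreover have "z \<notin> S" "z \<notin> ?K" using z S DJ K inC by blast+
      then have "?m z \<notin> ?m ` S" "?m z \<notin> ?m ` ?K" by (simp_all only: mem not_False_eq_True)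
      ultimately have "?m z \<in> outside (?m ` S \<union> ?m ` ?K)" by (simp add: outside_inside)
      moreover have "?m z \<noteq> 0" using nz z by simp
      ultimately have "?m z \<in> ?m ` (Y - {a})" unfolding Y by simp
      then have "z \<in> Y - {a}" by (simp only: mem)
      then show "z \<in> Y" by simp
    qed
    show "E - {a} \<subseteq> Y1" "E - {a} \<subseteq> Y2" using out X1(3) X2(3) by blast+
  qed (use X1 X2 in blast)+
qed

text \<open>The inside is open, nonempty and simply connected, so the Riemann mapping theorem
  applies.\<close>

lemma jordan_inside_homeomorphic_disc:
  fixes c :: "real \<Rightarrow> complex"
  assumes "simple_path c" "pathfinish c = pathstart c"
  shows "inside (path_image c) homeomorphic ball (0::complex) 1"
  using assms Jordan_inside_outside[OF assms] simply_connected_inside_simple_path[OF assms(1)]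
  by (metis simply_connected_eq_homeomorphic_to_disc)

section \<open>Polygonal arcs parametrized by Finsler length\<close>

text \<open>The length of a straight segment. The metric is an explicit argument because lengths in
  two different metrics are compared later.\<close>

definition seg :: "(complex \<Rightarrow> complex \<Rightarrow> real) \<Rightarrow> complex \<Rightarrow> complex \<Rightarrow> real" where
  "seg F p q = integral {0..1} (\<lambda>t. F (linepath p q t) (q - p))"

text \<open>A reversible continuous Finsler metric in coordinates: \<open>F z v\<close> is the norm
  of the vector \<open>v\<close> at the point \<open>z\<close>. The coordinates are complex numbers
  because Jordan curves and inversions live there.\<close>

locale plane_finsler =
  fixes F :: "complex \<Rightarrow> complex \<Rightarrow> real"
  assumes F_continuous: "continuous_on UNIV (\<lambda>(z, v). F z v)"
    and F_norm: "asymmetric_norm (F z)"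
    and F_minus: "F z (- v) = F z v"
begin

lemma F_nonneg: "0 \<le> F z v"
  and F_eq_0_iff: "F z v = 0 \<longleftrightarrow> v = 0"
  and F_triangle: "F z (u + v) \<le> F z u + F z v"
  using F_norm[of z] by (auto simp: asymmetric_norm_def)

lemma F_pos: "v \<noteq> 0 \<Longrightarrow> 0 < F z v"
  using F_nonneg[of z v] F_eq_0_iff[of z v] by linarith

lemma F_scaleR: "F z (r *\<^sub>R v) = \<bar>r\<bar> * F z v"
proof -
  have pos: "F z (r *\<^sub>R v) = r * F z v" if "r > 0" for r v
    using F_norm[of z] that by (auto simp: asymmetric_norm_def)
  consider "r > 0" | "r = 0" | "r < 0" by linarith
  then show ?thesis
  proof cases
    case 3
    then show ?thesis using pos[of "- r" "- v"] F_minus[of z v] by simp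
  qed (use pos F_eq_0_iff[of z 0] in auto)
qed

lemma continuous_on_F:
  assumes "continuous_on S f" "continuous_on S g"
  shows "continuous_on S (\<lambda>t. F (f t) (g t))"
  using continuous_on_compose2[OF F_continuous continuous_on_Pair[OF assms]] by simp

text \<open>\<open>F\<close> attains its extrema on the compact product of \<open>K\<close> with the
  unit circle; homogeneity extends the bounds to all vectors.\<close>

lemma F_bounds:
  assumes "compact K"
  obtains m M where "0 < m" "0 < M" "\<And>z v. z \<in> K \<Longrightarrow> m * norm v \<le> F z v" "\<And>z v. z \<in> K \<Longrightarrow> F z v \<le> M * norm v"
proof (cases "K = {}")
  case True
  then show ?thesis using that[of 1 1] by simp
next
  case False
  let ?S = "K \<times> sphere (0::complex) 1"
  have c: "compact ?S" "?S \<noteq> {}" using assms False by (auto intro: compact_Times)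
  have cont: "continuous_on ?S (\<lambda>p. F (fst p) (snd p))"
    by (intro continuous_on_F continuous_intros)
  obtain a where a: "a \<in> ?S" "\<And>p. p \<in> ?S \<Longrightarrow> F (fst a) (snd a) \<le> F (fst p) (snd p)"
    using continuous_attains_inf[OF c cont] by blast
  obtain b where b: "b \<in> ?S" "\<And>p. p \<in> ?S \<Longrightarrow> F (fst p) (snd p) \<le> F (fst b) (snd b)"
    using continuous_attains_sup[OF c cont] by blast
  have pos: "0 < F (fst a) (snd a)" "0 < F (fst b) (snd b)" using a(1) b(1) by (auto intro!: F_pos)
  have eq: "F z v = norm v * F z (sgn v)" for z v
  proof (cases "v = 0")
    case False
    then have "norm v *\<^sub>R sgn v = v" by (simp add: sgn_div_norm)
    then show ?thesis using F_scaleR[of z "norm v" "sgn v"] by simp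
  qed (use F_eq_0_iff in simp)
  have "F (fst a) (snd a) * norm v \<le> F z v \<and> F z v \<le> F (fst b) (snd b) * norm v" if "z \<in> K" for z v
  proof (cases "v = 0")
    case True then show ?thesis using F_eq_0_iff[of z v] by simp
  next
    case False
    then have "(z, sgn v) \<in> ?S" using that by (simp add: norm_sgn)
    from a(2)[OF this] b(2)[OF this] show ?thesis
      unfolding eq[of z v] by (simp add: mult.commute mult_left_mono)
  qed
  then show ?thesis using that[OF pos] by blast
qed

text \<open>Passing to a part of the segment scales the velocity by \<open>t - s\<close>;
  homogeneity turns this factor into the one of the substitution. Additivity of length along a
  segment follows.\<close>

lemma seg_part:
  assumes "0 \<le> s" "s \<le> t" "t \<le> 1"
  shows "seg F (linepath p q s) (linepath p q t) = integral {s..t} (\<lambda>\<tau>. F (linepath p q \<tau>) (q - p))"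
proof -
  let ?k = "\<lambda>\<tau>. F (linepath p q \<tau>) (q - p)"
  have ck: "continuous_on A ?k" for A by (intro continuous_on_F continuous_on_linepath continuous_intros)
  have d: "linepath p q t - linepath p q s = (t - s) *\<^sub>R (q - p)"
    by (simp add: linepath_def algebra_simps)
  have l: "linepath (linepath p q s) (linepath p q t) \<tau> = linepath p q (s + (t - s) * \<tau>)" for \<tau>
    by (simp add: linepath_def algebra_simps)
  have "((\<lambda>\<tau>. (t - s) *\<^sub>R ?k (s + (t - s) * \<tau>)) has_integral (integral {s + (t - s) * 0..s + (t - s) * 1} ?k)) {0..1}"
  proof (rule has_integral_substitution[where c = s and d = t])
    show "(\<lambda>\<tau>. s + (t - s) * \<tau>) ` {0..1} \<subseteq> {s..t}"
    proof safe
      fix x :: real assume "x \<in> {0..1}"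
      then have "0 \<le> (t - s) * x" "(t - s) * x \<le> (t - s) * 1" using assms by (auto intro: mult_left_mono simp del: mult_1_right)
      then show "s + (t - s) * x \<in> {s..t}" by simp
    qed
  qed (use assms ck in \<open>auto intro!: derivative_eq_intros\<close>)
  then have "integral {0..1} (\<lambda>\<tau>. (t - s) *\<^sub>R ?k (s + (t - s) * \<tau>)) = integral {s + (t - s) * 0..s + (t - s) * 1} ?k"
    by (rule integral_unique)
  then have "integral {0..1} (\<lambda>\<tau>. (t - s) *\<^sub>R ?k (s + (t - s) * \<tau>)) = integral {s..t} ?k"
    by (simp only: mult_zero_right mult_1_right add_0_right add_diff_cancel_left' diff_add_cancel add.commute[of s])
  then show ?thesis unfolding seg_def l d F_scaleR using assms by (simp only: real_scaleR_def abs_of_nonneg diff_ge_0_iff_ge)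
qed

lemma seg_nonneg: "0 \<le> seg F p q"
  unfolding seg_def
  by (rule integral_nonneg) (auto intro!: integrable_continuous_real continuous_on_F continuous_on_linepath continuous_intros F_nonneg)

lemma seg_refl [simp]: "seg F p p = 0"
  using F_eq_0_iff[of _ 0] by (simp add: seg_def)

lemma seg_commute: "seg F p q = seg F q p"
proof -
  let ?k = "\<lambda>t. F (linepath p q t) (q - p)"
  have "(?k has_integral seg F p q) {0..1}"
    unfolding seg_def by (intro integrable_integral integrable_continuous_real continuous_on_F continuous_on_linepath continuous_intros)
  then have "((\<lambda>x. ?k (- 1 * x + 1)) has_integral seg F p q) ((\<lambda>x. (1/(-1)) * x + -((1/(-1)) * 1)) ` {0..1})"
    using has_integral_affinity01[of ?k "seg F p q" "-1" 1] by (simp add: algebra_simps)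
  moreover have "(\<lambda>x. (1/(-1)) * x + -((1/(-1)) * 1)) ` {0..1} = {0..1::real}"
    using image_affinity_atLeastAtMost[of "-1" 1 0 "1::real"] by (simp add: algebra_simps)
  moreover have "?k (- 1 * x + 1) = F (linepath q p x) (p - q)" for x
    using F_minus[of "linepath q p x" "p - q"] by (simp add: linepath_def algebra_simps)
  ultimately show ?thesis by (simp add: seg_def integral_unique)
qed

lemma seg_bounds:
  assumes "\<And>z. z \<in> closed_segment p q \<Longrightarrow> m * norm (q - p) \<le> F z (q - p)"
    and "\<And>z. z \<in> closed_segment p q \<Longrightarrow> F z (q - p) \<le> M * norm (q - p)"
  shows "m * norm (q - p) \<le> seg F p q" "seg F p q \<le> M * norm (q - p)"
proof -
  have int: "(\<lambda>t. F (linepath p q t) (q - p)) integrable_on {0..1}"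
    by (intro integrable_continuous_real continuous_on_F continuous_on_linepath continuous_intros)
  have "linepath p q t \<in> closed_segment p q" if "t \<in> {0..1}" for t
    using that linepath_in_path by blast
  then have "integral {0..1} (\<lambda>t::real. m * norm (q - p)) \<le> seg F p q" "seg F p q \<le> integral {0..1} (\<lambda>t::real. M * norm (q - p))"
    unfolding seg_def by (intro integral_le int integrable_const_ivl; use assms in blast)+
  then show "m * norm (q - p) \<le> seg F p q" "seg F p q \<le> M * norm (q - p)" by simp_all
qed

lemma seg_pos:
  assumes "p \<noteq> q" shows "0 < seg F p q"
proof -
  obtain m M where m: "0 < m" "\<And>z v. z \<in> closed_segment p q \<Longrightarrow> m * norm v \<le> F z v"
    "\<And>z v. z \<in> closed_segment p q \<Longrightarrow> F z v \<le> M * norm v"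
    using F_bounds[of "closed_segment p q"] compact_segment by metis
  have "m * norm (q - p) \<le> seg F p q" using seg_bounds(1)[of p q m M] m by blast
  moreover have "0 < m * norm (q - p)" using m(1) assms by simp
  ultimately show ?thesis by linarith
qed

lemma seg_linepath_add:
  assumes "0 \<le> s" "s \<le> t" "t \<le> u" "u \<le> 1"
  shows "seg F (linepath p q s) (linepath p q u) =
    seg F (linepath p q s) (linepath p q t) + seg F (linepath p q t) (linepath p q u)"
  using assms by (simp add: seg_part)
    (intro Henstock_Kurzweil_Integration.integral_combine[symmetric] integrable_continuous_real
      continuous_on_F continuous_on_linepath continuous_intros, auto)

lemma seg_split:
  assumes "x \<in> closed_segment p q"
  shows "seg F p q = seg F p x + seg F x q"
proof -
  obtain t where "0 \<le> t" "t \<le> 1" "x = linepath p q t"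
    using assms by (auto simp: path_image_linepath[symmetric] path_image_def simp del: path_image_linepath)
  then show ?thesis using seg_linepath_add[of 0 t 1 p q] by (simp add: linepath_0' linepath_1')
qed

text \<open>Polygonal curves parametrized by their \<open>F\<close>-length. The clause for a single
  segment speaks of all subintervals, so that restriction, shift and reversal preserve it without
  any formula for the parametrization, which the varying metric makes nonlinear.\<close>

inductive uarc :: "(real \<Rightarrow> complex) \<Rightarrow> real \<Rightarrow> real \<Rightarrow> bool" where
  uarc_segI: "a \<le> b \<Longrightarrow> continuous_on {a..b} g \<Longrightarrow>
    (\<And>x y. a \<le> x \<Longrightarrow> x \<le> y \<Longrightarrow> y \<le> b \<Longrightarrow>
      g ` {x..y} = closed_segment (g x) (g y) \<and> seg F (g x) (g y) = y - x) \<Longrightarrow> uarc g a b"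
| uarc_trans: "uarc g a b \<Longrightarrow> uarc g b c \<Longrightarrow> uarc g a c"

lemma uarc_le: "uarc g a b \<Longrightarrow> a \<le> b"
  by (induction rule: uarc.induct) auto

lemma uarc_continuous: "uarc g a b \<Longrightarrow> continuous_on {a..b} g"
proof (induction rule: uarc.induct)
  case (uarc_trans g a b c)
  then have "{a..c} = {a..b} \<union> {b..c}" using uarc_le[of g a b] uarc_le[of g b c] by auto
  then show ?case using uarc_trans by (simp add: continuous_on_closed_Un)
qed auto

lemma uarc_cong: "uarc g a b \<Longrightarrow> (\<And>x. x \<in> {a..b} \<Longrightarrow> h x = g x) \<Longrightarrow> uarc h a b"
proof (induction rule: uarc.induct)
  case (uarc_segI a b g)
  show ?case
  proof (rule uarc.uarc_segI)
    show "continuous_on {a..b} h" by (rule continuous_on_eq[OF uarc_segI(2)]) (use uarc_segI(4) in simp)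
    fix x y assume xy: "a \<le> x" "x \<le> y" "y \<le> b"
    then have "h ` {x..y} = g ` {x..y}" "h x = g x" "h y = g y"
      using uarc_segI(4) by (auto intro!: image_cong)
    then show "h ` {x..y} = closed_segment (h x) (h y) \<and> seg F (h x) (h y) = y - x"
      using uarc_segI(3)[OF xy] by simp
  qed (rule uarc_segI)
next
  case (uarc_trans g a b c)
  have "uarc h a b" using uarc_trans uarc_le[OF uarc_trans(2)] by auto
  moreover have "uarc h b c" using uarc_trans uarc_le[OF uarc_trans(1)] by auto
  ultimately show ?case by (rule uarc.uarc_trans)
qed

lemma uarc_restrict: "uarc g a b \<Longrightarrow> a \<le> s \<Longrightarrow> s \<le> t \<Longrightarrow> t \<le> b \<Longrightarrow> uarc g s t"
proof (induction arbitrary: s t rule: uarc.induct)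
  case (uarc_segI a b g)
  then show ?case
    by (intro uarc.uarc_segI) (auto intro: continuous_on_subset)
next
  case (uarc_trans g a b c)
  consider "t \<le> b" | "b \<le> s" | "s \<le> b" "b \<le> t" by linarith
  then show ?case
  proof cases
    case 3
    then have "uarc g s b" "uarc g b t" using uarc_trans by auto
    then show ?thesis by (rule uarc.uarc_trans)
  qed (use uarc_trans in auto)
qed

lemma uarc_shift: "uarc g a b \<Longrightarrow> uarc (\<lambda>t. g (t - c)) (a + c) (b + c)"
proof (induction rule: uarc.induct)
  case (uarc_segI a b g)
  show ?case
  proof (rule uarc.uarc_segI)
    show "continuous_on {a + c..b + c} (\<lambda>t. g (t - c))"
      by (rule continuous_on_compose2[OF uarc_segI(2)]) (auto intro!: continuous_intros)
    fix x y assume xy: "a + c \<le> x" "x \<le> y" "y \<le> b + c"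
    have "(\<lambda>t. t - c) ` {x..y} = {x - c..y - c}" by simp
    then have "(\<lambda>t. g (t - c)) ` {x..y} = g ` {x - c..y - c}" by (metis image_image)
    then show "(\<lambda>t. g (t - c)) ` {x..y} = closed_segment (g (x - c)) (g (y - c)) \<and> seg F (g (x - c)) (g (y - c)) = y - x"
      using uarc_segI(3)[of "x - c" "y - c"] xy by simp
  qed (use uarc_segI in simp)
qed (rule uarc.uarc_trans)

lemma uarc_reflect: "uarc g a b \<Longrightarrow> uarc (\<lambda>t. g (c - t)) (c - b) (c - a)"
proof (induction rule: uarc.induct)
  case (uarc_segI a b g)
  show ?case
  proof (rule uarc.uarc_segI)
    show "continuous_on {c - b..c - a} (\<lambda>t. g (c - t))"
      by (rule continuous_on_compose2[OF uarc_segI(2)]) (auto intro!: continuous_intros)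
    fix x y assume xy: "c - b \<le> x" "x \<le> y" "y \<le> c - a"
    have "(\<lambda>t. c - t) ` {x..y} = {c - y..c - x}" by simp
    then have "(\<lambda>t. g (c - t)) ` {x..y} = g ` {c - y..c - x}" by (metis image_image)
    then show "(\<lambda>t. g (c - t)) ` {x..y} = closed_segment (g (c - x)) (g (c - y)) \<and> seg F (g (c - x)) (g (c - y)) = y - x"
      using uarc_segI(3)[of "c - y" "c - x"] xy by (simp add: closed_segment_commute seg_commute)
  qed (use uarc_segI in simp)
qed (rule uarc.uarc_trans)

definition parc :: "complex \<Rightarrow> complex \<Rightarrow> complex set \<Rightarrow> real \<Rightarrow> bool" where
  "parc p q S l \<longleftrightarrow> (\<exists>g. uarc g 0 l \<and> inj_on g {0..l} \<and> g 0 = p \<and> g l = q \<and> S = g ` {0..l})"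

lemma parc_nonneg: "parc p q S l \<Longrightarrow> 0 \<le> l"
  using uarc_le by (auto simp: parc_def)

lemma parc_ends: "parc p q S l \<Longrightarrow> p \<in> S \<and> q \<in> S"
  using uarc_le by (fastforce simp: parc_def)

lemma parc_compact: "parc p q S l \<Longrightarrow> compact S"
  by (auto simp: parc_def intro: compact_continuous_image uarc_continuous)

text \<open>The length \<open>E t\<close> of an initial piece is continuous and strictly increasing
  in the affine parameter; its inverse \<open>h\<close> gives the parametrization by length.\<close>

lemma parc_segment: "parc p q (closed_segment p q) (seg F p q)"
proof (cases "p = q")
  case True
  have "uarc (\<lambda>_. p) 0 0" by (rule uarc_segI) auto
  then show ?thesis using True unfolding parc_def by (intro exI[of _ "\<lambda>_. p"]) auto
next
  case False
  define E where "E t = seg F p (linepath p q t)" for t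
  have E: "E t = integral {0..t} (\<lambda>\<tau>. F (linepath p q \<tau>) (q - p))" if "t \<in> {0..1}" for t
    using seg_part[of 0 t p q] that by (simp add: E_def linepath_0')
  have contE: "continuous_on {0..1} E"
  proof -
    have "continuous_on {0..1} (\<lambda>t. integral {0..t} (\<lambda>\<tau>. F (linepath p q \<tau>) (q - p)))"
      by (intro indefinite_integral_continuous_1 integrable_continuous_real continuous_on_F continuous_on_linepath continuous_intros)
    then show ?thesis by (rule continuous_on_eq) (use E in simp)
  qed
  have diff: "E t - E s = seg F (linepath p q s) (linepath p q t)" if "0 \<le> s" "s \<le> t" "t \<le> 1" for s t
    using seg_linepath_add[of 0 s t p q] that by (simp add: E_def linepath_0')
  have injl: "linepath p q s = linepath p q t \<longleftrightarrow> s = t" for s t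
  proof -
    have "linepath p q s - linepath p q t = (s - t) *\<^sub>R (q - p)" by (simp add: linepath_def algebra_simps)
    then show ?thesis using False by (metis diff_eq_diff_eq eq_iff_diff_eq_0 scaleR_eq_0_iff)
  qed
  have mono: "E s < E t" if "0 \<le> s" "s < t" "t \<le> 1" for s t
    using diff[of s t] seg_pos[of "linepath p q s" "linepath p q t"] injl[of s t] that by auto
  have inj: "inj_on E {0..1}"
    by (rule linorder_inj_onI) (use mono in \<open>auto simp: order.strict_iff_order\<close>)
  have E01: "E 0 = 0" "E 1 = seg F p q" by (auto simp: E_def linepath_0' linepath_1')
  have imE: "E ` {s..t} = {E s..E t}" if "0 \<le> s" "s \<le> t" "t \<le> 1" for s t
  proof
    show "E ` {s..t} \<subseteq> {E s..E t}"
      using mono that by (auto simp: order.order_iff_strict)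
    show "{E s..E t} \<subseteq> E ` {s..t}"
    proof
      fix y assume "y \<in> {E s..E t}"
      then show "y \<in> E ` {s..t}"
        using IVT'[of E s y t] that continuous_on_subset[OF contE, of "{s..t}"] by fastforce
    qed
  qed
  obtain h where h: "homeomorphism {0..1} {0..seg F p q} E h"
    using homeomorphism_compact[OF _ contE imE[of 0 1] inj] E01 by auto
  define g where "g = linepath p q \<circ> h"
  have hm: "h y \<in> {0..1}" "E (h y) = y" if "y \<in> {0..seg F p q}" for y
    using h that by (auto simp: homeomorphism_def)
  have hE: "h (E t) = t" if "t \<in> {0..1}" for t using h that by (auto simp: homeomorphism_def)
  have him: "h ` {x..y} = {h x..h y} \<and> h x \<le> h y" if "0 \<le> x" "x \<le> y" "y \<le> seg F p q" for x y
  proof -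
    have le: "h x \<le> h y" using mono[of "h y" "h x"] hm[of x] hm[of y] that by fastforce
    have "{x..y} = E ` {h x..h y}" using imE[of "h x" "h y"] hm[of x] hm[of y] that le by auto
    then have "h ` {x..y} = (\<lambda>t. h (E t)) ` {h x..h y}" by (simp add: image_image)
    also have "\<dots> = {h x..h y}" using hE hm[of x] hm[of y] that by (auto simp: image_def)
    finally show ?thesis using le by simp
  qed
  have l0: "0 \<le> seg F p q" by (rule seg_nonneg)
  have im: "linepath p q ` {s..t} = closed_segment (linepath p q s) (linepath p q t)" if "s \<le> t" for s t
  proof -
    have "closed_segment (linepath p q s) (linepath p q t) = linepath p q ` closed_segment s t"
      using closed_segment_linear_image[of "\<lambda>x. x *\<^sub>R (q - p)" s t]
        closed_segment_translation[of p "s *\<^sub>R (q - p)" "t *\<^sub>R (q - p)"]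
      by (simp add: linepath_def algebra_simps image_image linear_iff)
    then show ?thesis using that by (simp add: closed_segment_eq_real_ivl)
  qed
  have "uarc g 0 (seg F p q)"
  proof (rule uarc_segI[OF l0])
    show "continuous_on {0..seg F p q} g"
      unfolding g_def using h by (intro continuous_on_compose continuous_on_linepath) (auto simp: homeomorphism_def)
    fix x y assume xy: "0 \<le> x" "x \<le> y" "y \<le> seg F p q"
    have "g ` {x..y} = closed_segment (g x) (g y)"
    proof -
      have "g ` {x..y} = linepath p q ` (h ` {x..y})" by (simp only: g_def image_comp)
      then show ?thesis using him[OF xy] im by (simp add: g_def)
    qed
    moreover have "seg F (g x) (g y) = y - x"
      using diff[of "h x" "h y"] hm[of x] hm[of y] him[OF xy] xy by (simp add: g_def)
    ultimately show "g ` {x..y} = closed_segment (g x) (g y) \<and> seg F (g x) (g y) = y - x" by blast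
  qed
  moreover have "inj_on g {0..seg F p q}"
    unfolding g_def o_def by (rule inj_onI) (metis injl hm(2))
  moreover have h0: "h 0 = 0" "h (seg F p q) = 1" using hE[of 0] hE[of 1] E01 by auto
  moreover have "g ` {0..seg F p q} = closed_segment p q"
  proof -
    have "g ` {0..seg F p q} = linepath p q ` (h ` {0..seg F p q})" by (simp only: g_def image_comp)
    then show ?thesis using him[of 0 "seg F p q"] l0 h0 im[of 0 1] by (simp add: linepath_0' linepath_1')
  qed
  ultimately show ?thesis unfolding parc_def
    by (intro exI[of _ g]) (simp add: g_def linepath_0' linepath_1')
qed

lemma parc_reverse: "parc p q S l \<Longrightarrow> parc q p S l"
proof -
  assume "parc p q S l"
  then obtain g where g: "uarc g 0 l" "inj_on g {0..l}" "g 0 = p" "g l = q" "S = g ` {0..l}"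
    by (auto simp: parc_def)
  have "uarc (\<lambda>t. g (l - t)) 0 l" using uarc_reflect[OF g(1), of l] by simp
  moreover have "inj_on (\<lambda>t. g (l - t)) {0..l}"
  proof (rule inj_onI)
    fix x y assume "x \<in> {0..l}" "y \<in> {0..l}" "g (l - x) = g (l - y)"
    then have "l - x = l - y" using inj_onD[OF g(2)] by auto
    then show "x = y" by simp
  qed
  moreover have "(\<lambda>t. l - t) ` {0..l} = {0..l}" by simp
  then have "(\<lambda>t. g (l - t)) ` {0..l} = S" unfolding g(5) by (metis image_image)
  ultimately show ?thesis using g unfolding parc_def by (intro exI[of _ "\<lambda>t. g (l - t)"]) auto
qed

lemma parc_of_uarc:
  assumes "uarc g a b" "a \<le> s" "s \<le> t" "t \<le> b" "inj_on g {s..t}"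
  shows "parc (g s) (g t) (g ` {s..t}) (t - s)"
proof -
  have "uarc (\<lambda>x. g (x + s)) 0 (t - s)"
    using uarc_shift[OF uarc_restrict[OF assms(1-4)], of "- s"] by simp
  moreover have "inj_on (\<lambda>x. g (x + s)) {0..t - s}"
  proof (rule inj_onI)
    fix x y assume "x \<in> {0..t - s}" "y \<in> {0..t - s}" "g (x + s) = g (y + s)"
    then have "x + s = y + s" by (intro inj_onD[OF assms(5)]) auto
    then show "x = y" by simp
  qed
  moreover have "(\<lambda>x. x + s) ` {0..t - s} = {s..t}" by simp
  then have "(\<lambda>x. g (x + s)) ` {0..t - s} = g ` {s..t}" by (metis image_image)
  ultimately show ?thesis unfolding parc_def by (intro exI[of _ "\<lambda>x. g (x + s)"]) auto
qed

lemma uarc_glue: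
  assumes g: "uarc g 0 l" and h: "uarc h 0 m" and eq: "g l = h 0"
  defines "f \<equiv> \<lambda>t. if t \<le> l then g t else h (t - l)"
  shows "uarc f 0 (l + m)" "f ` {0..l + m} = g ` {0..l} \<union> h ` {0..m}"
proof -
  have lm: "0 \<le> l" "0 \<le> m" using uarc_le g h by auto
  have fh: "f t = h (t - l)" if "l \<le> t" for t using that eq by (auto simp: f_def)
  have "uarc f 0 l" by (rule uarc_cong[OF g]) (simp add: f_def)
  moreover have "uarc (\<lambda>t. h (t - l)) l (l + m)" using uarc_shift[OF h, of l] by (simp add: add.commute)
  then have "uarc f l (l + m)" by (rule uarc_cong) (simp add: fh)
  ultimately show "uarc f 0 (l + m)" by (rule uarc_trans)
  have "f ` {0..l + m} = f ` {0..l} \<union> f ` {l..l + m}"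
    using ivl_disj_un_two_touch(4)[of 0 l "l + m"] lm by (metis image_Un le_add_same_cancel1)
  also have "f ` {0..l} = g ` {0..l}" by (auto simp: f_def)
  also have "f ` {l..l + m} = (\<lambda>t. h (t - l)) ` {l..l + m}" using fh by (intro image_cong) auto
  also have "\<dots> = h ` ((\<lambda>t. t - l) ` {l..l + m})" by (simp only: image_image)
  also have "\<dots> = h ` {0..m}" by simp
  finally show "f ` {0..l + m} = g ` {0..l} \<union> h ` {0..m}" .
qed

lemma parc_join:
  assumes "parc p q S l" "parc q r T m" "S \<inter> T \<subseteq> {q}"
  shows "parc p r (S \<union> T) (l + m)"
proof -
  obtain g where g: "uarc g 0 l" "inj_on g {0..l}" "g 0 = p" "g l = q" "S = g ` {0..l}"
    using assms(1) by (auto simp: parc_def)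
  obtain h where h: "uarc h 0 m" "inj_on h {0..m}" "h 0 = q" "h m = r" "T = h ` {0..m}"
    using assms(2) by (auto simp: parc_def)
  define f where "f t = (if t \<le> l then g t else h (t - l))" for t
  have lm: "0 \<le> l" "0 \<le> m" using uarc_le g h by auto
  note glue = uarc_glue[OF g(1) h(1), unfolded g(4) h(3), OF refl, folded f_def]
  have hne: "h (t - l) \<notin> S" if "l < t" "t \<le> l + m" for t
  proof
    assume "h (t - l) \<in> S"
    then have "h (t - l) = h 0" using assms(3) h that by fastforce
    then show False using h(2) that lm by (auto dest: inj_onD)
  qed
  have "x = y" if "x \<in> {0..l + m}" "y \<in> {0..l + m}" "f x = f y" for x y
  proof -
    consider "x \<le> l" "y \<le> l" | "l < x" "l < y" | "x \<le> l" "l < y" | "l < x" "y \<le> l" by linarith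
    then show ?thesis
    proof cases
      case 1 then show ?thesis using that g(2) by (auto simp: f_def dest: inj_onD)
    next
      case 2
      then have "h (x - l) = h (y - l)" using that by (simp add: f_def)
      then have "x - l = y - l" by (rule inj_onD[OF h(2)]) (use 2 that in auto)
      then show ?thesis by simp
    next
      case 3
      then have "g x = h (y - l)" using that by (simp add: f_def)
      moreover have "g x \<in> S" unfolding g(5) using 3 that by (intro imageI) auto
      ultimately have "h (y - l) \<in> S" by simp
      then show ?thesis using that hne[of y] 3 by auto
    next
      case 4
      then have "g y = h (x - l)" using that by (simp add: f_def)
      moreover have "g y \<in> S" unfolding g(5) using 4 that by (intro imageI) auto
      ultimately have "h (x - l) \<in> S" by simp
      then show ?thesis using that hne[of x] 4 by auto
    qed
  qed
  then have "inj_on f {0..l + m}" by (rule inj_onI)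
  moreover have "f 0 = p" "f (l + m) = r" using g h lm by (auto simp: f_def)
  ultimately show ?thesis using glue g(5) h(5) unfolding parc_def by blast
qed

text \<open>Loop erasure: leave the arc at its point on the segment that is closest to \<open>y\<close>.\<close>

lemma parc_extend:
  assumes "parc p x S k" "p \<notin> closed_segment x y"
  obtains S' k' where "parc p y S' k'" "k' \<le> k + seg F x y" "S' \<subseteq> S \<union> closed_segment x y"
proof -
  obtain g where g: "uarc g 0 k" "inj_on g {0..k}" "g 0 = p" "g k = x" "S = g ` {0..k}"
    using assms(1) by (auto simp: parc_def)
  have cS: "compact S" using parc_compact[OF assms(1)] .
  have xS: "x \<in> S" using parc_ends[OF assms(1)] by blast
  define A where "A = S \<inter> closed_segment x y"
  have "compact A" "A \<noteq> {}" using cS xS by (auto simp: A_def)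
  then obtain z where z: "z \<in> A" "\<And>w. w \<in> A \<Longrightarrow> dist y z \<le> dist y w"
    using distance_attains_inf[of A y] compact_imp_closed by metis
  obtain r where r: "r \<in> {0..k}" "z = g r" using z(1) g(5) by (auto simp: A_def)
  have "parc p z (g ` {0..r}) r"
    using parc_of_uarc[OF g(1), of 0 r] r g(3) inj_on_subset[OF g(2), of "{0..r}"] by simp
  moreover have "parc z y (closed_segment z y) (seg F z y)" by (rule parc_segment)
  moreover have "g ` {0..r} \<inter> closed_segment z y \<subseteq> {z}"
  proof
    fix w assume w: "w \<in> g ` {0..r} \<inter> closed_segment z y"
    have sub: "closed_segment z y \<subseteq> closed_segment x y"
      using z(1) by (intro closed_segment_subset convex_closed_segment) (auto simp: A_def)
    then have "w \<in> A" using w r g(5) by (auto simp: A_def)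
    then have "dist y z \<le> dist y w" by (rule z(2))
    moreover have "dist z y = dist z w + dist w y"
      using w between_mem_segment[of z y w] by (simp add: between)
    ultimately show "w \<in> {z}" 
      using dist_commute[of y z] dist_commute[of y w] zero_le_dist[of z w] by (metis add_le_same_cancel2 dist_eq_0_iff order_antisym singletonI)
  qed
  ultimately have p: "parc p y (g ` {0..r} \<union> closed_segment z y) (r + seg F z y)" by (rule parc_join)
  have zxy: "z \<in> closed_segment x y" using z(1) by (simp add: A_def)
  show ?thesis
  proof (rule that[OF p])
    show "r + seg F z y \<le> k + seg F x y" using seg_split[OF zxy] seg_nonneg[of x z] r by auto
    show "g ` {0..r} \<union> closed_segment z y \<subseteq> S \<union> closed_segment x y"
      using r g(5) zxy closed_segment_subset[of z "closed_segment x y" y] by auto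
  qed
qed

lemma parc_arc:
  assumes "parc p q S l" "p \<noteq> q"
  obtains c where "arc c" "pathstart c = p" "pathfinish c = q" "path_image c = S"
proof -
  obtain g where g: "uarc g 0 l" "inj_on g {0..l}" "g 0 = p" "g l = q" "S = g ` {0..l}"
    using assms(1) by (auto simp: parc_def)
  have l: "0 < l" using uarc_le[OF g(1)] g(3,4) assms(2) by (cases "l = 0") auto
  have im: "(\<lambda>x. l * x) ` {0..1} = {0..l}" using l by (simp add: image_mult_atLeastAtMost)
  show ?thesis
  proof (rule that[of "\<lambda>x. g (l * x)"])
    have "continuous_on {0..1} (\<lambda>x. g (l * x))"
      by (rule continuous_on_compose2[OF uarc_continuous[OF g(1)]]) (use im in \<open>auto intro!: continuous_intros\<close>)
    moreover have "inj_on (\<lambda>x. g (l * x)) {0..1}"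
    proof (rule inj_onI)
      fix x y :: real assume xy: "x \<in> {0..1}" "y \<in> {0..1}" "g (l * x) = g (l * y)"
      then have "l * x \<in> {0..l}" "l * y \<in> {0..l}" using im by blast+
      then show "x = y" using inj_onD[OF g(2) xy(3)] l by simp
    qed
    ultimately show "arc (\<lambda>x. g (l * x))" by (simp add: arc_def path_def)
    show "path_image (\<lambda>x. g (l * x)) = S"
      unfolding path_image_def g(5) im[symmetric] image_image ..
  qed (use g in \<open>auto simp: pathstart_def pathfinish_def\<close>)
qed

section \<open>Simple closed polygons\<close>

definition closedp :: "(real \<Rightarrow> complex) \<Rightarrow> real \<Rightarrow> bool" where
  "closedp g L \<longleftrightarrow> uarc g 0 L \<and> 0 < L \<and> g 0 = g L \<and> inj_on g {0..<L}"

lemma closedp_join: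
  assumes "parc p q S l" "parc q p T m" "S \<inter> T = {p, q}" "p \<noteq> q"
  obtains g where "closedp g (l + m)" "g ` {0..l + m} = S \<union> T"
proof -
  obtain g where g: "uarc g 0 l" "inj_on g {0..l}" "g 0 = p" "g l = q" "S = g ` {0..l}"
    using assms(1) by (auto simp: parc_def)
  obtain h where h: "uarc h 0 m" "inj_on h {0..m}" "h 0 = q" "h m = p" "T = h ` {0..m}"
    using assms(2) by (auto simp: parc_def)
  define f where "f t = (if t \<le> l then g t else h (t - l))" for t
  have "l \<noteq> 0" "m \<noteq> 0" using g h assms(4) by auto
  then have lm: "0 < l" "0 < m" using uarc_le[OF g(1)] uarc_le[OF h(1)] by auto
  note glue = uarc_glue[OF g(1) h(1), unfolded g(4) h(3), OF refl, folded f_def]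
  have hne: "h (t - l) \<notin> S" if "l < t" "t < l + m" for t
  proof
    assume "h (t - l) \<in> S"
    then have "h (t - l) = h 0 \<or> h (t - l) = h m" using assms(3) h that by fastforce
    then show False using h(2) that lm by (auto dest: inj_onD)
  qed
  have "x = y" if "x \<in> {0..<l + m}" "y \<in> {0..<l + m}" "f x = f y" for x y
  proof -
    consider "x \<le> l" "y \<le> l" | "l < x" "l < y" | "x \<le> l" "l < y" | "l < x" "y \<le> l" by linarith
    then show ?thesis
    proof cases
      case 1 then show ?thesis using that g(2) by (auto simp: f_def dest: inj_onD)
    next
      case 2
      then have "h (x - l) = h (y - l)" using that by (simp add: f_def)
      then have "x - l = y - l" by (rule inj_onD[OF h(2)]) (use 2 that in auto)
      then show ?thesis by simp
    next
      case 3
      then have "g x = h (y - l)" using that by (simp add: f_def)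
      moreover have "g x \<in> S" unfolding g(5) using 3 that by (intro imageI) auto
      ultimately have "h (y - l) \<in> S" by simp
      then show ?thesis using that hne[of y] 3 by auto
    next
      case 4
      then have "g y = h (x - l)" using that by (simp add: f_def)
      moreover have "g y \<in> S" unfolding g(5) using 4 that by (intro imageI) auto
      ultimately have "h (x - l) \<in> S" by simp
      then show ?thesis using that hne[of x] 4 by auto
    qed
  qed
  then have "inj_on f {0..<l + m}" by (rule inj_onI)
  moreover have "f 0 = p" "f (l + m) = p" using g h lm by (auto simp: f_def)
  ultimately have "closedp f (l + m)" using glue lm by (simp add: closedp_def)
  then show ?thesis using that glue g(5) h(5) by blast
qed

lemma closedp_inj:
  assumes "closedp g L" "0 \<le> x" "x < y" "y \<le> L" "g x = g y"
  shows "x = 0" "y = L"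
proof -
  have inj: "inj_on g {0..<L}" "g 0 = g L" using assms(1) by (auto simp: closedp_def)
  show "y = L"
  proof (rule ccontr)
    assume "y \<noteq> L" then show False using inj_onD[OF inj(1) assms(5)] assms(2-4) by auto
  qed
  then show "x = 0" using inj_onD[OF inj(1), of x 0] inj(2) assms(2-5) by auto
qed

lemma closedp_simple_path:
  assumes "closedp g L"
  obtains c where "simple_path c" "pathfinish c = pathstart c" "path_image c = g ` {0..L}"
proof
  let ?c = "\<lambda>x. g (L * x)"
  have L: "0 < L" and g: "uarc g 0 L" "g 0 = g L" using assms by (auto simp: closedp_def)
  have im: "(\<lambda>x. L * x) ` {0..1} = {0..L}" using L by (simp add: image_mult_atLeastAtMost)
  have "continuous_on {0..1} ?c"
    by (rule continuous_on_compose2[OF uarc_continuous[OF g(1)]]) (use im in \<open>auto intro!: continuous_intros\<close>)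
  moreover have *: "x = 0 \<and> y = 1" if "x \<in> {0..1}" "y \<in> {0..1}" "?c x = ?c y" "x < y" for x y
  proof -
    have "0 \<le> L * x" "L * x < L * y" "L * y \<le> L" using that L by (auto simp: mult_left_le)
    then have "L * x = 0" "L * y = L" using closedp_inj[OF assms _ _ _ that(3)] by auto
    then show ?thesis using L by simp
  qed
  then have "loop_free ?c" unfolding loop_free_def by (metis linorder_less_linear)
  ultimately show "simple_path ?c" by (simp add: simple_path_def path_def)
  show "path_image ?c = g ` {0..L}" unfolding path_image_def im[symmetric] image_image ..
  show "pathfinish ?c = pathstart ?c" using g by (simp add: pathstart_def pathfinish_def)
qed

text \<open>The complementary arc runs through the base point \<open>g 0 = g L\<close>; hence its
  trace is a union of two images.\<close>

lemma closedp_split: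
  assumes "closedp g L" "0 \<le> s" "s < t" "t \<le> L" "g s \<noteq> g t"
  shows "parc (g s) (g t) (g ` {s..t}) (t - s)"
    "parc (g t) (g s) (g ` {t..L} \<union> g ` {0..s}) (L - (t - s))"
    "g ` {s..t} \<inter> (g ` {t..L} \<union> g ` {0..s}) = {g s, g t}"
    "g ` {s..t} \<union> (g ` {t..L} \<union> g ` {0..s}) = g ` {0..L}"
proof -
  have g: "uarc g 0 L" "g 0 = g L" using assms(1) by (auto simp: closedp_def)
  note inj = closedp_inj[OF assms(1)]
  have sub: "inj_on g {x..y}" if "0 \<le> x" "y \<le> L" "0 < x \<or> y < L" for x y
  proof (rule linorder_inj_onI)
    fix u v assume uv: "u < v" "u \<in> {x..y}" "v \<in> {x..y}"
    then show "g u \<noteq> g v" using inj[of u v] that by auto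
  qed auto
  \<comment> \<open>\<open>g\<close> is injective on a closed interval unless this is all of
    \<open>{0..L}\<close>, a case that \<open>g s \<noteq> g t\<close> excludes.\<close>
  have st: "0 < s \<or> t < L" using assms g(2) by (cases "s = 0"; cases "t = L") auto
  show "parc (g s) (g t) (g ` {s..t}) (t - s)"
    using parc_of_uarc[OF g(1)] assms sub st by auto
  have "parc (g t) (g 0) (g ` {t..L}) (L - t)"
    using parc_of_uarc[OF g(1), of t L] assms sub[of t L] g(2) by auto
  moreover have "parc (g 0) (g s) (g ` {0..s}) s"
    using parc_of_uarc[OF g(1), of 0 s] assms sub[of 0 s] by auto
  moreover have eqs: "x = y \<or> (x = 0 \<and> y = L)" if "g x = g y" "0 \<le> x" "x \<le> y" "y \<le> L" for x y
    using inj[of x y] that by (cases "x = y") auto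
  have "g ` {t..L} \<inter> g ` {0..s} \<subseteq> {g 0}"
  proof
    fix w assume "w \<in> g ` {t..L} \<inter> g ` {0..s}"
    then obtain x y where xy: "w = g y" "w = g x" "y \<in> {t..L}" "x \<in> {0..s}" by blast
    then have "x = y \<or> (x = 0 \<and> y = L)" using assms(3) by (intro eqs) auto
    then show "w \<in> {g 0}" using xy assms(3) by auto
  qed
  ultimately have "parc (g t) (g s) (g ` {t..L} \<union> g ` {0..s}) (L - t + s)" by (rule parc_join)
  then show "parc (g t) (g s) (g ` {t..L} \<union> g ` {0..s}) (L - (t - s))" by (simp add: algebra_simps)
  have "w \<in> {g s, g t}" if "w \<in> g ` {s..t}" "w \<in> g ` {t..L} \<union> g ` {0..s}" for w
  proof -
    have "\<exists>x. w = g x \<and> x \<in> {s..t}" using that(1) by blast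
    then obtain x where x: "w = g x" "x \<in> {s..t}" by blast
    from that(2) consider y where "w = g y" "y \<in> {t..L}" | y where "w = g y" "y \<in> {0..s}" by blast
    then show ?thesis
    proof cases
      case (1 y)
      then have "x = y \<or> (x = 0 \<and> y = L)" using x assms by (intro eqs) auto
      then have "x = t \<or> x = s" using x 1 assms(2) by auto
      then show ?thesis using x(1) by blast
    next
      case (2 y)
      then have "y = x \<or> (y = 0 \<and> x = L)" using x assms by (intro eqs) auto
      then have "x = s \<or> x = t" using x 2 assms(4) by auto
      then show ?thesis using x(1) by blast
    qed
  qed
  then show "g ` {s..t} \<inter> (g ` {t..L} \<union> g ` {0..s}) = {g s, g t}" using assms by auto
  have "{0..L} = {s..t} \<union> ({t..L} \<union> {0..s})" using assms by auto
  then show "g ` {s..t} \<union> (g ` {t..L} \<union> g ` {0..s}) = g ` {0..L}" by (metis image_Un)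
qed

end

section \<open>Short cuts and the Besicovitch inequality\<close>

context plane_finsler begin

text \<open>This is the 1-Lipschitz condition for the inner distance of \<open>D\<close>, tested on
  segments only. Polygonal competitors give it directly, and \<open>seg_lipschitz_curve\<close>
  passes from segments to all curves.\<close>

definition seg_lipschitz :: "complex set \<Rightarrow> (complex \<Rightarrow> real) \<Rightarrow> bool" where
  "seg_lipschitz D h \<longleftrightarrow> (\<forall>x y. closed_segment x y \<subseteq> D \<longrightarrow> \<bar>h y - h x\<bar> \<le> seg F x y)"

lemma seg_lipschitz_local:
  assumes "seg_lipschitz D h" "open D" "x \<in> D"
  obtains r M where "0 < r" "0 < M" "\<And>y. dist y x < r \<Longrightarrow> \<bar>h y - h x\<bar> \<le> M * dist y x"
proof -
  obtain r where r: "0 < r" "cball x r \<subseteq> D" using assms(2,3) open_contains_cball by blast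
  obtain m M where M: "0 < M" "\<And>z v. z \<in> cball x r \<Longrightarrow> m * norm v \<le> F z v"
    "\<And>z v. z \<in> cball x r \<Longrightarrow> F z v \<le> M * norm v"
    using F_bounds[of "cball x r"] by (metis compact_cball)
  have "\<bar>h y - h x\<bar> \<le> M * dist y x" if "dist y x < r" for y
  proof -
    have sub: "closed_segment x y \<subseteq> cball x r"
      using that r by (intro closed_segment_subset convex_cball) (auto simp: dist_commute)
    then have "\<bar>h y - h x\<bar> \<le> seg F x y" using assms(1) r(2) by (auto simp: seg_lipschitz_def)
    also have "\<dots> \<le> M * norm (y - x)" using M sub by (intro seg_bounds(2)[where m = m]) auto
    finally show ?thesis by (simp add: dist_norm)
  qed
  then show ?thesis using that r(1) M(1) by blast
qed

lemma seg_lipschitz_continuous: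
  assumes "seg_lipschitz D h" "open D"
  shows "continuous_on D h"
proof -
  have "isCont h x" if x: "x \<in> D" for x
  proof -
    obtain r M where r: "0 < r" "0 < M" "\<And>y. dist y x < r \<Longrightarrow> \<bar>h y - h x\<bar> \<le> M * dist y x"
      using seg_lipschitz_local[OF assms x] by metis
    have "dist (h y) (h x) < e" if "0 < e" "dist y x < min r (e / M)" for y e
    proof -
      have "M * dist y x < e" using that r by (auto simp: field_simps)
      then show ?thesis using r(3)[of y] that by (simp add: dist_real_def)
    qed
    moreover have "0 < min r (e / M)" if "0 < e" for e using r that by simp
    ultimately show ?thesis unfolding continuous_at_eps_delta by (metis dist_commute)
  qed
  then show ?thesis using assms(2) continuous_on_eq_continuous_at by blast
qed

end

section \<open>Arc length coordinates on the boundary of a square\<close>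

definition circ_dist :: "real \<Rightarrow> real \<Rightarrow> real \<Rightarrow> real" where
  "circ_dist L s t = min \<bar>s - t\<bar> (L - \<bar>s - t\<bar>)"

text \<open>Coordinates of the arc length parametrization, of period \<open>4 * d\<close>, of the boundary of the square
  \<open>[0, d]\<^sup>2\<close>.\<close>

definition sq1 :: "real \<Rightarrow> real \<Rightarrow> real" where
  "sq1 d s = max 0 (min d (min (s - d) (4 * d - s)))"

definition sq2 :: "real \<Rightarrow> real \<Rightarrow> real" where
  "sq2 d s = max 0 (min d (max (d - s) (s - 2 * d)))"

text \<open>On a closed curve run through at unit speed, no coordinate changes by more than the
  shorter arc. This is the condition under which the two coordinates can be prescribed as boundary
  values of an inner distance.\<close>

lemma sq_lipschitz:
  assumes "0 < d" "s \<in> {0..4 * d}" "t \<in> {0..4 * d}"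
  shows "\<bar>sq1 d s - sq1 d t\<bar> \<le> circ_dist (4 * d) s t" "\<bar>sq2 d s - sq2 d t\<bar> \<le> circ_dist (4 * d) s t"
  using assms unfolding sq1_def sq2_def circ_dist_def min_def max_def abs_if atLeastAtMost_iff
  by (smt (verit))+

lemma sq_range:
  assumes "0 < d"
  shows "0 \<le> sq1 d s" "sq1 d s \<le> d" "0 \<le> sq2 d s" "sq2 d s \<le> d"
  using assms by (auto simp: sq1_def sq2_def)

lemma frontier_square:
  "frontier (cbox 0 (Complex d d)) =
    {z. 0 \<le> Re z \<and> Re z \<le> d \<and> 0 \<le> Im z \<and> Im z \<le> d \<and> (Re z = 0 \<or> Re z = d \<or> Im z = 0 \<or> Im z = d)}"
  unfolding frontier_def closure_cbox interior_cbox
  by (auto simp: in_cbox_complex_iff in_box_complex_iff)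

lemma square_param:
  assumes d: "0 < d"
  shows "(\<lambda>s. Complex (sq1 d s) (sq2 d s)) ` {0..4 * d} = frontier (cbox 0 (Complex d d))" (is "?K ` _ = ?Q")
    and "inj_on (\<lambda>s. Complex (sq1 d s) (sq2 d s)) {0..<4 * d}"
    and "continuous_on UNIV (\<lambda>s. Complex (sq1 d s) (sq2 d s))"
    and "Complex (sq1 d 0) (sq2 d 0) = Complex (sq1 d (4 * d)) (sq2 d (4 * d))"
proof -
  \<comment> \<open>The sides in order: from \<open>(0, d)\<close> down to the origin, right, up,
    and back to the left. Thus \<open>sq1\<close> vanishes on the first quarter and
    \<open>sq2\<close> on the second.\<close>
  have a: "sq1 d s = 0 \<and> sq2 d s = d - s" if "0 \<le> s" "s \<le> d" for s
    using that d by (auto simp: sq1_def sq2_def)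
  have b: "sq1 d s = s - d \<and> sq2 d s = 0" if "d \<le> s" "s \<le> 2 * d" for s
    using that d by (auto simp: sq1_def sq2_def)
  have c: "sq1 d s = d \<and> sq2 d s = s - 2 * d" if "2 * d \<le> s" "s \<le> 3 * d" for s
    using that d by (auto simp: sq1_def sq2_def)
  have e: "sq1 d s = 4 * d - s \<and> sq2 d s = d" if "3 * d \<le> s" "s \<le> 4 * d" for s
    using that d by (auto simp: sq1_def sq2_def)
  show "?K ` {0..4 * d} = ?Q"
  proof
    show "?K ` {0..4 * d} \<subseteq> ?Q"
    proof
      fix z assume "z \<in> ?K ` {0..4 * d}"
      then obtain s where s: "z = ?K s" "0 \<le> s" "s \<le> 4 * d" by auto
      consider "s \<le> d" | "d \<le> s" "s \<le> 2 * d" | "2 * d \<le> s" "s \<le> 3 * d" | "3 * d \<le> s" by linarith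
      then show "z \<in> ?Q"
      proof cases
        case 1
        then have "sq1 d s = 0" "sq2 d s = d - s" using a[of s] s by auto
        then show ?thesis using 1 s(2,3) d unfolding s(1) frontier_square by simp
      next
        case 2
        then have "sq1 d s = s - d" "sq2 d s = 0" using b[of s] s by auto
        then show ?thesis using 2 s(2,3) d unfolding s(1) frontier_square by simp
      next
        case 3
        then have "sq1 d s = d" "sq2 d s = s - 2 * d" using c[of s] s by auto
        then show ?thesis using 3 s(2,3) d unfolding s(1) frontier_square by simp
      next
        case 4
        then have "sq1 d s = 4 * d - s" "sq2 d s = d" using e[of s] s by auto
        then show ?thesis using 4 s(2,3) d unfolding s(1) frontier_square by simp
      qed
    qed
    show "?Q \<subseteq> ?K ` {0..4 * d}"
    proof
      fix z assume "z \<in> ?Q"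
      then have z: "0 \<le> Re z" "Re z \<le> d" "0 \<le> Im z" "Im z \<le> d"
        "Re z = 0 \<or> Re z = d \<or> Im z = 0 \<or> Im z = d" unfolding frontier_square by auto
      from z(5) consider "Re z = 0" | "Im z = 0" | "Re z = d" | "Im z = d" by blast
      then have "\<exists>s\<in>{0..4 * d}. sq1 d s = Re z \<and> sq2 d s = Im z"
      proof cases
        case 1 with a[of "d - Im z"] z(1-4) d show ?thesis by (intro bexI[of _ "d - Im z"]) simp_all
      next
        case 2 with b[of "d + Re z"] z(1-4) d show ?thesis by (intro bexI[of _ "d + Re z"]) simp_all
      next
        case 3 with c[of "2 * d + Im z"] z(1-4) d show ?thesis by (intro bexI[of _ "2 * d + Im z"]) simp_all
      next
        case 4 with e[of "4 * d - Re z"] z(1-4) d show ?thesis by (intro bexI[of _ "4 * d - Re z"]) simp_all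
      qed
      then obtain s where s: "s \<in> {0..4 * d}" "sq1 d s = Re z" "sq2 d s = Im z" by blast
      then have "z = ?K s" by (simp add: complex_eq_iff)
      then show "z \<in> ?K ` {0..4 * d}" using s(1) by blast
    qed
  qed
  show "inj_on ?K {0..<4 * d}"
  proof (rule inj_onI)
    fix s t assume st: "s \<in> {0..<4 * d}" "t \<in> {0..<4 * d}" "?K s = ?K t"
    have cs: "(r \<le> d \<and> sq1 d r = 0 \<and> sq2 d r = d - r) \<or> (d \<le> r \<and> r \<le> 2 * d \<and> sq1 d r = r - d \<and> sq2 d r = 0) \<or>
       (2 * d \<le> r \<and> r \<le> 3 * d \<and> sq1 d r = d \<and> sq2 d r = r - 2 * d) \<or> (3 * d \<le> r \<and> sq1 d r = 4 * d - r \<and> sq2 d r = d)"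
      if "r \<in> {0..<4 * d}" for r
    proof -
      consider "r \<le> d" | "d \<le> r" "r \<le> 2 * d" | "2 * d \<le> r" "r \<le> 3 * d" | "3 * d \<le> r" by linarith
      then show ?thesis using that a[of r] b[of r] c[of r] e[of r] by cases auto
    qed
    have "sq1 d s = sq1 d t" "sq2 d s = sq2 d t" using st(3) by auto
    then show "s = t" using cs[OF st(1)] cs[OF st(2)] st(1,2) d unfolding atLeastLessThan_iff
      by (elim disjE conjE; linarith)
  qed
  show "continuous_on UNIV ?K"
    unfolding sq1_def sq2_def by (intro continuous_intros)
  show "?K 0 = ?K (4 * d)" using a[of 0] e[of "4 * d"] d by simp
qed

section \<open>Cutting and pasting dividing polygons\<close>

text \<open>All that the plane argument needs to know about the sphere. \<open>besicovitch\<close>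
  is monotonicity for the map \<open>(h1, h2)\<close> into the sup-norm plane; the exempted value
  \<open>w\<close> is the one the map would take at the pole. \<open>limit_at_infinity\<close>
  expresses that infinity is an ordinary point of the sphere.\<close>

locale finsler_area = plane_finsler F for F +
  fixes \<nu> :: "complex measure" and c :: real
  assumes sets_nu: "sets \<nu> = sets borel" and finite_nu: "finite_measure \<nu>"
    and null_segment: "emeasure \<nu> (closed_segment p q) = 0"
    and besicovitch: "open D \<Longrightarrow> seg_lipschitz D h1 \<Longrightarrow> seg_lipschitz D h2 \<Longrightarrow> 0 < e \<Longrightarrow>
      (\<And>z. Re z \<in> {a..a + e} \<Longrightarrow> Im z \<in> {a..a + e} \<Longrightarrow> z \<noteq> w \<Longrightarrow> z \<in> (\<lambda>x. Complex (h1 x) (h2 x)) ` D) \<Longrightarrow>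
      c * e\<^sup>2 \<le> measure \<nu> D"
    and limit_at_infinity: "open D \<Longrightarrow> seg_lipschitz D h \<Longrightarrow> (\<And>z. R < norm z \<Longrightarrow> z \<in> D) \<Longrightarrow>
      \<exists>l. (h \<longlongrightarrow> l) at_infinity"
begin

interpretation finite_measure \<nu> by (rule finite_nu)

abbreviation "m \<equiv> measure \<nu>"

lemma open_sets_nu: "open X \<Longrightarrow> X \<in> sets \<nu>"
  and compact_sets_nu: "compact X \<Longrightarrow> X \<in> sets \<nu>"
  by (auto simp: sets_nu compact_imp_closed)

lemma null_segment_sets: "closed_segment p q \<in> null_sets \<nu>"
  using null_segment compact_sets_nu[OF compact_segment] by (simp add: null_sets_def)

lemma null_point: "{p} \<in> null_sets \<nu>"
  using null_segment_sets[of p p] by simp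

lemma null_uarc: "uarc g a b \<Longrightarrow> g ` {a..b} \<in> null_sets \<nu>"
proof (induction rule: uarc.induct)
  case (uarc_segI a b g)
  then show ?case using null_segment_sets by auto
next
  case (uarc_trans g a b c)
  have "{a..c} = {a..b} \<union> {b..c}" using uarc_le[OF uarc_trans(1)] uarc_le[OF uarc_trans(2)] by auto
  then show ?case using uarc_trans(3,4) by (simp add: image_Un null_sets.Un)
qed

lemma null_parc: "parc p q S l \<Longrightarrow> S \<in> null_sets \<nu>"
  using null_uarc by (auto simp: parc_def)

lemma measure_null: "N \<in> null_sets \<nu> \<Longrightarrow> m N = 0"
  by (simp add: null_sets_def measure_def)

definition cut :: "(real \<Rightarrow> complex) \<Rightarrow> real \<Rightarrow> bool" where
  "cut g L \<longleftrightarrow> closedp g L \<and> m UNIV / 4 \<le> m (inside (g ` {0..L})) \<and> m UNIV / 4 \<le> m (outside (g ` {0..L}))"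

text \<open>Of the two parts into which the chord \<open>K\<close> divides the larger side, one has at least a quarter of the
  area, and its complement contains the other side.\<close>

lemma surgery:
  assumes cp: "closedp g L" and C: "C = g ` {0..L}" and DE: "{D, E} = {inside C, outside C}"
    and area: "m UNIV / 2 \<le> m D" "m UNIV / 4 \<le> m E"
    and st: "0 \<le> s" "s < t" "t \<le> L" and K: "parc (g s) (g t) K k" "g s \<noteq> g t" "K - {g s, g t} \<subseteq> D"
  shows "\<exists>g' L'. cut g' L' \<and> (L' = k + (t - s) \<or> L' = k + (L - (t - s)))"
proof -
  let ?p = "g s" and ?q = "g t" and ?A = "g ` {s..t}" and ?B = "g ` {t..L} \<union> g ` {0..s}"
  note sp = closedp_split[OF cp st K(2)]
  obtain c where c: "simple_path c" "pathfinish c = pathstart c" "path_image c = C"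
    using closedp_simple_path[OF cp] C by metis
  note js = jordan_sides[OF c(1,2) c(3)[symmetric] DE]
  obtain c1 where c1: "arc c1" "pathstart c1 = ?p" "pathfinish c1 = ?q" "path_image c1 = ?A"
    using parc_arc[OF sp(1) K(2)] .
  obtain c2 where c2: "arc c2" "pathstart c2 = ?p" "pathfinish c2 = ?q" "path_image c2 = ?B"
    using parc_arc[OF parc_reverse[OF sp(2)] K(2)] .
  obtain ck where ck: "arc ck" "pathstart ck = ?p" "pathfinish ck = ?q" "path_image ck = K"
    using parc_arc[OF K(1,2)] .
  have AB: "?A \<union> ?B = C" using sp(4) C by simp
  obtain X1 Y1 X2 Y2 a where
    X: "{X1, Y1} = {inside (?A \<union> K), outside (?A \<union> K)}" "{X2, Y2} = {inside (?B \<union> K), outside (?B \<union> K)}"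
    and cover: "D \<subseteq> X1 \<union> X2 \<union> K" "E - {a} \<subseteq> Y1" "E - {a} \<subseteq> Y2"
    using theta_curve_sides[OF c1(1) c2(1) ck(1) c1(2,3) c2(2,3) ck(2,3), of D E] sp(3) DE K(3)
    unfolding c1(4) c2(4) ck(4) AB by metis
  have KC: "K \<inter> C \<subseteq> {?p, ?q}" using K(3) js(6) by blast
  have pq: "?p \<in> ?A" "?q \<in> ?A" "?p \<in> ?B" "?q \<in> ?B" "?p \<in> K" "?q \<in> K"
    using parc_ends[OF sp(1)] parc_ends[OF sp(2)] parc_ends[OF K(1)] by blast+
  have new: "\<exists>g'. closedp g' (k + l) \<and> g' ` {0..k + l} = S \<union> K"
    if S: "parc ?q ?p S l" "S \<subseteq> C" "?p \<in> S" "?q \<in> S" for S l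
  proof -
    have "K \<inter> S = {?p, ?q}" using KC S(2-4) pq by blast
    from closedp_join[OF K(1) S(1) this K(2)] show ?thesis by (metis Un_commute)
  qed
  have sets: "X \<in> sets \<nu> \<and> Y \<in> sets \<nu>" if "closedp g' L'" "g' ` {0..L'} = S" "{X, Y} = {inside S, outside S}"
    for g' L' S X Y
  proof -
    note f = that
    obtain c where "simple_path c" "pathfinish c = pathstart c" "path_image c = S"
      using closedp_simple_path[OF f(1)] f(2) by metis
    from jordan_sides(1,2)[OF this(1,2) this(3)[symmetric] f(3)] show ?thesis using open_sets_nu by blast
  qed
  obtain g1 where g1: "closedp g1 (k + (t - s))" "g1 ` {0..k + (t - s)} = ?A \<union> K"
    using new[OF parc_reverse[OF sp(1)]] AB pq by blast
  obtain g2 where g2: "closedp g2 (k + (L - (t - s)))" "g2 ` {0..k + (L - (t - s))} = ?B \<union> K"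
    using new[OF sp(2)] AB pq by blast
  note s1 = sets[OF g1 X(1)] and s2 = sets[OF g2 X(2)]
  have Ks: "K \<in> null_sets \<nu>" by (rule null_parc[OF K(1)])
  have "m D \<le> m (X1 \<union> X2 \<union> K)" using cover(1) s1 s2 Ks by (intro finite_measure_mono) auto
  also have "\<dots> \<le> m (X1 \<union> X2) + m K" using s1 s2 Ks by (intro measure_Un_le) auto
  also have "\<dots> \<le> m X1 + m X2" using measure_Un_le[of X1 \<nu> X2] s1 s2 measure_null[OF Ks] by auto
  finally have half: "m UNIV / 4 \<le> m X1 \<or> m UNIV / 4 \<le> m X2" using area(1) by auto
  \<comment> \<open>The exceptional point of the theta curve has no area, so \<open>E\<close> lies
    in \<open>Y\<close> up to a null set.\<close>
  have Y: "m UNIV / 4 \<le> m Y" if "E - {a} \<subseteq> Y" "Y \<in> sets \<nu>" for Y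
  proof -
    have "m E \<le> m (Y \<union> {a})" using that null_setsD2[OF null_point[of a]] by (intro finite_measure_mono sets.Un) blast+
    also have "\<dots> \<le> m Y" using measure_Un_le[of Y \<nu> "{a}"] that(2) null_point[of a] measure_null[OF null_point[of a]] by auto
    finally show ?thesis using area(2) by simp
  qed
  \<comment> \<open>Whichever part is large enough determines the arc that is kept; there is no
    choice of the shorter curve.\<close>
  have "cut g1 (k + (t - s)) \<or> cut g2 (k + (L - (t - s)))"
    using half
  proof
    assume "m UNIV / 4 \<le> m X1"
    then have "cut g1 (k + (t - s))" using g1 X(1) Y[OF cover(2)] s1 unfolding cut_def doubleton_eq_iff by auto
    then show ?thesis ..
  next
    assume "m UNIV / 4 \<le> m X2"
    then have "cut g2 (k + (L - (t - s)))" using g2 X(2) Y[OF cover(3)] s2 unfolding cut_def doubleton_eq_iff by auto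
    then show ?thesis ..
  qed
  then show ?thesis by blast
qed

text \<open>Surgery keeps one of the arcs, of lengths \<open>t - s\<close> and
  \<open>L - (t - s)\<close>. Almost minimality bounds \<open>k\<close> from below by the discarded
  arc minus \<delta>. As it is unknown which one is discarded, only the shorter arc is a bound in
  both cases.\<close>

lemma chord_lower_bound:
  assumes cp: "closedp g L" and C: "C = g ` {0..L}" and DE: "{D, E} = {inside C, outside C}"
    and area: "m UNIV / 2 \<le> m D" "m UNIV / 4 \<le> m E"
    and min: "\<And>g' L'. cut g' L' \<Longrightarrow> L < L' + \<delta>"
    and st: "s \<in> {0..L}" "t \<in> {0..L}" and K: "parc (g s) (g t) K k" "g s \<noteq> g t" "K - {g s, g t} \<subseteq> D"
  shows "circ_dist L s t - \<delta> \<le> k"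
proof -
  consider "s < t" | "t < s" using K(2) by (cases s t rule: linorder_cases) auto
  then show ?thesis
  proof cases
    case 1
    then show ?thesis using surgery[OF cp C DE area _ 1 _ K] st min unfolding circ_dist_def by fastforce
  next
    case 2
    have "K - {g t, g s} \<subseteq> D" using K(3) by blast
    from surgery[OF cp C DE area _ 2 _ parc_reverse[OF K(1)] K(2)[symmetric] this]
    show ?thesis using st min 2 unfolding circ_dist_def by fastforce
  qed
qed

end

section \<open>Inner distance to the boundary curve\<close>

context plane_finsler begin

text \<open>Up to truncation at \<open>d\<close>, this is the inner distance of \<open>D\<close> from \<open>x\<close> to the boundary curve \<open>g\<close>, where
  ending at \<open>g s\<close> costs an additional \<open>u s\<close>. Truncation also keeps the infimum over a nonempty set.\<close>

definition reach :: "(real \<Rightarrow> complex) \<Rightarrow> real \<Rightarrow> complex set \<Rightarrow> real \<Rightarrow> (real \<Rightarrow> real) \<Rightarrow> complex \<Rightarrow> real" where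
  "reach g L D d u x = Inf (insert d {l + u s |l s S. s \<in> {0..L} \<and> parc (g s) x S l \<and> S - {g s} \<subseteq> D})"

context
  fixes g :: "real \<Rightarrow> complex" and L d :: real and D :: "complex set" and u :: "real \<Rightarrow> real"
  assumes disj: "g ` {0..L} \<inter> D = {}" and u: "\<And>s. 0 \<le> u s" "\<And>s. u s \<le> d"
begin

lemma reach_set_nonneg:
  "z \<in> insert d {l + u s |l s S. s \<in> {0..L} \<and> parc (g s) x S l \<and> S - {g s} \<subseteq> D} \<Longrightarrow> 0 \<le> z"
  using u[of 0] u(1) parc_nonneg by fastforce

lemma reach_le:
  assumes "s \<in> {0..L}" "parc (g s) x S l" "S - {g s} \<subseteq> D"
  shows "reach g L D d u x \<le> l + u s"
  unfolding reach_def
  by (rule cInf_lower) (use assms reach_set_nonneg in \<open>blast | (intro bdd_belowI[of _ 0], blast)\<close>)+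

lemma reach_le_const: "reach g L D d u x \<le> d"
  unfolding reach_def
  by (rule cInf_lower) (use reach_set_nonneg in \<open>blast | (intro bdd_belowI[of _ 0], blast)\<close>)+

lemma reach_geI:
  assumes "b \<le> d" "\<And>l s S. s \<in> {0..L} \<Longrightarrow> parc (g s) x S l \<Longrightarrow> S - {g s} \<subseteq> D \<Longrightarrow> b \<le> l + u s"
  shows "b \<le> reach g L D d u x"
  unfolding reach_def by (rule cInf_greatest) (use assms in auto)

text \<open>An arc that competes for \<open>x\<close>, prolonged by the segment and freed of loops,
  competes for \<open>y\<close>. The segment lies in \<open>D\<close> and so misses the starting
  point on the curve.\<close>

lemma reach_segment:
  assumes "closed_segment x y \<subseteq> D"
  shows "reach g L D d u y \<le> reach g L D d u x + seg F x y"
proof -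
  have "reach g L D d u y - seg F x y \<le> reach g L D d u x"
  proof (rule reach_geI)
    show "reach g L D d u y - seg F x y \<le> d" using reach_le_const[of y] seg_nonneg[of x y] by simp
    fix l s S assume s: "s \<in> {0..L}" "parc (g s) x S l" "S - {g s} \<subseteq> D"
    have "g s \<notin> closed_segment x y" using s(1) disj assms by blast
    from parc_extend[OF s(2) this] obtain S' k'
      where S': "parc (g s) y S' k'" "k' \<le> l + seg F x y" "S' \<subseteq> S \<union> closed_segment x y" .
    have "S' - {g s} \<subseteq> D" using S'(3) s(3) assms by blast
    from reach_le[OF s(1) S'(1) this] show "reach g L D d u y - seg F x y \<le> l + u s" using S'(2) by simp
  qed
  then show ?thesis by simp
qed

lemma seg_lipschitz_reach: "seg_lipschitz D (reach g L D d u)"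
  unfolding seg_lipschitz_def
proof (intro allI impI)
  fix x y assume xy: "closed_segment x y \<subseteq> D"
  then have "closed_segment y x \<subseteq> D" by (simp add: closed_segment_commute)
  from reach_segment[OF xy] reach_segment[OF this]
  show "\<bar>reach g L D d u y - reach g L D d u x\<bar> \<le> seg F x y" by (simp add: seg_commute[of y x])
qed

text \<open>The upper bound is the straight segment to \<open>g t\<close>. For the lower bound, a
  competing arc from \<open>g s\<close> is prolonged to \<open>g t\<close> and becomes a chord; its
  length plus \<delta> is at least the arc distance of \<open>s\<close> and \<open>t\<close>, which
  in turn bounds \<open>u t - u s\<close>.\<close>

lemma reach_boundary:
  assumes inj: "\<And>s t. s \<in> {0..L} \<Longrightarrow> t \<in> {0..L} \<Longrightarrow> g s = g t \<Longrightarrow> u s = u t"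
    and lip: "\<And>s t. s \<in> {0..L} \<Longrightarrow> t \<in> {0..L} \<Longrightarrow> \<bar>u s - u t\<bar> \<le> circ_dist L s t"
    and chord: "\<And>s t K k. s \<in> {0..L} \<Longrightarrow> t \<in> {0..L} \<Longrightarrow> parc (g s) (g t) K k \<Longrightarrow> g s \<noteq> g t \<Longrightarrow>
      K - {g s, g t} \<subseteq> D \<Longrightarrow> circ_dist L s t - \<delta> \<le> k"
    and \<delta>: "0 \<le> \<delta>" and t: "t \<in> {0..L}" and x: "closed_segment x (g t) - {g t} \<subseteq> D"
  shows "\<bar>reach g L D d u x - u t\<bar> \<le> \<delta> + seg F x (g t)"
proof -
  have xD: "x \<in> D \<or> x = g t" using x by (metis Diff_iff ends_in_segment(1) singletonD subsetD)
  have "parc (g t) x (closed_segment x (g t)) (seg F x (g t))"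
    using parc_reverse[OF parc_segment] .
  from reach_le[OF t this x] have up: "reach g L D d u x \<le> seg F x (g t) + u t" .
  have "u t - \<delta> - seg F x (g t) \<le> reach g L D d u x"
  proof (rule reach_geI)
    show "u t - \<delta> - seg F x (g t) \<le> d" using u(2)[of t] \<delta> seg_nonneg[of x "g t"] by simp
    fix l s S assume s: "s \<in> {0..L}" "parc (g s) x S l" "S - {g s} \<subseteq> D"
    show "u t - \<delta> - seg F x (g t) \<le> l + u s"
    proof (cases "g s = g t")
      case True
      then have "u s = u t" using inj s(1) t by blast
      then show ?thesis using parc_nonneg[OF s(2)] \<delta> seg_nonneg[of x "g t"] by simp
    next
      case False
      then have "g s \<notin> closed_segment x (g t)" using x disj s(1) by blast
      from parc_extend[OF s(2) this] obtain S' k' where S': "parc (g s) (g t) S' k'"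
        "k' \<le> l + seg F x (g t)" "S' \<subseteq> S \<union> closed_segment x (g t)" .
      have "S' - {g s, g t} \<subseteq> D" using S'(3) s(3) x by blast
      from chord[OF s(1) t S'(1) False this] lip[OF s(1) t] S'(2) show ?thesis by linarith
    qed
  qed
  then show ?thesis using up \<delta> by linarith
qed

end

text \<open>The straight way from \<open>x\<close> to \<open>w\<close> may leave \<open>D\<close>
  before it reaches \<open>w\<close>. It is stopped at its point of \<open>C\<close> closest to
  \<open>x\<close>: leaving \<open>D\<close> earlier would mean crossing the frontier
  earlier.\<close>

lemma first_hit:
  fixes C D :: "complex set"
  assumes C: "compact C" "frontier D = C" "D \<inter> C = {}" and x: "x \<in> D" and w: "w \<in> C"
  obtains q where "q \<in> C" "q \<in> closed_segment x w" "closed_segment x q - {q} \<subseteq> D"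
proof -
  let ?A = "C \<inter> closed_segment x w"
  have "compact ?A" "?A \<noteq> {}" using C(1) w by (auto intro!: compact_Int)
  then obtain q where q: "q \<in> ?A" "\<And>z. z \<in> ?A \<Longrightarrow> dist x q \<le> dist x z"
    using distance_attains_inf[of ?A x] compact_imp_closed by metis
  have "y \<in> D" if y: "y \<in> closed_segment x q" "y \<noteq> q" for y
  proof (rule ccontr)
    assume "y \<notin> D"
    then have "closed_segment x y \<inter> frontier D \<noteq> {}"
      using x by (intro connected_Int_frontier) auto
    then obtain z where z: "z \<in> closed_segment x y" "z \<in> C" using C by blast
    have sub: "closed_segment x q \<subseteq> closed_segment x w" "closed_segment x y \<subseteq> closed_segment x q"
      using q(1) y(1) by (simp_all add: closed_segment_subset)
    then have "dist x q \<le> dist x z" using z q(2) by blast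
    moreover have "dist x y = dist x z + dist z y"
      using z(1) between_mem_segment[of x y z] by (simp add: between)
    moreover have "dist x q = dist x y + dist y q"
      using y(1) between_mem_segment[of x q y] by (simp add: between)
    ultimately have "dist y q \<le> 0" using zero_le_dist[of z y] by linarith
    then show False using y(2) by simp
  qed
  then show ?thesis using that[of q] q(1) by blast
qed

text \<open>For \<open>x\<close> near \<open>w\<close>, the first boundary point \<open>q\<close> on
  the way to \<open>w\<close> is near both. \<open>reach_boundary\<close> compares \<open>x\<close>
  with \<open>q\<close>, and continuity of \<open>k\<close> compares \<open>q\<close> with
  \<open>w\<close>.\<close>

lemma reach_near_boundary:
  assumes C: "compact C" "frontier D = C" "D \<inter> C = {}" "C = g ` {0..L}"
    and k: "continuous_on C k" "\<And>t. t \<in> {0..L} \<Longrightarrow> k (g t) = u t"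
    and u: "\<And>s. 0 \<le> u s" "\<And>s. u s \<le> d"
    and lip: "\<And>s t. s \<in> {0..L} \<Longrightarrow> t \<in> {0..L} \<Longrightarrow> \<bar>u s - u t\<bar> \<le> circ_dist L s t"
    and chord: "\<And>s t K k. s \<in> {0..L} \<Longrightarrow> t \<in> {0..L} \<Longrightarrow> parc (g s) (g t) K k \<Longrightarrow> g s \<noteq> g t \<Longrightarrow>
      K - {g s, g t} \<subseteq> D \<Longrightarrow> circ_dist L s t - \<delta> \<le> k"
    and \<delta>: "0 \<le> \<delta>" and w: "w \<in> C" and e: "0 < e"
  shows "\<exists>r>0. \<forall>x\<in>D. dist x w < r \<longrightarrow> \<bar>reach g L D d u x - k w\<bar> \<le> \<delta> + e"
proof -
  obtain r1 where r1: "0 < r1" "\<And>q. q \<in> C \<Longrightarrow> dist q w < r1 \<Longrightarrow> dist (k q) (k w) < e / 2"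
    using k(1) w e unfolding continuous_on_iff by (metis half_gt_zero)
  obtain a M where M: "0 < M" "\<And>z v. z \<in> cball w 1 \<Longrightarrow> a * norm v \<le> F z v"
    "\<And>z v. z \<in> cball w 1 \<Longrightarrow> F z v \<le> M * norm v"
    using F_bounds[of "cball w 1"] by (metis compact_cball)
  \<comment> \<open>Within \<open>r1\<close> the function \<open>k\<close> varies by less than
    \<open>e / 2\<close>; within 1 the bound \<open>M\<close> holds; the last entry makes the
    segment to \<open>q\<close> at most \<open>e / 2\<close> long.\<close>
  define r where "r = min (min r1 1) (e / (2 * M))"
  have r: "0 < r" "r \<le> r1" "r \<le> 1" "r \<le> e / (2 * M)" using r1(1) e M(1) by (simp_all add: r_def)
  have Mr: "M * r \<le> e / 2" using r(4) M(1) by (simp add: field_simps)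
  have "\<bar>reach g L D d u x - k w\<bar> \<le> \<delta> + e" if x: "x \<in> D" "dist x w < r" for x
  proof -
    obtain q where q: "q \<in> C" "q \<in> closed_segment x w" "closed_segment x q - {q} \<subseteq> D"
      using first_hit[OF C(1-3) x(1) w] .
    obtain t where t: "t \<in> {0..L}" "q = g t" using q(1) C(4) by blast
    have dq: "dist x q \<le> dist x w" "dist q w \<le> dist x w"
      using q(2) between_mem_segment[of x w q] by (auto simp: between)
    have "closed_segment x q \<subseteq> cball w 1"
      using x(2) dq r by (intro closed_segment_subset convex_cball) (auto simp: dist_commute)
    then have "seg F x q \<le> M * norm (q - x)" using M by (intro seg_bounds(2)[where m = a]) auto
    also have "\<dots> \<le> M * r" using dq x(2) M(1) by (simp add: dist_norm norm_minus_commute)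
    finally have s: "seg F x (g t) \<le> e / 2" using Mr t(2) by simp
    have "\<bar>reach g L D d u x - u t\<bar> \<le> \<delta> + seg F x (g t)"
    proof (rule reach_boundary[OF _ u _ lip chord \<delta> t(1)])
      show "g ` {0..L} \<inter> D = {}" using C by blast
      show "u s = u t" if "s \<in> {0..L}" "t \<in> {0..L}" "g s = g t" for s t using k(2) that by metis
      show "closed_segment x (g t) - {g t} \<subseteq> D" using q(3) t(2) by simp
    qed
    moreover have "dist (k q) (k w) < e / 2" using r1(2)[OF q(1)] dq x(2) r by auto
    then have "\<bar>u t - k w\<bar> < e / 2" using k(2)[OF t(1)] t(2) by (simp add: dist_real_def)
    ultimately show ?thesis using s by linarith
  qed
  then show ?thesis using r(1) by blast
qed

end

section \<open>Covering the square and bounding the length\<close>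

context finsler_area begin

interpretation finite_measure \<nu> by (rule finite_nu)

text \<open>The covering lemma wants a bounded domain. Inversion at a point of \<open>E\<close>
  turns \<open>D\<close> into the inside of \<open>J\<close> up to 0, and the map is extended to 0
  by its limit at infinity. The value \<open>z\<close> given to it there is the only one that
  \<open>D\<close> itself may fail to take.\<close>

lemma open_seg_lipschitz_covers:
  assumes c: "simple_path p" "pathfinish p = pathstart p" "C = path_image p"
    and DE: "{D, E} = {inside C, outside C}"
    and h: "seg_lipschitz D h1" "seg_lipschitz D h2"
    and Q: "convex Q" "bounded Q" and hom: "homeomorphism C (frontier Q) k k'"
    and near: "\<And>w. w \<in> C \<Longrightarrow> \<exists>r>0. \<forall>x\<in>D. dist x w < r \<longrightarrow> dist (Complex (h1 x) (h2 x)) (k w) < \<delta>"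
    and \<delta>: "\<delta> < \<delta>'"
  obtains z where "\<And>y. y \<in> interior Q \<Longrightarrow> (\<And>q. q \<in> frontier Q \<Longrightarrow> \<delta>' < dist q y) \<Longrightarrow> y \<noteq> z \<Longrightarrow>
    y \<in> (\<lambda>x. Complex (h1 x) (h2 x)) ` D"
proof -
  note j = jordan_sides[OF c DE]
  obtain a where a: "a \<in> E" using j by blast
  define J where "J = minv a ` C"
  have aC: "a \<notin> C" "a \<notin> D" using a j(5,6) by blast+
  have c': "simple_path (minv a \<circ> p)" "pathfinish (minv a \<circ> p) = pathstart (minv a \<circ> p)" "J = path_image (minv a \<circ> p)"
    using c aC(1) simple_path_continuous_image[of p "minv a"] continuous_on_minv[OF aC(1)] inj_on_minv[of a C]
    by (auto simp: J_def pathfinish_compose pathstart_compose path_image_compose)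
  note j' = Jordan_inside_outside[OF c'(1,2), folded c'(3)]
  have side: "minv a ` D = inside J - {0}" using minv_jordan_side(1)[OF c DE a] by (simp add: J_def)
  let ?i = "\<lambda>\<zeta>. a + 1 / \<zeta>" and ?f = "\<lambda>x. Complex (h1 x) (h2 x)"
  have iD: "?i \<zeta> \<in> D" if "\<zeta> \<in> inside J" "\<zeta> \<noteq> 0" for \<zeta>
  proof -
    have "\<zeta> \<in> minv a ` D" using that side by simp
    then obtain x where "x \<in> D" "\<zeta> = minv a x" by blast
    moreover from this have "x \<noteq> a" using aC by blast
    ultimately show ?thesis using minv_inverse[of x a] by simp
  qed
  have contf: "continuous_on D ?f"
    using seg_lipschitz_continuous[OF h(1) j(1)] seg_lipschitz_continuous[OF h(2) j(1)]
    by (intro continuous_intros)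
  \<comment> \<open>If 0 is inside \<open>J\<close>, then \<open>D\<close> contains a neighbourhood
    of infinity and the limits exist; otherwise any \<open>z\<close> will do.\<close>
  have "\<exists>z. 0 \<in> inside J \<longrightarrow> ((\<lambda>\<zeta>. ?f (?i \<zeta>)) \<longlongrightarrow> z) (at 0)"
  proof (cases "0 \<in> inside J")
    case True
    obtain r where r: "0 < r" "ball 0 r \<subseteq> inside J" using True j' by (metis open_contains_ball)
    have "z \<in> D" if "norm a + 1 / r < norm z" for z
    proof -
      have "norm z \<le> norm (z - a) + norm a" using norm_triangle_sub[of z a] by simp
      then have "1 / r < norm (z - a)" using that by simp
      then have "norm (z - a) > 0" "1 < norm (z - a) * r" using r(1)
        by (auto simp: field_simps intro: less_trans[of 0 "1 / r"])
      then have "norm (minv a z) < r" by (simp add: minv_def norm_divide field_simps)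
      then have "minv a z \<in> inside J" using r(2) by auto
      moreover have "z \<noteq> a" using \<open>norm (z - a) > 0\<close> by auto
      ultimately show ?thesis using iD[of "minv a z"] minv_inverse[of z a] by (simp add: minv_def)
    qed
    then obtain l1 l2 where "(h1 \<longlongrightarrow> l1) at_infinity" "(h2 \<longlongrightarrow> l2) at_infinity"
      using limit_at_infinity[OF j(1) h(1)] limit_at_infinity[OF j(1) h(2)] by blast
    then have lim: "(?f \<longlongrightarrow> Complex l1 l2) at_infinity" by (intro tendsto_intros)
    have "filterlim (\<lambda>\<zeta>. a + inverse \<zeta>) at_infinity (at 0)"
      by (intro tendsto_add_filterlim_at_infinity[OF tendsto_const] filterlim_inverse_at_infinity)
    then have "filterlim ?i at_infinity (at 0)" by (simp add: inverse_eq_divide)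
    from filterlim_compose[OF lim this] show ?thesis by blast
  qed auto
  then obtain z where z: "0 \<in> inside J \<Longrightarrow> ((\<lambda>\<zeta>. ?f (?i \<zeta>)) \<longlongrightarrow> z) (at 0)" by blast
  define G where "G \<zeta> = (if \<zeta> = 0 then z else ?f (?i \<zeta>))" for \<zeta>
  have oi: "open (inside J)" using j' by simp
  have contG: "continuous_on (inside J) G"
    unfolding continuous_on_eq_continuous_at[OF oi]
  proof
    fix \<zeta> assume \<zeta>: "\<zeta> \<in> inside J"
    show "isCont G \<zeta>"
    proof (cases "\<zeta> = 0")
      case True
      have "(G \<longlongrightarrow> z) (at 0)"
        by (rule Lim_transform_eventually[OF z]) (use \<zeta> True in \<open>auto simp: G_def eventually_at_filter\<close>)
      then show ?thesis using True by (simp add: isCont_def G_def)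
    next
      case False
      have "continuous_on (inside J - {0}) (\<lambda>\<zeta>. ?f (?i \<zeta>))"
        by (rule continuous_on_compose2[OF contf]) (use iD in \<open>auto intro!: continuous_intros\<close>)
      then have "continuous_on (inside J - {0}) G"
        by (rule continuous_on_eq) (auto simp: G_def)
      then show ?thesis using False \<zeta> oi continuous_on_eq_continuous_at[of "inside J - {0}" G] by auto
    qed
  qed
  have fr: "frontier (inside J) = J" using j' by simp
  have J0: "0 \<notin> J" using aC by (auto simp: J_def minv_def)
  have iJ: "homeomorphism J C ?i (minv a)"
  proof (rule homeomorphismI)
    show "continuous_on J ?i" using J0 by (intro continuous_intros) auto
    show "continuous_on C (minv a)" using aC by (intro continuous_on_minv)
    show "?i ` J \<subseteq> C" "\<And>y. y \<in> C \<Longrightarrow> ?i (minv a y) = y"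
      using aC by (auto simp: J_def minv_def)
    show "minv a ` C \<subseteq> J" by (simp add: J_def)
    show "minv a (?i \<zeta>) = \<zeta>" if "\<zeta> \<in> J" for \<zeta> using that J0 by (auto simp: minv_def)
  qed
  note homJ = homeomorphism_compose[OF iJ hom]
  have nearJ: "\<exists>r>0. \<forall>\<zeta>\<in>inside J. dist \<zeta> \<omega> < r \<longrightarrow> dist (G \<zeta>) ((k \<circ> ?i) \<omega>) < \<delta>" if \<omega>: "\<omega> \<in> J" for \<omega>
  proof -
    have "?i \<omega> \<in> C" using iJ \<omega> by (auto simp: homeomorphism_def)
    from near[OF this] obtain r where r: "0 < r" "\<And>x. x \<in> D \<Longrightarrow> dist x (?i \<omega>) < r \<Longrightarrow> dist (?f x) (k (?i \<omega>)) < \<delta>"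
      by blast
    have w0: "\<omega> \<noteq> 0" using \<omega> J0 by auto
    then have "isCont ?i \<omega>" by (intro continuous_intros)
    then obtain r' where r': "0 < r'" "\<And>\<zeta>. dist \<zeta> \<omega> < r' \<Longrightarrow> dist (?i \<zeta>) (?i \<omega>) < r"
      using r(1) unfolding continuous_at_eps_delta by (auto simp: dist_commute)
    have "dist (G \<zeta>) ((k \<circ> ?i) \<omega>) < \<delta>" if "\<zeta> \<in> inside J" "dist \<zeta> \<omega> < min r' (norm \<omega>)" for \<zeta>
    proof -
      have "\<zeta> \<noteq> 0" using that(2) by auto
      then show ?thesis using r(2)[OF iD[OF that(1)] r'(2)] that(2) by (simp add: G_def)
    qed
    then show ?thesis using r'(1) w0 by (intro exI[of _ "min r' (norm \<omega>)"]) auto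
  qed
  show ?thesis
  proof (rule that[of z])
    fix y assume y: "y \<in> interior Q" "\<And>q. q \<in> frontier Q \<Longrightarrow> \<delta>' < dist q y" "y \<noteq> z"
    have "y \<in> G ` inside J"
    proof (rule covers_of_almost_homeomorphism_on_frontier[OF oi _ _ contG Q _ _ \<delta> y(1,2)])
      show "bounded (inside J)" "inside J \<noteq> {}" using j' by auto
      show "homeomorphism (frontier (inside J)) (frontier Q) (k \<circ> ?i) (minv a \<circ> k')" using homJ fr by simp
      show "\<exists>r>0. \<forall>x\<in>inside J. dist x w < r \<longrightarrow> dist (G x) ((k \<circ> ?i) w) < \<delta>" if "w \<in> frontier (inside J)" for w
        using nearJ that fr by auto
    qed
    then obtain \<zeta> where "\<zeta> \<in> inside J" "y = G \<zeta>" by blast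
    then show "y \<in> ?f ` D" using y(3) iD[of \<zeta>] by (auto simp: G_def split: if_splits)
  qed
qed

text \<open>\<open>g\<close> maps a compact interval onto \<open>C\<close> and is therefore a
  quotient map, so \<open>k\<close> is continuous because \<open>k\<close> after \<open>g\<close>
  parametrizes the square. The parametrizations of \<open>C\<close> and of the square identify the
  same two parameters, which makes \<open>k\<close> well defined and injective.\<close>

lemma closedp_square_homeomorphism:
  assumes cp: "closedp g L" and C: "C = g ` {0..L}" and d: "d = L / 4"
  obtains k k' where "homeomorphism C (frontier (cbox 0 (Complex d d))) k k'"
    "\<And>t. t \<in> {0..L} \<Longrightarrow> k (g t) = Complex (sq1 d t) (sq2 d t)"
proof -
  have g: "uarc g 0 L" "0 < L" "g 0 = g L" using cp by (auto simp: closedp_def)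
  have d0: "0 < d" and L: "L = 4 * d" using g d by auto
  let ?K = "\<lambda>s. Complex (sq1 d s) (sq2 d s)"
  note sq = square_param[OF d0, folded L]
  have eq: "s = t \<or> (s = 0 \<and> t = L) \<or> (s = L \<and> t = 0)" if "s \<in> {0..L}" "t \<in> {0..L}" "g s = g t" for s t
    using closedp_inj[OF cp, of s t] closedp_inj[OF cp, of t s] that by (cases s t rule: linorder_cases) auto
  define k where "k w = ?K (SOME t. t \<in> {0..L} \<and> g t = w)" for w
  have kg: "k (g t) = ?K t" if t: "t \<in> {0..L}" for t
  proof -
    define s where "s = (SOME s. s \<in> {0..L} \<and> g s = g t)"
    have s: "s \<in> {0..L} \<and> g s = g t" unfolding s_def by (rule someI[of _ t]) (use t in simp)
    have "?K s = ?K t" using eq[of s t] s t sq(4) by auto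
    then show ?thesis by (simp add: k_def s_def)
  qed
  have contg: "continuous_on {0..L} g" using uarc_continuous[OF g(1)] .
  have contk: "continuous_on C k"
    unfolding continuous_on_open_invariant
  proof (intro allI impI)
    fix B :: "complex set" assume B: "open B"
    have "openin (top_of_set {0..L}) ({0..L} \<inter> ?K -` B)"
      using continuous_openin_preimage_gen[OF continuous_on_subset[OF sq(3) subset_UNIV] B] .
    moreover have "{0..L} \<inter> g -` (C \<inter> k -` B) = {0..L} \<inter> ?K -` B"
    proof (rule set_eqI)
      fix x
      show "x \<in> {0..L} \<inter> g -` (C \<inter> k -` B) \<longleftrightarrow> x \<in> {0..L} \<inter> ?K -` B"
        using kg[of x] imageI[of x "{0..L}" g] C by (cases "x \<in> {0..L}") auto
    qed
    ultimately have "openin (top_of_set C) (C \<inter> k -` B)"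
      using Abstract_Topology_2.continuous_imp_quotient_map[OF contg C[symmetric] compact_Icc, of "C \<inter> k -` B"] by simp
    then show "\<exists>A. open A \<and> A \<inter> C = k -` B \<inter> C" by (auto simp: openin_open Int_commute)
  qed
  have "k ` C = ?K ` {0..L}" using kg C by (auto simp: image_image)
  then have "k ` C = frontier (cbox 0 (Complex d d))" using sq(1) by simp
  moreover have "inj_on k C"
  proof (rule inj_onI)
    fix x y assume xy: "x \<in> C" "y \<in> C" "k x = k y"
    have rep: "\<exists>s\<in>{0..<L}. w = g s" if "w \<in> C" for w
    proof -
      have "\<exists>s\<in>{0..L}. w = g s" using that C by blast
      then obtain s where "s \<in> {0..L}" "w = g s" by blast
      then show ?thesis using g(2,3) by (cases "s = L") (auto intro: bexI[of _ 0] bexI[of _ s])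
    qed
    obtain s t where st: "s \<in> {0..<L}" "x = g s" "t \<in> {0..<L}" "y = g t" using rep xy by meson
    then have "?K s = ?K t" using kg[of s] kg[of t] xy(3) by auto
    then have "s = t" using sq(2) st by (auto simp: inj_on_def)
    then show "x = y" using st by simp
  qed
  moreover have "compact C" using compact_continuous_image[OF contg compact_Icc] C by simp
  ultimately obtain k' where "homeomorphism C (frontier (cbox 0 (Complex d d))) k k'"
    using homeomorphism_compact[OF _ contk] by blast
  then show ?thesis using that kg by blast
qed

lemma almost_minimal_cut_length:
  assumes cut: "cut g L" and \<eta>: "0 < \<eta>" and min: "\<And>g' L'. cut g' L' \<Longrightarrow> L < L' + \<eta> / 8" and c: "0 < c"
  shows "L \<le> 2 * sqrt (3 / c * m UNIV) + 16 * \<eta>"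
proof -
  have cp: "closedp g L" using cut by (simp add: cut_def)
  define C where "C = g ` {0..L}"
  define d where "d = L / 4"
  \<comment> \<open>Each coordinate will be off by at most 2\<delta>, so the map is off by at most
    4\<delta> = \<eta>/2, which is less than \<eta>.\<close>
  define \<delta> where "\<delta> = \<eta> / 8"
  have L: "0 < L" and d: "0 < d" and L4: "4 * d = L" using cp by (auto simp: closedp_def d_def)
  obtain p where p: "simple_path p" "pathfinish p = pathstart p" "C = path_image p"
    using closedp_simple_path[OF cp] C_def by metis
  have null: "C \<in> null_sets \<nu>" using null_uarc cp by (auto simp: C_def closedp_def)
  note jj = jordan_sides[OF p refl]
  have sn: "inside C \<in> sets \<nu>" "outside C \<in> sets \<nu>" using jj open_sets_nu by auto
  have "UNIV = inside C \<union> (outside C \<union> C)" using jj(6) by blast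
  then have "m UNIV \<le> m (inside C) + m (outside C \<union> C)"
    using measure_Un_le[of "inside C" \<nu> "outside C \<union> C"] sn null by auto
  moreover have "m (outside C \<union> C) = m (outside C)"
    using measure_Un_null_set[OF sn(2) null] by simp
  moreover have "m (inside C) + m (outside C) = m (inside C \<union> outside C)"
    using sn jj(5) by (intro finite_measure_Union[symmetric]) auto
  moreover have "m (inside C \<union> outside C) \<le> m UNIV"
    using open_sets_nu[OF open_UNIV] by (intro finite_measure_mono) auto
  ultimately have sum: "m UNIV = m (inside C) + m (outside C)" by linarith
  have quarter: "m UNIV / 4 \<le> m (inside C)" "m UNIV / 4 \<le> m (outside C)" using cut by (auto simp: cut_def C_def)
  \<comment> \<open>The areas of the sides add up to the whole, the curve being null. Hence one side
    has at least half, and at most three quarters as the other keeps a quarter; this is the origin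
    of the 3 under the root.\<close>
  have "\<exists>D E. {D, E} = {inside C, outside C} \<and> m UNIV / 2 \<le> m D \<and> m UNIV / 4 \<le> m E \<and> m D \<le> 3 / 4 * m UNIV"
  proof (cases "m UNIV / 2 \<le> m (inside C)")
    case True
    then show ?thesis using sum quarter by (intro exI[of _ "inside C"] exI[of _ "outside C"]) auto
  next
    case False
    then show ?thesis using sum quarter by (intro exI[of _ "outside C"] exI[of _ "inside C"]) auto
  qed
  then obtain D E where DE: "{D, E} = {inside C, outside C}" and
    area: "m UNIV / 2 \<le> m D" "m UNIV / 4 \<le> m E" "m D \<le> 3 / 4 * m UNIV" by blast
  note j = jordan_sides[OF p DE]
  have DC: "D \<inter> C = {}" using j(6) by blast
  have compC: "compact C" using p(1,3) by (simp add: compact_simple_path_image)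
  obtain k k' where k: "homeomorphism C (frontier (cbox 0 (Complex d d))) k k'"
    "\<And>t. t \<in> {0..L} \<Longrightarrow> k (g t) = Complex (sq1 d t) (sq2 d t)"
    using closedp_square_homeomorphism[OF cp C_def d_def] by blast
  have contk: "continuous_on C k" using k(1) by (simp add: homeomorphism_def)
  \<comment> \<open>As \<open>sq1\<close> vanishes on the first quarter of \<open>C\<close> and
    \<open>sq2\<close> on the second, these are the truncated distances from two consecutive
    quarters, completed along \<open>C\<close>.\<close>
  let ?h1 = "reach g L D d (sq1 d)" and ?h2 = "reach g L D d (sq2 d)"
  have disj: "g ` {0..L} \<inter> D = {}" using DC C_def by blast
  have h: "seg_lipschitz D ?h1" "seg_lipschitz D ?h2"
    using seg_lipschitz_reach[OF disj] sq_range[OF d] by blast+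
  have \<delta>: "0 < \<delta>" using \<eta> by (simp add: \<delta>_def)
  note chord = chord_lower_bound[OF cp C_def DE area(1,2) min[folded \<delta>_def]]
  have near: "\<exists>r>0. \<forall>x\<in>D. dist x w < r \<longrightarrow> dist (Complex (?h1 x) (?h2 x)) (k w) < \<eta>" if w: "w \<in> C" for w
  proof -
    have 1: "\<exists>r>0. \<forall>x\<in>D. dist x w < r \<longrightarrow> \<bar>?h1 x - Re (k w)\<bar> \<le> \<delta> + \<delta>"
      by (rule reach_near_boundary[OF compC j(9) DC C_def, where k = "\<lambda>w. Re (k w)"])
        (use contk k(2) sq_range[OF d] sq_lipschitz(1)[OF d] chord \<delta> w L4 in \<open>auto intro!: continuous_intros\<close>)
    have 2: "\<exists>r>0. \<forall>x\<in>D. dist x w < r \<longrightarrow> \<bar>?h2 x - Im (k w)\<bar> \<le> \<delta> + \<delta>"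
      by (rule reach_near_boundary[OF compC j(9) DC C_def, where k = "\<lambda>w. Im (k w)"])
        (use contk k(2) sq_range[OF d] sq_lipschitz(2)[OF d] chord \<delta> w L4 in \<open>auto intro!: continuous_intros\<close>)
    obtain r1 r2 where r: "0 < r1" "0 < r2" "\<And>x. x \<in> D \<Longrightarrow> dist x w < r1 \<Longrightarrow> \<bar>?h1 x - Re (k w)\<bar> \<le> \<delta> + \<delta>"
      "\<And>x. x \<in> D \<Longrightarrow> dist x w < r2 \<Longrightarrow> \<bar>?h2 x - Im (k w)\<bar> \<le> \<delta> + \<delta>" using 1 2 by metis
    have "dist (Complex (?h1 x) (?h2 x)) (k w) < \<eta>" if "x \<in> D" "dist x w < min r1 r2" for x
    proof -
      have "dist (Complex (?h1 x) (?h2 x)) (k w) \<le> \<bar>?h1 x - Re (k w)\<bar> + \<bar>?h2 x - Im (k w)\<bar>"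
        using cmod_le[of "Complex (?h1 x) (?h2 x) - k w"] by (simp add: dist_norm)
      then show ?thesis using r(3)[of x] r(4)[of x] that \<eta> by (simp add: \<delta>_def)
    qed
    then show ?thesis using r(1,2) by (intro exI[of _ "min r1 r2"]) auto
  qed
  let ?Q = "cbox 0 (Complex d d)"
  obtain z where z: "\<And>y. y \<in> interior ?Q \<Longrightarrow> (\<And>q. q \<in> frontier ?Q \<Longrightarrow> 3 / 2 * \<eta> < dist q y) \<Longrightarrow> y \<noteq> z \<Longrightarrow>
    y \<in> (\<lambda>x. Complex (?h1 x) (?h2 x)) ` D"
    using open_seg_lipschitz_covers[OF p DE h convex_box(1) bounded_cbox k(1) near, of "3 / 2 * \<eta>"] \<eta> by auto
  show ?thesis
  proof (cases "d \<le> 4 * \<eta>")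
    case True
    have "0 \<le> m UNIV / c" using c by simp
    then have "0 \<le> 2 * sqrt (3 / c * m UNIV)" using c by simp
    then show ?thesis using True L4 by linarith
  next
    case False
    \<comment> \<open>The square with corners at 2\<eta> and d - 2\<eta> has distance at least
      2\<eta> from the frontier, more than the 3/2 \<eta> required. Shortening the side by 4\<eta>
      costs 16\<eta> in \<open>L = 4 * d\<close>.\<close>
    define e where "e = d - 4 * \<eta>"
    have "c * e\<^sup>2 \<le> m D"
    proof (rule besicovitch[OF j(1) h, where a = "2 * \<eta>" and w = z])
      show "0 < e" using False by (simp add: e_def)
      fix y assume y: "Re y \<in> {2 * \<eta>..2 * \<eta> + e}" "Im y \<in> {2 * \<eta>..2 * \<eta> + e}" "y \<noteq> z"
      show "y \<in> (\<lambda>x. Complex (?h1 x) (?h2 x)) ` D"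
      proof (rule z[OF _ _ y(3)])
        show "y \<in> interior ?Q" using y \<eta> by (simp add: interior_cbox in_box_complex_iff e_def)
        fix q assume "q \<in> frontier ?Q"
        then have "Re q = 0 \<or> Re q = d \<or> Im q = 0 \<or> Im q = d" unfolding frontier_square by blast
        then have "3 / 2 * \<eta> < \<bar>Re (q - y)\<bar> \<or> 3 / 2 * \<eta> < \<bar>Im (q - y)\<bar>" using y \<eta> by (auto simp: e_def)
        then show "3 / 2 * \<eta> < dist q y"
          using abs_Re_le_cmod[of "q - y"] abs_Im_le_cmod[of "q - y"] by (auto simp: dist_norm)
      qed
    qed
    then have "c * e\<^sup>2 \<le> 3 / 4 * m UNIV" using area(3) by simp
    then have "(2 * e)\<^sup>2 \<le> 3 / c * m UNIV" using c by (simp add: field_simps power2_eq_square)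
    then have "2 * e \<le> sqrt (3 / c * m UNIV)" by (rule real_le_rsqrt)
    then have "2 * (2 * e) \<le> 2 * sqrt (3 / c * m UNIV)" by simp
    moreover have "L = 2 * (2 * e) + 16 * \<eta>" using L4 by (simp add: e_def)
    ultimately show ?thesis by simp
  qed
qed

end

section \<open>Existence of dividing polygons\<close>

lemma (in plane_finsler) closedp_square_boundary:
  assumes t: "0 < t"
  obtains g L where "closedp g L" "g ` {0..L} = frontier (cbox (Complex (-t) (-t)) (Complex t t))"
proof -
  define p1 p2 p3 p4 where "p1 = Complex t t" and "p2 = Complex (-t) t" and "p3 = Complex (-t) (-t)" and "p4 = Complex t (-t)"
  note p = p1_def p2_def p3_def p4_def
  have seg: "closed_segment p1 p2 = {z. Im z = t \<and> \<bar>Re z\<bar> \<le> t}" "closed_segment p2 p3 = {z. Re z = - t \<and> \<bar>Im z\<bar> \<le> t}"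
    "closed_segment p3 p4 = {z. Im z = - t \<and> \<bar>Re z\<bar> \<le> t}" "closed_segment p4 p1 = {z. Re z = t \<and> \<bar>Im z\<bar> \<le> t}"
    using t by (auto simp: p closed_segment_same_Re closed_segment_same_Im closed_segment_eq_real_ivl)
  let ?S = "closed_segment p1 p2 \<union> closed_segment p2 p3" and ?T = "closed_segment p3 p4 \<union> closed_segment p4 p1"
  have S: "parc p1 p3 ?S (seg F p1 p2 + seg F p2 p3)"
    by (rule parc_join[OF parc_segment parc_segment], unfold seg) (auto simp: p complex_eq_iff)
  have T: "parc p3 p1 ?T (seg F p3 p4 + seg F p4 p1)"
    by (rule parc_join[OF parc_segment parc_segment], unfold seg) (auto simp: p complex_eq_iff)
  have "?S \<inter> ?T = {p1, p3}" using t unfolding seg by (auto simp: p complex_eq_iff)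
  moreover have "p1 \<noteq> p3" using t by (simp add: p)
  ultimately obtain g where g: "closedp g (seg F p1 p2 + seg F p2 p3 + (seg F p3 p4 + seg F p4 p1))"
    "g ` {0..seg F p1 p2 + seg F p2 p3 + (seg F p3 p4 + seg F p4 p1)} = ?S \<union> ?T"
    using closedp_join[OF S T] by blast
  have "?S \<union> ?T = frontier (cbox (Complex (-t) (-t)) (Complex t t))"
    unfolding frontier_def closure_cbox interior_cbox seg by (auto simp: in_cbox_complex_iff in_box_complex_iff)
  then show ?thesis using that g by simp
qed

context finsler_area begin

interpretation finite_measure \<nu> by (rule finite_nu)

text \<open>The area of a centred open square grows with its half side. At the supremum
  \<open>u\<close> of the half sides for which it is at most half of the total, continuity from
  below gives at most half for the open square, continuity from above at least half for the closed
  one; the boundary is null, so both are half.\<close>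

lemma bisecting_square:
  obtains t where "0 < t" "m UNIV / 4 \<le> m (box (Complex (-t) (-t)) (Complex t t))"
    "m UNIV / 4 \<le> m (- cbox (Complex (-t) (-t)) (Complex t t))"
proof (cases "m UNIV = 0")
  case True
  then show ?thesis using that[of 1] by simp
next
  case False
  let ?a = "m UNIV"
  have a: "0 < ?a" using False measure_nonneg[of \<nu> UNIV] by linarith
  define B where "B t = {z. \<bar>Re z\<bar> < t \<and> \<bar>Im z\<bar> < t}" for t
  define Q where "Q t = {z. \<bar>Re z\<bar> \<le> t \<and> \<bar>Im z\<bar> \<le> t}" for t
  have B: "B t = box (Complex (-t) (-t)) (Complex t t)" and Q: "Q t = cbox (Complex (-t) (-t)) (Complex t t)" for t
    by (auto simp: B_def Q_def in_box_complex_iff in_cbox_complex_iff)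
  have sB: "B t \<in> sets \<nu>" and sQ: "Q t \<in> sets \<nu>" for t
    unfolding B Q using open_sets_nu compact_sets_nu by auto
  have mono: "m (B s) \<le> m (B t)" if "s \<le> t" for s t
    using that sB by (intro finite_measure_mono) (auto simp: B_def)
  have "incseq (\<lambda>n. B (real n))" by (auto simp: incseq_def B_def)
  moreover have "(\<Union>n. B (real n)) = UNIV"
  proof -
    have "\<exists>n. z \<in> B (real n)" for z
    proof -
      obtain n where "\<bar>Re z\<bar> + \<bar>Im z\<bar> < real n" using reals_Archimedean2 by blast
      then show ?thesis by (intro exI[of _ n]) (auto simp: B_def)
    qed
    then show ?thesis by blast
  qed
  ultimately have "(\<lambda>n. m (B (real n))) \<longlonglongrightarrow> ?a"
    using finite_Lim_measure_incseq[of "\<lambda>n. B (real n)"] sB by auto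
  then have "eventually (\<lambda>n. ?a / 2 < m (B (real n))) sequentially" using a by (intro order_tendstoD) auto
  then obtain N where N: "?a / 2 < m (B (real N))" by (auto simp: eventually_sequentially)
  define T where "T = {t. 0 \<le> t \<and> m (B t) \<le> ?a / 2}"
  have T0: "0 \<in> T" using a by (simp add: T_def B_def)
  have bdd: "bdd_above T"
  proof (rule bdd_aboveI)
    fix t assume "t \<in> T"
    then show "t \<le> real N" using N mono[of "real N" t] by (cases "t \<le> real N") (auto simp: T_def)
  qed
  define u where "u = Sup T"
  have u0: "0 \<le> u" unfolding u_def by (rule cSup_upper[OF T0 bdd])
  have low: "m (B t) \<le> ?a / 2" if "t < u" for t
  proof -
    have "\<exists>s\<in>T. t < s" using that less_cSup_iff[of T t] T0 bdd unfolding u_def by blast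
    then obtain s where "s \<in> T" "t < s" by blast
    then show ?thesis using mono[of t s] by (auto simp: T_def)
  qed
  have high: "?a / 2 \<le> m (B t)" if "u < t" for t
  proof (rule ccontr)
    assume "\<not> ?thesis"
    then have "t \<in> T" using that u0 by (auto simp: T_def)
    then show False using cSup_upper[OF _ bdd] that unfolding u_def by fastforce
  qed
  have ev: "\<exists>n. x < u - 1 / real (Suc n)" if "x < u" for x
    using reals_Archimedean[of "u - x"] that by (auto simp: inverse_eq_divide algebra_simps)
  have "incseq (\<lambda>n. B (u - 1 / real (Suc n)))"
    by (rule incseq_SucI) (auto simp: B_def intro: less_le_trans simp: frac_le diff_left_mono)
  moreover have "(\<Union>n. B (u - 1 / real (Suc n))) = B u"
  proof
    show "(\<Union>n. B (u - 1 / real (Suc n))) \<subseteq> B u" by (auto simp: B_def) (smt (verit) divide_nonneg_pos of_nat_0_le_iff)+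
    show "B u \<subseteq> (\<Union>n. B (u - 1 / real (Suc n)))"
    proof
      fix z assume "z \<in> B u"
      then have "max \<bar>Re z\<bar> \<bar>Im z\<bar> < u" by (simp add: B_def)
      from ev[OF this] show "z \<in> (\<Union>n. B (u - 1 / real (Suc n)))" by (auto simp: B_def)
    qed
  qed
  ultimately have "(\<lambda>n. m (B (u - 1 / real (Suc n)))) \<longlonglongrightarrow> m (B u)"
    using finite_Lim_measure_incseq[of "\<lambda>n. B (u - 1 / real (Suc n))"] sB by auto
  then have 1: "m (B u) \<le> ?a / 2"
    by (rule LIMSEQ_le_const2) (use low in \<open>auto intro!: exI[of _ 0]\<close>)
  have ev': "\<exists>n. u + 1 / real (Suc n) \<le> x" if "u < x" for x
    using reals_Archimedean[of "x - u"] that by (auto simp: inverse_eq_divide algebra_simps intro: less_imp_le)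
  have "decseq (\<lambda>n. B (u + 1 / real (Suc n)))"
    by (rule decseq_SucI) (auto simp: B_def intro: less_le_trans simp: frac_le)
  moreover have "(\<Inter>n. B (u + 1 / real (Suc n))) = Q u"
  proof
    show "Q u \<subseteq> (\<Inter>n. B (u + 1 / real (Suc n)))" by (auto simp: B_def Q_def intro: le_less_trans)
    show "(\<Inter>n. B (u + 1 / real (Suc n))) \<subseteq> Q u"
    proof
      fix z assume z: "z \<in> (\<Inter>n. B (u + 1 / real (Suc n)))"
      have "\<not> u < max \<bar>Re z\<bar> \<bar>Im z\<bar>"
      proof
        assume "u < max \<bar>Re z\<bar> \<bar>Im z\<bar>"
        from ev'[OF this] obtain n where "u + 1 / real (Suc n) \<le> max \<bar>Re z\<bar> \<bar>Im z\<bar>" by blast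
        moreover have "z \<in> B (u + 1 / real (Suc n))" using z by blast
        ultimately show False by (auto simp: B_def)
      qed
      then show "z \<in> Q u" by (auto simp: Q_def)
    qed
  qed
  ultimately have "(\<lambda>n. m (B (u + 1 / real (Suc n)))) \<longlonglongrightarrow> m (Q u)"
    using finite_Lim_measure_decseq[of "\<lambda>n. B (u + 1 / real (Suc n))"] sB by auto
  then have 2: "?a / 2 \<le> m (Q u)"
    by (rule LIMSEQ_le_const) (use high in \<open>auto intro!: exI[of _ 0]\<close>)
  \<comment> \<open>For \<open>u = 0\<close> the closed square would be a point, which is null and
    cannot carry half of a positive area.\<close>
  have "u \<noteq> 0"
  proof
    assume "u = 0"
    then have "Q u = {0}" by (auto simp: Q_def complex_eq_iff)
    then show False using 2 a measure_null[OF null_point[of 0]] by simp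
  qed
  then have u: "0 < u" using u0 by simp
  obtain g L where g: "closedp g L" "g ` {0..L} = frontier (Q u)"
    using closedp_square_boundary[OF u] unfolding Q by blast
  have null: "frontier (Q u) \<in> null_sets \<nu>" using null_uarc[of g 0 L] g by (simp add: closedp_def)
  have "Q u = B u \<union> frontier (Q u)"
    unfolding B Q frontier_def closure_cbox interior_cbox using box_subset_cbox by blast
  then have "m (Q u) = m (B u \<union> frontier (Q u))" by (rule arg_cong)
  then have eq: "m (Q u) = m (B u)" using measure_Un_null_set[OF sB null] by simp
  have "m (- Q u) = ?a - m (Q u)"
    using finite_measure_compl[OF sQ[of u]] sets_eq_imp_space_eq[OF sets_nu] by (simp add: Compl_eq_Diff_UNIV)
  then show ?thesis using that[OF u] 1 2 eq a unfolding B Q by linarith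
qed

lemma cut_exists: "\<exists>g L. cut g L"
proof -
  obtain t where t: "0 < t" "m UNIV / 4 \<le> m (box (Complex (-t) (-t)) (Complex t t))"
    "m UNIV / 4 \<le> m (- cbox (Complex (-t) (-t)) (Complex t t))" using bisecting_square .
  let ?Q = "cbox (Complex (-t) (-t)) (Complex t t)"
  obtain g L where g: "closedp g L" "g ` {0..L} = frontier ?Q" using closedp_square_boundary[OF t(1)] .
  have "inside (frontier ?Q) = box (Complex (-t) (-t)) (Complex t t)"
    using inside_frontier_eq_interior[OF bounded_cbox convex_box(1)] by (simp add: interior_cbox)
  moreover have "outside (frontier ?Q) = - ?Q"
    using outside_frontier_eq_complement_closure[OF bounded_cbox convex_box(1)] by simp
  ultimately have "cut g L" using g t(2,3) by (simp add: cut_def)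
  then show ?thesis by blast
qed

theorem short_cut_exists:
  assumes c: "0 < c" and \<epsilon>: "0 < \<epsilon>"
  shows "\<exists>g L. cut g L \<and> L \<le> 2 * sqrt (3 / c * m UNIV) + \<epsilon>"
proof -
  define S where "S = {L. \<exists>g. cut g L}"
  have S: "S \<noteq> {}" "bdd_below S" using cut_exists
    by (auto simp: S_def cut_def closedp_def intro!: bdd_belowI[of _ 0])
  have "Inf S < Inf S + \<epsilon> / 128" using \<epsilon> by simp
  then obtain L where L: "L \<in> S" "L < Inf S + \<epsilon> / 128" using S cInf_less_iff by metis
  then obtain g where g: "cut g L" by (auto simp: S_def)
  have "L < L' + \<epsilon> / 16 / 8" if "cut g' L'" for g' L'
  proof -
    have "L' \<in> S" using that unfolding S_def by blast
    from cInf_lower[OF this S(2)] L(2) show ?thesis by simp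
  qed
  from almost_minimal_cut_length[OF g _ this c] \<epsilon> have "L \<le> 2 * sqrt (3 / c * m UNIV) + 16 * (\<epsilon> / 16)" by simp
  then show ?thesis using g by auto
qed

end

section \<open>Curves and coordinates\<close>

text \<open>On a short piece of the curve the chord is nearly tangent, so by continuity of
  \<open>F\<close> its length nearly is the integral. Summing up carries the Lipschitz condition
  from segments over to curves.\<close>

lemma (in plane_finsler) seg_lipschitz_curve:
  assumes h: "seg_lipschitz G h" "open G" and ab: "a \<le> b"
    and g: "\<And>t. t \<in> {a..b} \<Longrightarrow> (g has_vector_derivative g' t) (at t within {a..b})"
    and g': "continuous_on {a..b} g'" and G: "g ` {a..b} \<subseteq> G"
  shows "\<bar>h (g b) - h (g a)\<bar> \<le> integral {a..b} (\<lambda>t. F (g t) (g' t))"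
proof (rule field_le_epsilon)
  fix e0 :: real assume e0: "0 < e0"
  define e where "e = e0 / (b - a + 1)"
  have e: "0 < e" "e * (b - a) \<le> e0" using e0 ab by (auto simp: e_def field_simps)
  let ?k = "\<lambda>t. F (g t) (g' t)"
  have contg: "continuous_on {a..b} g"
    using g has_vector_derivative_continuous continuous_on_eq_continuous_within by blast
  have contk: "continuous_on {a..b} ?k" by (intro continuous_on_F contg g')
  have intk: "?k integrable_on {s..t}" if "a \<le> s" "t \<le> b" for s t
    using that continuous_on_subset[OF contk, of "{s..t}"] by (intro integrable_continuous_real) auto
  txt \<open>Bolzano's principle reduces the claim to short intervals around a point \<open>x\<close>, on which \<open>g\<close> is
    close to its tangent.\<close>
  define P where "P s t \<longleftrightarrow> a \<le> s \<and> t \<le> b \<longrightarrow> \<bar>h (g t) - h (g s)\<bar> \<le> integral {s..t} ?k + e * (t - s)" for s t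
  have "P a b"
  proof (rule Bolzano[OF ab])
    fix r s t assume P: "P r s" "P s t" "r \<le> s" "s \<le> t"
    show "P r t"
      unfolding P_def
    proof
      assume "a \<le> r \<and> t \<le> b"
      moreover from this have "integral {r..s} ?k + integral {s..t} ?k = integral {r..t} ?k"
        using P intk by (intro Henstock_Kurzweil_Integration.integral_combine) auto
      ultimately show "\<bar>h (g t) - h (g r)\<bar> \<le> integral {r..t} ?k + e * (t - r)"
        using P unfolding P_def by (auto simp: algebra_simps)
    qed
  next
    fix x assume x: "a \<le> x" "x \<le> b"
    then have xab: "x \<in> {a..b}" by simp
    define H where "H p = F (fst p) (snd p)" for p
    have "isCont H (g x, g' x)"
      using F_continuous by (simp add: continuous_on_eq_continuous_at split_beta H_def[abs_def])
    from this[unfolded continuous_at_eps_delta, rule_format, OF half_gt_zero[OF e(1)]]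
    obtain d1 where d1: "0 < d1" "\<And>p. dist p (g x, g' x) < d1 \<Longrightarrow> dist (H p) (H (g x, g' x)) < e / 2"
      by blast
    obtain d2 where d2: "0 < d2" "ball (g x) d2 \<subseteq> G" using h(2) G xab open_contains_ball_eq[of G "g x"] by blast
    obtain d3 where d3: "0 < d3" "\<And>s. s \<in> {a..b} \<Longrightarrow> dist s x < d3 \<Longrightarrow> dist (?k s) (?k x) < e / 2"
      using contk xab e(1) unfolding continuous_on_iff by (metis half_gt_zero)
    obtain d4 where d4: "0 < d4" "\<And>s. s \<in> {a..b} \<Longrightarrow> dist s x < d4 \<Longrightarrow> dist (g s) (g x) < min d2 (d1 / 2)"
      using contg xab d1(1) d2(1) unfolding continuous_on_iff by (metis min_less_iff_conj half_gt_zero)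
    have "\<exists>d>0. \<forall>s\<in>{a..b}. 0 < dist s x \<and> dist s x < d \<longrightarrow>
        dist ((1 / norm (s - x)) *\<^sub>R (g s - (g x + (s - x) *\<^sub>R g' x))) 0 < d1 / 2"
      using g[OF xab] half_gt_zero[OF d1(1)] unfolding has_vector_derivative_def has_derivative_within Lim_within by blast
    then obtain d5 where d5: "0 < d5" "\<And>s. s \<in> {a..b} \<Longrightarrow> s \<noteq> x \<Longrightarrow> dist s x < d5 \<Longrightarrow>
        norm ((1 / norm (s - x)) *\<^sub>R (g s - (g x + (s - x) *\<^sub>R g' x))) < d1 / 2" by auto
    define d where "d = min d3 (min d4 d5)"
    have near: "\<bar>h (g s) - h (g x)\<bar> \<le> \<bar>s - x\<bar> * (?k x + e / 2)" if s: "s \<in> {a..b}" "dist s x < d" for s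
    proof (cases "s = x")
      case False
      define w where "w = (g s - g x) /\<^sub>R (s - x)"
      have gw: "g s - g x = (s - x) *\<^sub>R w" using False by (simp add: w_def)
      have "g s - (g x + (s - x) *\<^sub>R g' x) = (s - x) *\<^sub>R (w - g' x)" using gw by (simp add: algebra_simps)
      then have dw: "dist w (g' x) < d1 / 2" using d5(2)[OF s(1) False] s(2) False by (simp add: d_def dist_norm)
      have dg: "dist (g s) (g x) < d2" "dist (g s) (g x) < d1 / 2" using d4(2)[OF s(1)] s(2) by (auto simp: d_def)
      have sub: "closed_segment (g x) (g s) \<subseteq> ball (g x) (min d2 (d1 / 2))"
        using dg d1 d2 by (intro closed_segment_subset convex_ball) (auto simp: dist_commute)
      \<comment> \<open>The bound is written as a multiple of the norm of the chord, the form that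
        \<open>seg_bounds\<close> expects. If the chord is degenerate, both sides are 0.\<close>
      have "F z (g s - g x) \<le> (\<bar>s - x\<bar> * (?k x + e / 2) / norm (g s - g x)) * norm (g s - g x)"
        if z: "z \<in> closed_segment (g x) (g s)" for z
      proof (cases "g s = g x")
        case True then show ?thesis using F_eq_0_iff[of z 0] by simp
      next
        case ne: False
        have "dist (z, w) (g x, g' x) \<le> dist z (g x) + dist w (g' x)" 
          by (simp add: dist_Pair_Pair) (metis sqrt_sum_squares_le_sum zero_le_dist)
        also have "\<dots> < d1" using sub z dw by (auto simp: dist_commute)
        finally have "F z w \<le> ?k x + e / 2" using d1(2)[of "(z, w)"] by (auto simp: H_def dist_real_def abs_if split: if_splits)
        then have "\<bar>s - x\<bar> * F z w \<le> \<bar>s - x\<bar> * (?k x + e / 2)" by (intro mult_left_mono) auto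
        moreover have "F z (g s - g x) = \<bar>s - x\<bar> * F z w" by (simp only: gw F_scaleR)
        moreover have "(A / norm (g s - g x)) * norm (g s - g x) = A" for A using ne by simp
        ultimately show ?thesis by simp
      qed
      from seg_bounds(2)[of "g x" "g s" 0, OF _ this] F_nonneg
      have "seg F (g x) (g s) \<le> (\<bar>s - x\<bar> * (?k x + e / 2) / norm (g s - g x)) * norm (g s - g x)" by simp
      also have "\<dots> \<le> \<bar>s - x\<bar> * (?k x + e / 2)" using e(1) F_nonneg[of "g x" "g' x"] by (cases "g s = g x") auto
      finally have "seg F (g x) (g s) \<le> \<bar>s - x\<bar> * (?k x + e / 2)" .
      moreover have "ball (g x) (min d2 (d1 / 2)) \<subseteq> ball (g x) d2" by (rule subset_ball) simp
      then have "closed_segment (g x) (g s) \<subseteq> G" using sub d2(2) by blast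
      ultimately show ?thesis using h(1) unfolding seg_lipschitz_def by fastforce
    qed simp
    have low: "(t - s) * (?k x - e / 2) \<le> integral {s..t} ?k"
      if st: "a \<le> s" "s \<le> t" "t \<le> b" "\<And>r. r \<in> {s..t} \<Longrightarrow> dist r x < d" for s t
    proof -
      have "integral {s..t} (\<lambda>_. ?k x - e / 2) \<le> integral {s..t} ?k"
      proof (rule integral_le)
        fix r assume r: "r \<in> {s..t}"
        have "dist (?k r) (?k x) < e / 2" using d3(2)[of r] st(4)[OF r] st r by (simp add: d_def)
        then show "?k x - e / 2 \<le> ?k r" unfolding dist_real_def by linarith
      qed (use st intk in auto)
      then show ?thesis using st(2) by simp
    qed
    show "\<exists>d>0. \<forall>s t. s \<le> x \<and> x \<le> t \<and> t - s < d \<longrightarrow> P s t"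
    proof (intro exI[of _ d] conjI allI impI)
      show "0 < d" using d3 d4 d5 by (simp add: d_def)
      fix s t assume st: "s \<le> x \<and> x \<le> t \<and> t - s < d"
      show "P s t"
        unfolding P_def
      proof
        assume ab: "a \<le> s \<and> t \<le> b"
        have "\<bar>h (g t) - h (g s)\<bar> \<le> \<bar>h (g t) - h (g x)\<bar> + \<bar>h (g s) - h (g x)\<bar>" by linarith
        also have "\<dots> \<le> \<bar>t - x\<bar> * (?k x + e / 2) + \<bar>s - x\<bar> * (?k x + e / 2)"
          using near[of t] near[of s] st ab by (intro add_mono) (auto simp: dist_real_def)
        also have "\<dots> = (t - x) * (?k x + e / 2) + (x - s) * (?k x + e / 2)" using st by simp
        \<comment> \<open>One half of \<open>e\<close> is spent on the increments of
          \<open>h\<close>, the other on bounding the integrand from below.\<close>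
        also have "\<dots> = (t - s) * (?k x - e / 2) + e * (t - s)" by (simp add: field_simps)
        also have "\<dots> \<le> integral {s..t} ?k + e * (t - s)"
        proof -
          have "dist r x < d" if "r \<in> {s..t}" for r using that st by (auto simp: dist_real_def abs_if)
          then show ?thesis using low[of s t] st ab by simp
        qed
        finally show "\<bar>h (g t) - h (g s)\<bar> \<le> integral {s..t} ?k + e * (t - s)" .
      qed
    qed
  qed
  then show "\<bar>h (g b) - h (g a)\<bar> \<le> integral {a..b} ?k + e0" using e(2) unfolding P_def by simp
qed

lemma partition_induct:
  fixes T :: "real set"
  assumes T: "finite T" "{0, 1} \<subseteq> T" "T \<subseteq> {0..1}"
    and step: "\<And>a b. a \<in> T \<Longrightarrow> b \<in> T \<Longrightarrow> a < b \<Longrightarrow> {a<..<b} \<inter> T = {} \<Longrightarrow> P a b"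
    and trans: "\<And>a b c. a \<in> T \<Longrightarrow> b \<in> T \<Longrightarrow> c \<in> T \<Longrightarrow> a < b \<Longrightarrow> b < c \<Longrightarrow> P a b \<Longrightarrow> P b c \<Longrightarrow> P a c"
  shows "P 0 1"
proof -
  have "P 0 t" if "t \<in> T" "0 < t" for t
    using that
  proof (induction "card {s\<in>T. s < t}" arbitrary: t rule: less_induct)
    case less
    let ?S = "{s\<in>T. s < t}"
    have S: "finite ?S" "?S \<noteq> {}" using T less by auto
    define s where "s = Max ?S"
    have s: "s \<in> T" "s < t" using Max_in[OF S] by (auto simp: s_def)
    have "r \<le> s" if "r \<in> T" "r < t" for r using Max_ge[OF S(1)] that by (auto simp: s_def)
    then have "{s<..<t} \<inter> T = {}" by force
    then have st: "P s t" using step s less by blast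
    show ?case
    proof (cases "s = 0")
      case False
      then have s0: "0 < s" using s(1) T(3) by force
      have "card {r\<in>T. r < s} < card ?S" using T(1) s by (intro psubset_card_mono) auto
      from less.hyps[OF this s(1) s0] show ?thesis using trans[OF _ s(1) less.prems(1) s0 s(2) _ st] T(2) by blast
    qed (use st in simp)
  qed
  then show ?thesis using T(2) by simp
qed

text \<open>Charts take values in \<open>real^2\<close>, while the topology and the metrics of the
  plane are stated over the complex numbers. \<open>toV\<close> and \<open>toC\<close> are the
  mutually inverse linear identifications.\<close>

definition toV :: "complex \<Rightarrow> real^2" where "toV z = vector [Re z, Im z]"
definition toC :: "real^2 \<Rightarrow> complex" where "toC v = Complex (v $ 1) (v $ 2)"

lemma toV_nth [simp]: "toV z $ 1 = Re z" "toV z $ 2 = Im z" by (simp_all add: toV_def)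
lemma toC_sel [simp]: "Re (toC v) = v $ 1" "Im (toC v) = v $ 2" by (simp_all add: toC_def)
lemma toC_toV [simp]: "toC (toV z) = z" by (simp add: complex_eq_iff)
lemma toV_toC [simp]: "toV (toC v) = v" by (simp add: vec_eq_iff forall_2)

lemma linear_toV: "linear toV" and linear_toC: "linear toC"
  by (auto intro!: linearI simp: vec_eq_iff forall_2 complex_eq_iff)

lemma bounded_linear_toV: "bounded_linear toV" and bounded_linear_toC: "bounded_linear toC"
  using linear_toV linear_toC linear_conv_bounded_linear by blast+

lemmas has_derivative_toC = bounded_linear.has_derivative[OF bounded_linear_toC]
  and has_derivative_toV = bounded_linear.has_derivative[OF bounded_linear_toV]
  and continuous_on_toC [continuous_intros] = bounded_linear.continuous_on[OF bounded_linear_toC]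
  and continuous_on_toV [continuous_intros] = bounded_linear.continuous_on[OF bounded_linear_toV]

lemma toV_image: "toV ` G = toC -` G"
  by (auto simp: image_iff) (metis toV_toC)

lemma toC_eq_0_iff: "toC v = 0 \<longleftrightarrow> v = 0"
  by (simp add: complex_eq_iff vec_eq_iff forall_2)

lemma open_toV_image: "open G \<Longrightarrow> open (toV ` G)"
  unfolding toV_image by (intro continuous_open_vimage) (auto simp: linear_continuous_at bounded_linear_toC)

section \<open>Open subsets of a chart as manifolds\<close>

text \<open>An open piece of a parametrized surface with a single chart. It has no boundary points,
  so the corners of polygons never have to be covered by charts.\<close>

definition open_mfd :: "(complex \<Rightarrow> real^3) \<Rightarrow> (real^3 \<Rightarrow> real^2) \<Rightarrow> complex set \<Rightarrow> (real^3, 2) mfd" where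
  "open_mfd \<psi> \<phi> G = \<lparr>mtop = top_of_set (\<psi> ` G), atlas = {(\<psi> ` G, \<phi>)}\<rparr>"

text \<open>In a manifold with one chart a tangent vector consists of a single pair of a chart and a
  coordinate vector; the description reads off the latter.\<close>

definition chart_metric :: "(real^3 \<Rightarrow> real^2) \<Rightarrow> (complex \<Rightarrow> complex \<Rightarrow> real) \<Rightarrow> (real^3, 2) tangent \<Rightarrow> real" where
  "chart_metric \<phi> F w = F (toC (\<phi> (fst w))) (toC (THE v. \<exists>c. (c, v) \<in> snd w))"

lemma Ck_on_const: "Ck_on k (\<lambda>x. c) U"
proof (induction k arbitrary: c)
  case (Suc k)
  have "frechet_derivative (\<lambda>x. c) (at x) = (\<lambda>_. 0)" for x :: 'a
    by (rule frechet_derivative_const)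
  then show ?case using Suc by simp
qed simp

lemma smooth_on_id: "smooth_on S (\<lambda>x. x)"
proof -
  have "Ck_on k (\<lambda>x::'a. x) UNIV" for k
  proof (cases k)
    case (Suc n)
    have "frechet_derivative (\<lambda>x::'a. x) (at x) = (\<lambda>h. h)" for x
      by (rule frechet_derivative_ident)
    then show ?thesis using Suc by (simp add: differentiable_on_def Ck_on_const)
  qed simp
  then show ?thesis unfolding smooth_on_def by (metis UNIV_I open_UNIV)
qed

lemma smooth_on_cong: "(\<And>x. x \<in> S \<Longrightarrow> f x = g x) \<Longrightarrow> smooth_on S f \<longleftrightarrow> smooth_on S g"
  unfolding smooth_on_def by (metis IntD1)

lemma second_countable_top_of_set: "second_countable_top (top_of_set (S :: 'a::second_countable_topology set))"
proof -
  obtain B :: "'a set set" where B: "countable B" "topological_basis B" using ex_countable_basis by blast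
  show ?thesis
    unfolding second_countable_top_def
  proof (intro exI[of _ "(\<inter>) S ` B"] conjI allI impI ballI)
    show "openin (top_of_set S) X" if "X \<in> (\<inter>) S ` B" for X
      using that B(2) topological_basis_open by (auto simp: openin_open)
    fix U x assume Ux: "openin (top_of_set S) U \<and> x \<in> U"
    then obtain V where V: "open V" "U = S \<inter> V" by (auto simp: openin_open)
    obtain X where "X \<in> B" "x \<in> X" "X \<subseteq> V" using topological_basisE[OF B(2) V(1)] Ux V(2) by blast
    then show "\<exists>X\<in>(\<inter>) S ` B. x \<in> X \<and> X \<subseteq> U" using Ux V(2) by (intro bexI[of _ "S \<inter> X"]) auto
  qed (use B in auto)
qed

text \<open>\<open>\<psi>\<close> parametrizes a surface by the whole plane and
  \<open>\<phi>\<close> inverts it, up to the identification with \<open>real^2\<close>. The two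
  stereographic projections and the flat plane are instances.\<close>

locale chart_param =
  fixes \<psi> :: "complex \<Rightarrow> real^3" and \<phi> :: "real^3 \<Rightarrow> real^2"
  assumes \<psi>_continuous: "continuous_on UNIV \<psi>" and \<phi>_continuous: "continuous_on (range \<psi>) \<phi>"
    and \<phi>_\<psi> [simp]: "\<phi> (\<psi> z) = toV z"
begin

lemma \<psi>_inj [simp]: "\<psi> z = \<psi> w \<longleftrightarrow> z = w"
  by (metis \<phi>_\<psi> toC_toV)

lemma \<phi>_image [simp]: "\<phi> ` \<psi> ` G = toV ` G" by (simp add: image_image)

lemma \<phi>_inj: "inj_on \<phi> (\<psi> ` G)"
  by (rule inj_onI) (metis \<phi>_\<psi> imageE toC_toV)

lemma inv_into_\<phi> [simp]: "z \<in> G \<Longrightarrow> inv_into (\<psi> ` G) \<phi> (toV z) = \<psi> z"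
  using inv_into_f_f[OF \<phi>_inj, of "\<psi> z" G] by simp

lemma is_chart_\<psi>:
  assumes G: "open G" and U: "openin (top_of_set S) (\<psi> ` G)"
  shows "is_chart (top_of_set S) (\<psi> ` G, \<phi>)"
proof -
  have sub: "\<psi> ` G \<subseteq> S" using U openin_imp_subset by blast
  have "homeomorphic_maps (top_of_set (\<psi> ` G)) (top_of_set (toV ` G)) \<phi> (\<psi> \<circ> toC)"
    unfolding homeomorphic_maps_def
  proof (intro conjI ballI)
    show "continuous_map (top_of_set (\<psi> ` G)) (top_of_set (toV ` G)) \<phi>"
      using continuous_on_subset[OF \<phi>_continuous, of "\<psi> ` G"] by (auto simp: continuous_map_in_subtopology)
    show "continuous_map (top_of_set (toV ` G)) (top_of_set (\<psi> ` G)) (\<psi> \<circ> toC)"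
      using continuous_on_compose2[OF \<psi>_continuous continuous_on_toC[OF continuous_on_id], of "toV ` G"]
      by (auto simp: continuous_map_in_subtopology o_def)
  qed auto
  then have "homeomorphic_map (top_of_set (\<psi> ` G)) (top_of_set (toV ` G)) \<phi>"
    using homeomorphic_map_maps by blast
  moreover have "openin (top_of_set (sector {})) (toV ` G)" using open_toV_image[OF G] by (simp add: sector_def)
  moreover have "subtopology (top_of_set S) (\<psi> ` G) = top_of_set (\<psi> ` G)"
    using sub by (simp add: subtopology_subtopology inf_absorb2)
  ultimately show ?thesis using U unfolding is_chart_def by auto
qed

text \<open>The domain of the transition map is open in the plane, so the derivative within it is
  the ordinary derivative of the second chart after the parametrization.\<close>

lemma tvec_\<psi>:
  assumes G: "open G" "z \<in> G" and op: "\<And>c. c \<in> atlas M \<Longrightarrow> open (\<psi> -` fst c)"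
  shows "tvec M (\<psi> ` G, \<phi>) (\<psi> z) v = (\<psi> z, {(c', v'). c' \<in> atlas M \<and> \<psi> z \<in> fst c' \<and>
    (\<exists>D. (snd c' \<circ> \<psi> \<circ> toC has_derivative D) (at (toV z)) \<and> v' = D v)})"
proof -
  have "(transition (\<psi> ` G, \<phi>) c' has_derivative D) (at (toV z) within transition_dom (\<psi> ` G, \<phi>) c') \<longleftrightarrow>
    (snd c' \<circ> \<psi> \<circ> toC has_derivative D) (at (toV z))" if c': "c' \<in> atlas M" "\<psi> z \<in> fst c'" for c' D
  proof -
    let ?U = "toV ` (G \<inter> \<psi> -` fst c')"
    have U: "open ?U" "toV z \<in> ?U" using op[OF c'(1)] G c'(2) by (auto intro!: open_toV_image)
    have dom: "transition_dom (\<psi> ` G, \<phi>) c' = ?U"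
    proof -
      have "\<psi> ` G \<inter> fst c' = \<psi> ` (G \<inter> \<psi> -` fst c')" by auto
      then show ?thesis by (simp add: transition_dom_def split_beta)
    qed
    have eq: "transition (\<psi> ` G, \<phi>) c' x = (snd c' \<circ> \<psi> \<circ> toC) x" if "x \<in> ?U" for x
      using that by (cases c') (auto simp: transition_def)
    have "(transition (\<psi> ` G, \<phi>) c' has_derivative D) (at (toV z)) \<longleftrightarrow> (snd c' \<circ> \<psi> \<circ> toC has_derivative D) (at (toV z))"
      using has_derivative_transform_within_open[OF _ U] eq by (metis (no_types, lifting))
    then show ?thesis unfolding dom using at_within_open[OF U(2,1)] by simp
  qed
  then show ?thesis unfolding tvec_def by (auto simp del: comp_apply)
qed

text \<open>The chart of the smaller set \<open>G\<close> is evaluated in the manifold of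
  \<open>H\<close>, as compatibility of volumes with restriction requires.\<close>

lemma tvec_open_mfd:
  assumes "open G" "z \<in> G" "open H" "G \<subseteq> H"
  shows "tvec (open_mfd \<psi> \<phi> H) (\<psi> ` G, \<phi>) (\<psi> z) v = (\<psi> z, {((\<psi> ` H, \<phi>), v)})"
proof -
  have vim: "\<psi> -` \<psi> ` H = H" by auto
  have "\<phi> \<circ> \<psi> \<circ> toC = (\<lambda>x. x)" by (auto simp: fun_eq_iff)
  then have "(\<phi> \<circ> \<psi> \<circ> toC has_derivative D) (at (toV z)) \<longleftrightarrow> D = (\<lambda>x. x)" for D
    using has_derivative_unique has_derivative_ident by metis
  then show ?thesis using assms
    by (subst tvec_\<psi>) (auto simp: open_mfd_def vim)
qed

lemma chart_metric_tvec:
  assumes "open G" "z \<in> G" "open H" "G \<subseteq> H"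
  shows "chart_metric \<phi> F (tvec (open_mfd \<psi> \<phi> H) (\<psi> ` G, \<phi>) (\<psi> z) v) = F z (toC v)"
  unfolding tvec_open_mfd[OF assms] chart_metric_def by simp

lemma compatible_\<psi>: "compatible (\<psi> ` G, \<phi>) (\<psi> ` H, \<phi>)"
proof -
  have "smooth_on (transition_dom (\<psi> ` G, \<phi>) (\<psi> ` H, \<phi>)) (transition (\<psi> ` G, \<phi>) (\<psi> ` H, \<phi>))" for G H
  proof (subst smooth_on_cong)
    fix x assume "x \<in> transition_dom (\<psi> ` G, \<phi>) (\<psi> ` H, \<phi>)"
    then obtain z where "z \<in> G" "x = toV z" by (auto simp: transition_dom_def)
    then show "transition (\<psi> ` G, \<phi>) (\<psi> ` H, \<phi>) x = x" by (simp add: transition_def)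
  qed (rule smooth_on_id)
  then show ?thesis by (simp add: compatible_def)
qed

lemma open_mfd_reversible_finsler_manifold:
  assumes F: "plane_finsler F" and G: "open G"
  shows "reversible_finsler_manifold (open_mfd \<psi> \<phi> G) (chart_metric \<phi> F)"
proof -
  interpret plane_finsler F by fact
  have "manifold (open_mfd \<psi> \<phi> G)"
    unfolding manifold_def open_mfd_def
    using is_chart_\<psi>[OF G, of "\<psi> ` G"] second_countable_top_of_set compatible_\<psi>
    by (auto simp: Hausdorff_space_subtopology Hausdorff_space_euclidean)
  moreover have "finsler_metric (open_mfd \<psi> \<phi> G) (chart_metric \<phi> F)"
  proof -
    have "continuous_on (toV ` G \<times> UNIV) (\<lambda>(x, v). chart_metric \<phi> F (tvec (open_mfd \<psi> \<phi> G) (\<psi> ` G, \<phi>) (inv_into (\<psi> ` G) \<phi> x) v))"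
    proof (rule continuous_on_eq)
      show "continuous_on (toV ` G \<times> UNIV) (\<lambda>p. F (toC (fst p)) (toC (snd p)))"
        by (intro continuous_on_F continuous_intros)
    qed (auto simp: chart_metric_tvec[OF G _ G])
    moreover have "asymmetric_norm (\<lambda>v. chart_metric \<phi> F (tvec (open_mfd \<psi> \<phi> G) (\<psi> ` G, \<phi>) (\<psi> z) v))" if "z \<in> G" for z
      unfolding chart_metric_tvec[OF G that G order_refl] asymmetric_norm_def F_eq_0_iff toC_eq_0_iff
        linear_add[OF linear_toC] linear_cmul[OF linear_toC] F_scaleR
      using F_nonneg F_triangle by auto
    ultimately show ?thesis by (auto simp: finsler_metric_def open_mfd_def)
  qed
  moreover have "reversible (open_mfd \<psi> \<phi> G) (chart_metric \<phi> F)"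
  proof -
    have "chart_metric \<phi> F (tvec (open_mfd \<psi> \<phi> G) (\<psi> ` G, \<phi>) (\<psi> z) (- v)) = chart_metric \<phi> F (tvec (open_mfd \<psi> \<phi> G) (\<psi> ` G, \<phi>) (\<psi> z) v)"
      if "z \<in> G" for z v
      unfolding chart_metric_tvec[OF G that G order_refl] linear_neg[OF linear_toC] F_minus ..
    then show ?thesis by (auto simp: reversible_def open_mfd_def)
  qed
  ultimately show ?thesis by (simp add: reversible_finsler_manifold_def)
qed

lemma velocity_open_mfd:
  assumes G: "open G" and v: "((\<phi> \<circ> \<gamma>) has_vector_derivative v) (at t)" and \<gamma>: "\<gamma> t = \<psi> z" "z \<in> G"
  shows "chart_metric \<phi> F (velocity (open_mfd \<psi> \<phi> G) \<gamma> t) = F z (toC v)"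
proof -
  have "velocity (open_mfd \<psi> \<phi> G) \<gamma> t = tvec (open_mfd \<psi> \<phi> G) (\<psi> ` G, \<phi>) (\<psi> z) v"
    unfolding velocity_def
  proof (rule the_equality)
    show "\<exists>c\<in>atlas (open_mfd \<psi> \<phi> G). \<gamma> t \<in> fst c \<and> (\<exists>v'. ((snd c \<circ> \<gamma>) has_vector_derivative v') (at t) \<and>
        tvec (open_mfd \<psi> \<phi> G) (\<psi> ` G, \<phi>) (\<psi> z) v = tvec (open_mfd \<psi> \<phi> G) c (\<gamma> t) v')"
      using v \<gamma> by (auto simp: open_mfd_def)
  qed (use v \<gamma> vector_derivative_unique_at in \<open>auto simp: open_mfd_def\<close>)
  then show ?thesis using chart_metric_tvec[OF G \<gamma>(2) G] by simp
qed

lemma seg_lipschitz_curve_length: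
  assumes F: "plane_finsler F" and h: "plane_finsler.seg_lipschitz F G h" "open G"
    and \<gamma>: "piecewise_C1_curve (open_mfd \<psi> \<phi> G) \<gamma>"
  shows "\<bar>h (toC (\<phi> (\<gamma> 1))) - h (toC (\<phi> (\<gamma> 0)))\<bar> \<le> curve_length (open_mfd \<psi> \<phi> G) (chart_metric \<phi> F) \<gamma>"
proof -
  interpret plane_finsler F by fact
  define g where "g t = toC (\<phi> (\<gamma> t))" for t
  let ?f = "\<lambda>t. chart_metric \<phi> F (velocity (open_mfd \<psi> \<phi> G) \<gamma> t)"
  from \<gamma> have "\<exists>T. finite T \<and> {0, 1} \<subseteq> T \<and> T \<subseteq> {0..1} \<and>
      (\<forall>a\<in>T. \<forall>b\<in>T. a < b \<and> {a<..<b} \<inter> T = {} \<longrightarrow> C1_curve_on (open_mfd \<psi> \<phi> G) a b \<gamma>)"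
    unfolding piecewise_C1_curve_def by (rule conjunct2)
  then obtain T where T: "finite T" "{0, 1} \<subseteq> T" "T \<subseteq> {0..1}"
    and C1: "\<forall>a\<in>T. \<forall>b\<in>T. a < b \<and> {a<..<b} \<inter> T = {} \<longrightarrow> C1_curve_on (open_mfd \<psi> \<phi> G) a b \<gamma>"
    by (elim exE conjE)
  have img: "\<gamma> t \<in> \<psi> ` G" if "t \<in> {0..1}" for t
    using \<gamma> that unfolding piecewise_C1_curve_def by (auto simp: open_mfd_def continuous_map_in_subtopology)
  have \<gamma>g: "\<gamma> t = \<psi> (g t)" "g t \<in> G" if "t \<in> {0..1}" for t
    using img[OF that] by (auto simp: g_def)
  define P where "P a b \<longleftrightarrow> ?f integrable_on {a..b} \<and> \<bar>h (g b) - h (g a)\<bar> \<le> integral {a..b} ?f" for a b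
  have "P 0 1"
  proof (rule partition_induct[OF T(1-3)])
    fix a b assume ab: "a \<in> T" "b \<in> T" "a < b" "{a<..<b} \<inter> T = {}"
    then have sub: "{a..b} \<subseteq> {0..1}" using T(3) by auto
    have all: "{a..b} \<inter> \<gamma> -` \<psi> ` G = {a..b}" using img sub by auto
    obtain \<gamma>' where \<gamma>': "continuous_on {a..b} \<gamma>'"
      "\<And>t. t \<in> {a..b} \<Longrightarrow> ((\<phi> \<circ> \<gamma>) has_vector_derivative \<gamma>' t) (at t within {a..b})"
      using C1[rule_format, of a b] ab all unfolding C1_curve_on_def by (auto simp: open_mfd_def)
    define g' where "g' t = toC (\<gamma>' t)" for t
    have g': "(g has_vector_derivative g' t) (at t within {a..b})" if "t \<in> {a..b}" for t
      using bounded_linear.has_vector_derivative[OF bounded_linear_toC \<gamma>'(2)[OF that]] by (simp add: g_def[abs_def] g'_def o_def)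
    have cg': "continuous_on {a..b} g'" unfolding g'_def by (intro continuous_intros \<gamma>')
    have contg: "continuous_on {a..b} g"
      using g' has_vector_derivative_continuous continuous_on_eq_continuous_within by blast
    have f: "?f t = F (g t) (g' t)" if t: "t \<in> {a<..<b}" for t
    proof -
      have "((\<phi> \<circ> \<gamma>) has_vector_derivative \<gamma>' t) (at t)"
        using \<gamma>'(2)[of t] t by (metis at_within_interior atLeastAtMost_iff greaterThanLessThan_iff interior_atLeastAtMost_real less_imp_le)
      from velocity_open_mfd[OF h(2) this] \<gamma>g[of t] t sub show ?thesis by (auto simp: g'_def)
    qed
    \<comment> \<open>At the ends of a piece only one-sided derivatives are known and the velocity
      may be meaningless; two points do not affect the integral.\<close>
    have neg: "negligible {a, b}" by simp
    have ik: "(\<lambda>t. F (g t) (g' t)) integrable_on {a..b}"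
      by (intro integrable_continuous_real continuous_on_F contg cg')
    have "?f integrable_on {a..b}"
      by (rule integrable_spike[OF ik neg]) (use f in auto)
    moreover have "integral {a..b} ?f = integral {a..b} (\<lambda>t. F (g t) (g' t))"
      by (rule integral_spike[OF neg]) (use f in auto)
    moreover have "\<bar>h (g b) - h (g a)\<bar> \<le> integral {a..b} (\<lambda>t. F (g t) (g' t))"
      using ab(3) g' cg' \<gamma>g sub by (intro seg_lipschitz_curve[OF h]) auto
    ultimately show "P a b" by (simp add: P_def)
  next
    fix a b c assume "a < b" "b < c" "P a b" "P b c"
    then have P: "a \<le> b" "b \<le> c" "?f integrable_on {a..b}" "?f integrable_on {b..c}"
      "\<bar>h (g b) - h (g a)\<bar> \<le> integral {a..b} ?f" "\<bar>h (g c) - h (g b)\<bar> \<le> integral {b..c} ?f" by (auto simp: P_def)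
    have int: "?f integrable_on {a..c}" by (rule Henstock_Kurzweil_Integration.integrable_combine[OF P(1-4)])
    with Henstock_Kurzweil_Integration.integral_combine[OF P(1,2) int] P(5,6) show "P a c" unfolding P_def by linarith
  qed
  then show ?thesis by (simp add: P_def g_def curve_length_def)
qed

text \<open>The estimate for the target of a short map: the straight segment is an admissible
  curve.\<close>

lemma finsler_dist_le_seg:
  assumes F: "plane_finsler F" and G: "open G" and pq: "closed_segment p q \<subseteq> G"
  shows "finsler_dist (open_mfd \<psi> \<phi> G) (chart_metric \<phi> F) (\<psi> p) (\<psi> q) \<le> ennreal (seg F p q)"
proof -
  interpret plane_finsler F by fact
  define \<gamma> where "\<gamma> t = \<psi> (linepath p q t)" for t
  have lp: "linepath p q t \<in> G" if "t \<in> {0..1}" for t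
    using linepath_in_path[OF that, of p q] pq by blast
  have cont: "continuous_map (top_of_set {0..1}) (top_of_set (\<psi> ` G)) \<gamma>"
  proof -
    have "continuous_on {0..1} \<gamma>"
      unfolding \<gamma>_def by (rule continuous_on_compose2[OF \<psi>_continuous continuous_on_linepath]) auto
    then show ?thesis using lp by (auto simp: continuous_map_in_subtopology \<gamma>_def)
  qed
  have der: "((\<phi> \<circ> \<gamma>) has_vector_derivative toV (q - p)) (at t within S)" for t S
  proof -
    have "(\<lambda>t. toV (linepath p q t)) = (\<phi> \<circ> \<gamma>)" by (auto simp: \<gamma>_def)
    then show ?thesis using bounded_linear.has_vector_derivative[OF bounded_linear_toV has_vector_derivative_linepath_within] by metis
  qed
  have "C1_curve_on (open_mfd \<psi> \<phi> G) 0 1 \<gamma>"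
    unfolding C1_curve_on_def using cont der by (auto simp: open_mfd_def intro!: exI[of _ "\<lambda>_. toV (q - p)"])
  then have "piecewise_C1_curve (open_mfd \<psi> \<phi> G) \<gamma>"
    unfolding piecewise_C1_curve_def using cont by (auto simp: open_mfd_def intro!: exI[of _ "{0, 1}"])
  moreover have "curve_length (open_mfd \<psi> \<phi> G) (chart_metric \<phi> F) \<gamma> = seg F p q"
    unfolding curve_length_def seg_def
  proof (rule integral_cong)
    fix t :: real assume t: "t \<in> {0..1}"
    show "chart_metric \<phi> F (velocity (open_mfd \<psi> \<phi> G) \<gamma> t) = F (linepath p q t) (q - p)"
      using velocity_open_mfd[OF G der[of t UNIV] _ lp[OF t]] by (simp add: \<gamma>_def)
  qed
  moreover have "\<gamma> 0 = \<psi> p" "\<gamma> 1 = \<psi> q" by (simp_all add: \<gamma>_def linepath_0' linepath_1')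
  ultimately show ?thesis unfolding finsler_dist_def by (intro INF_lower2[of \<gamma>]) auto
qed

text \<open>The estimate for the source of a short map: no admissible curve is shorter than the
  increment of a Lipschitz function along it.\<close>

lemma finsler_dist_geI:
  assumes F: "plane_finsler F" and G: "open G" and x: "x \<in> G" "y \<in> G"
    and h: "plane_finsler.seg_lipschitz F G h"
  shows "ennreal \<bar>h y - h x\<bar> \<le> finsler_dist (open_mfd \<psi> \<phi> G) (chart_metric \<phi> F) (\<psi> x) (\<psi> y)"
  unfolding finsler_dist_def
proof (rule INF_greatest)
  fix \<gamma> assume "\<gamma> \<in> {\<gamma>. piecewise_C1_curve (open_mfd \<psi> \<phi> G) \<gamma> \<and> \<gamma> 0 = \<psi> x \<and> \<gamma> 1 = \<psi> y}"
  then show "ennreal \<bar>h y - h x\<bar> \<le> ennreal (curve_length (open_mfd \<psi> \<phi> G) (chart_metric \<phi> F) \<gamma>)"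
    using seg_lipschitz_curve_length[OF F h G, of \<gamma>] by (intro ennreal_leI) simp
qed

end

section \<open>The stereographic atlas\<close>

no_notation fps_nth (infixl "$" 75)

section \<open>Smoothness of rational maps off the origin\<close>

lemma Ck_on_cong:
  assumes "open U" "\<And>x. x \<in> U \<Longrightarrow> f x = g x" "Ck_on k g U"
  shows "Ck_on k f U"
  using assms(2,3)
proof (induction k arbitrary: f g)
  case 0
  then show ?case by (simp cong: continuous_on_cong)
next
  case (Suc k)
  have iff: "(f has_derivative D) (at x) \<longleftrightarrow> (g has_derivative D) (at x)" if "x \<in> U" for x D
    using has_derivative_transform_within_open[OF _ assms(1) that] Suc.prems(1) by metis
  then have "frechet_derivative f (at x) = frechet_derivative g (at x)" if "x \<in> U" for x
    using that unfolding frechet_derivative_def by presburger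
  then have "Ck_on k (\<lambda>x. frechet_derivative f (at x) b) U" if "b \<in> Basis" for b
    using Suc.IH[of "\<lambda>x. frechet_derivative f (at x) b" "\<lambda>x. frechet_derivative g (at x) b"] Suc.prems(2) that by simp
  moreover have "f differentiable_on U"
    using Suc.prems(2) iff assms(1) unfolding Ck_on.simps differentiable_on_eq_differentiable_at[OF assms(1)]
      differentiable_def by blast
  ultimately show ?case by simp
qed

text \<open>The algebra generated by the coordinates and the inverse of the squared norm. It
  contains the components of the inversion and is closed under directional derivatives off 0, so
  smoothness of every order follows by one induction.\<close>

inductive rational2 :: "(real^2 \<Rightarrow> real) \<Rightarrow> bool" where
  "rational2 (\<lambda>x. c)"
| "rational2 (\<lambda>x. x $ i)"
| "rational2 (\<lambda>x. inverse ((x $ 1)\<^sup>2 + (x $ 2)\<^sup>2))"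
| "rational2 f \<Longrightarrow> rational2 g \<Longrightarrow> rational2 (\<lambda>x. f x + g x)"
| "rational2 f \<Longrightarrow> rational2 g \<Longrightarrow> rational2 (\<lambda>x. f x * g x)"

lemma norm2_nonzero: "x \<noteq> 0 \<Longrightarrow> (x $ 1)\<^sup>2 + (x $ 2)\<^sup>2 \<noteq> (0::real)" for x :: "real^2"
  by (auto simp: vec_eq_iff forall_2 sum_power2_eq_zero_iff)

lemma rational2_derivative:
  "rational2 f \<Longrightarrow> \<exists>f'. (\<forall>x. x \<noteq> 0 \<longrightarrow> (f has_derivative f' x) (at x)) \<and> (\<forall>h. rational2 (\<lambda>x. f' x h))"
proof (induction rule: rational2.induct)
  case (1 c)
  then show ?case by (intro exI[of _ "\<lambda>x h. 0"]) (auto intro: rational2.intros)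
next
  case (2 i)
  have "((\<lambda>x. x $ i) has_derivative (\<lambda>h. h $ i)) (at x)" for x :: "real^2"
    by (rule bounded_linear_imp_has_derivative) (rule bounded_linear_vec_nth)
  then show ?case by (intro exI[of _ "\<lambda>x h. h $ i"]) (auto intro: rational2.intros)
next
  case 3
  have d: "((\<lambda>x. x $ i) has_derivative (\<lambda>h. h $ i)) (at x)" for x :: "real^2" and i
    by (rule bounded_linear_imp_has_derivative) (rule bounded_linear_vec_nth)
  define f' where "f' x h = - (inverse ((x $ 1)\<^sup>2 + (x $ 2)\<^sup>2) * inverse ((x $ 1)\<^sup>2 + (x $ 2)\<^sup>2) *
    (2 * h $ 1 * x $ 1 + 2 * h $ 2 * x $ 2))" for x h :: "real^2"
  have "((\<lambda>x. inverse ((x $ 1)\<^sup>2 + (x $ 2)\<^sup>2)) has_derivative f' x) (at x)" if "x \<noteq> 0" for x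
  proof -
    have "((\<lambda>x. x $ 1 * x $ 1 + x $ 2 * x $ 2) has_derivative
        (\<lambda>h. (x $ 1 * h $ 1 + h $ 1 * x $ 1) + (x $ 2 * h $ 2 + h $ 2 * x $ 2))) (at x)"
      by (intro has_derivative_add has_derivative_mult d)
    from has_derivative_eq_rhs[OF Deriv.has_derivative_inverse[OF _ this], of "f' x"] norm2_nonzero[OF that]
    show ?thesis by (simp add: power2_eq_square f'_def fun_eq_iff algebra_simps)
  qed
  moreover have "rational2 (\<lambda>x. f' x h)" for h
  proof -
    have "(\<lambda>x. f' x h) = (\<lambda>x. (- 1) * (inverse ((x $ 1)\<^sup>2 + (x $ 2)\<^sup>2) * inverse ((x $ 1)\<^sup>2 + (x $ 2)\<^sup>2) *
      ((2 * h $ 1) * x $ 1 + (2 * h $ 2) * x $ 2)))" by (simp add: f'_def fun_eq_iff)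
    then show ?thesis by (simp only:) (intro rational2.intros)
  qed
  ultimately show ?case by blast
next
  case (4 f g)
  then obtain f' g' where f: "\<And>x. x \<noteq> 0 \<Longrightarrow> (f has_derivative f' x) (at x)" "\<And>h. rational2 (\<lambda>x. f' x h)"
    and g: "\<And>x. x \<noteq> 0 \<Longrightarrow> (g has_derivative g' x) (at x)" "\<And>h. rational2 (\<lambda>x. g' x h)" by blast
  show ?case by (intro exI[of _ "\<lambda>x h. f' x h + g' x h"] conjI allI impI has_derivative_add f g rational2.intros)
next
  case (5 f g)
  then obtain f' g' where f: "\<And>x. x \<noteq> 0 \<Longrightarrow> (f has_derivative f' x) (at x)" "\<And>h. rational2 (\<lambda>x. f' x h)"
    and g: "\<And>x. x \<noteq> 0 \<Longrightarrow> (g has_derivative g' x) (at x)" "\<And>h. rational2 (\<lambda>x. g' x h)" by blast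
  show ?case
    by (intro exI[of _ "\<lambda>x h. f x * g' x h + f' x h * g x"] conjI allI impI has_derivative_mult f g rational2.intros 5)
qed

lemma Ck_on_rational2:
  fixes f :: "real^2 \<Rightarrow> real^2"
  assumes "rational2 (\<lambda>x. f x $ 1)" "rational2 (\<lambda>x. f x $ 2)"
  shows "Ck_on k f (- {0})"
proof -
  have der: "\<exists>D. (\<forall>x. x \<noteq> 0 \<longrightarrow> (f has_derivative D x) (at x)) \<and>
      (\<forall>h. rational2 (\<lambda>x. D x h $ 1) \<and> rational2 (\<lambda>x. D x h $ 2))"
    if "rational2 (\<lambda>x. f x $ 1)" "rational2 (\<lambda>x. f x $ 2)" for f :: "real^2 \<Rightarrow> real^2"
  proof -
    note r = that
    obtain f1 f2 where f1: "\<And>x. x \<noteq> 0 \<Longrightarrow> ((\<lambda>x. f x $ 1) has_derivative f1 x) (at x)" "\<And>h. rational2 (\<lambda>x. f1 x h)"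
      and f2: "\<And>x. x \<noteq> 0 \<Longrightarrow> ((\<lambda>x. f x $ 2) has_derivative f2 x) (at x)" "\<And>h. rational2 (\<lambda>x. f2 x h)"
      using rational2_derivative[OF r(1)] rational2_derivative[OF r(2)] by blast
    have f: "f = (\<lambda>x. f x $ 1 *\<^sub>R axis 1 1 + f x $ 2 *\<^sub>R axis 2 1)"
      by (auto simp: fun_eq_iff vec_eq_iff forall_2 axis_def)
    have "(f has_derivative (\<lambda>h. f1 x h *\<^sub>R axis 1 1 + f2 x h *\<^sub>R axis 2 1)) (at x)" if "x \<noteq> 0" for x
      by (subst f) (intro has_derivative_add has_derivative_scaleR_left f1 f2 that)
    then show ?thesis using f1(2) f2(2)
      by (intro exI[of _ "\<lambda>x h. f1 x h *\<^sub>R axis 1 1 + f2 x h *\<^sub>R axis 2 1"]) (auto simp: axis_def)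
  qed
  have op: "open (- {0 :: real^2})" by auto
  show ?thesis
    using assms
  proof (induction k arbitrary: f)
    case 0
    obtain D where "\<And>x. x \<noteq> 0 \<Longrightarrow> (f has_derivative D x) (at x)" using der[OF 0] by blast
    then have "continuous_on (- {0}) f"
      by (intro continuous_at_imp_continuous_on) (auto intro: has_derivative_continuous)
    then show ?case by simp
  next
    case (Suc k)
    obtain D where D: "\<And>x. x \<noteq> 0 \<Longrightarrow> (f has_derivative D x) (at x)"
      "\<And>h. rational2 (\<lambda>x. D x h $ 1)" "\<And>h. rational2 (\<lambda>x. D x h $ 2)" using der[OF Suc.prems] by blast
    have "frechet_derivative f (at x) = D x" if "x \<noteq> 0" for x
      using frechet_derivative_at[OF D(1)[OF that]] by simp
    then have "Ck_on k (\<lambda>x. frechet_derivative f (at x) b) (- {0})" for b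
      by (intro Ck_on_cong[OF op _ Suc.IH[OF D(2,3)]]) auto
    moreover have "f differentiable_on (- {0})"
      unfolding differentiable_on_eq_differentiable_at[OF op] differentiable_def using D(1) by blast
    ultimately show ?case by simp
  qed
qed

section \<open>Inverse stereographic projection\<close>

text \<open>For \<open>s\<close> equal to 1 or -1 this inverts \<open>stereo s\<close>. It misses
  the pole of height \<open>s\<close>, which corresponds to infinity, and sends 0 to the opposite
  pole.\<close>

definition spsi :: "real \<Rightarrow> complex \<Rightarrow> real^3" where
  "spsi s z = vector [2 * Re z / (1 + (cmod z)\<^sup>2), 2 * Im z / (1 + (cmod z)\<^sup>2), s * ((cmod z)\<^sup>2 - 1) / (1 + (cmod z)\<^sup>2)]"

lemma one_plus_sq_pos: "0 < 1 + (cmod z)\<^sup>2"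
  by (simp add: add_pos_nonneg)

lemma spsi_nth [simp]: "spsi s z $ 1 = 2 * Re z / (1 + (cmod z)\<^sup>2)" "spsi s z $ 2 = 2 * Im z / (1 + (cmod z)\<^sup>2)"
  "spsi s z $ 3 = s * ((cmod z)\<^sup>2 - 1) / (1 + (cmod z)\<^sup>2)"
  by (simp_all add: spsi_def)

lemma stereo_spsi:
  assumes "s = 1 \<or> s = - 1" shows "stereo s (spsi s z) = toV z"
proof -
  have ss: "s * s = 1" using assms by auto
  have "1 - s * (s * ((cmod z)\<^sup>2 - 1) / (1 + (cmod z)\<^sup>2)) = 1 - (s * s) * ((cmod z)\<^sup>2 - 1) / (1 + (cmod z)\<^sup>2)" by simp
  also have "\<dots> = 2 / (1 + (cmod z)\<^sup>2)" unfolding ss using one_plus_sq_pos[of z] by (simp add: field_simps)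
  finally have e: "1 - s * (s * ((cmod z)\<^sup>2 - 1) / (1 + (cmod z)\<^sup>2)) = 2 / (1 + (cmod z)\<^sup>2)" .
  have nz: "1 + (cmod z)\<^sup>2 \<noteq> 0" using one_plus_sq_pos[of z] by simp
  show ?thesis unfolding stereo_def spsi_nth e toV_def using nz by simp
qed

text \<open>Neither stereographic chart is composed with a conjugation, so the change of charts is
  the reflection in the unit circle and not \<open>1 / z\<close>: both coordinates of a point lie on
  the same ray, with reciprocal moduli.\<close>

lemma spsi_inversion:
  assumes "z \<noteq> 0" shows "spsi (- s) (1 / cnj z) = spsi s z"
proof -
  have c: "cmod (1 / cnj z) = 1 / cmod z" by (simp add: norm_divide)
  have re: "Re (1 / cnj z) = Re z / (cmod z)\<^sup>2" "Im (1 / cnj z) = Im z / (cmod z)\<^sup>2"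
    by (simp_all add: Re_divide Im_divide cmod_power2)
  have nz: "(cmod z)\<^sup>2 \<noteq> 0" "1 + (cmod z)\<^sup>2 \<noteq> 0" "0 < (cmod z)\<^sup>2" using assms one_plus_sq_pos[of z] by auto
  have e: "1 + (1 / cmod z)\<^sup>2 = (1 + (cmod z)\<^sup>2) / (cmod z)\<^sup>2" using nz by (simp add: field_simps power2_eq_square)
  have e2: "(1 / cmod z)\<^sup>2 - 1 = (1 - (cmod z)\<^sup>2) / (cmod z)\<^sup>2" using nz by (simp add: field_simps power2_eq_square)
  show ?thesis
    unfolding spsi_def re c e e2 using nz
    by (simp add: vec_eq_iff forall_3) (simp add: minus_divide_left algebra_simps)
qed

text \<open>At \<open>z = 0\<close>, a point outside the second chart, both sides are 0 by the
  convention for division by zero.\<close>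

lemma stereo_minus_spsi:
  assumes "s = 1 \<or> s = - 1" shows "stereo (- s) (spsi s z) = toV (1 / cnj z)"
proof (cases "z = 0")
  case True
  then show ?thesis by (simp add: stereo_def toV_def)
next
  case False
  then show ?thesis using stereo_spsi[of "- s" "1 / cnj z"] spsi_inversion[OF False, of s] assms by auto
qed

lemma norm_spsi:
  assumes "s = 1 \<or> s = - 1" shows "norm (spsi s z) = 1"
proof -
  have ss: "s\<^sup>2 = 1" using assms by auto
  have "(norm (spsi s z))\<^sup>2 = (spsi s z $ 1)\<^sup>2 + (spsi s z $ 2)\<^sup>2 + (spsi s z $ 3)\<^sup>2"
    by (simp add: norm_vec_def L2_set_def sum_3)
  also have "\<dots> = (4 * ((Re z)\<^sup>2 + (Im z)\<^sup>2) + s\<^sup>2 * ((cmod z)\<^sup>2 - 1)\<^sup>2) / (1 + (cmod z)\<^sup>2)\<^sup>2"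
    by (simp add: power_divide power_mult_distrib add_divide_distrib)
  also have "\<dots> = 1"
  proof -
    have "4 * (cmod z)\<^sup>2 + 1 * ((cmod z)\<^sup>2 - 1)\<^sup>2 = (1 + (cmod z)\<^sup>2)\<^sup>2" by (simp add: power2_eq_square algebra_simps)
    moreover have "(1 + (cmod z)\<^sup>2)\<^sup>2 \<noteq> 0" using one_plus_sq_pos[of z] by simp
    ultimately show ?thesis unfolding ss cmod_power2[symmetric] by simp
  qed
  finally show ?thesis by (metis norm_ge_zero power2_eq_1_iff abs_of_nonneg abs_minus abs_one)
qed

lemma range_spsi:
  assumes s: "s = 1 \<or> s = - 1" shows "range (spsi s) = sphere 0 1 - {axis 3 s}"
proof
  have "spsi s z \<noteq> axis 3 s" for z
  proof
    assume "spsi s z = axis 3 s"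
    then have "spsi s z $ 3 = s" by (simp add: axis_def)
    then have "s * ((cmod z)\<^sup>2 - 1) = s * (1 + (cmod z)\<^sup>2)" using one_plus_sq_pos[of z] by (simp add: field_simps)
    then show False using s by auto
  qed
  then show "range (spsi s) \<subseteq> sphere 0 1 - {axis 3 s}" using norm_spsi[OF s] by auto
  show "sphere 0 1 - {axis 3 s} \<subseteq> range (spsi s)"
  proof
    fix x :: "real^3" assume x: "x \<in> sphere 0 1 - {axis 3 s}"
    then have "(norm x)\<^sup>2 = 1" by simp
    then have n: "(x $ 1)\<^sup>2 + (x $ 2)\<^sup>2 + (x $ 3)\<^sup>2 = 1" by (simp add: norm_vec_def L2_set_def sum_3)
    \<comment> \<open>The height towards the missing pole; the preimage then has squared modulus
      \<open>(1 + u) / (1 - u)\<close>.\<close>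
    define u where "u = s * x $ 3"
    have ss: "s * s = 1" using s by auto
    have x3: "x $ 3 = s * u" using ss by (simp add: u_def mult.assoc[symmetric])
    have uu: "(x $ 1)\<^sup>2 + (x $ 2)\<^sup>2 = (1 - u) * (1 + u)"
    proof -
      have "(x $ 3)\<^sup>2 = u\<^sup>2" using s x3 by (auto simp: power2_eq_square)
      then show ?thesis using n by (simp add: algebra_simps power2_eq_square)
    qed
    have u1: "u \<noteq> 1"
    proof
      assume "u = 1"
      then have "x $ 1 = 0" "x $ 2 = 0" "x $ 3 = s" using uu x3 by (auto simp: sum_power2_eq_zero_iff)
      then show False using x by (auto simp: vec_eq_iff forall_3 axis_def)
    qed
    define z where "z = Complex (x $ 1 / (1 - u)) (x $ 2 / (1 - u))"
    have "(cmod z)\<^sup>2 = ((x $ 1)\<^sup>2 + (x $ 2)\<^sup>2) / (1 - u)\<^sup>2"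
      by (simp add: z_def cmod_power2 power_divide add_divide_distrib)
    also have "\<dots> = (1 + u) / (1 - u)" unfolding uu using u1 by (simp add: power2_eq_square)
    finally have cz: "(cmod z)\<^sup>2 = (1 + u) / (1 - u)" .
    have e: "1 + (cmod z)\<^sup>2 = 2 / (1 - u)" "(cmod z)\<^sup>2 - 1 = 2 * u / (1 - u)" unfolding cz using u1 by (auto simp: field_simps)
    have "spsi s z = x"
      unfolding spsi_def e using u1 x3 by (simp add: vec_eq_iff forall_3 z_def)
    then show "x \<in> range (spsi s)" by blast
  qed
qed

lemma continuous_on_vector3:
  assumes "continuous_on S f" "continuous_on S g" "continuous_on S (h :: 'a::topological_space \<Rightarrow> real)"
  shows "continuous_on S (\<lambda>x. vector [f x, g x, h x] :: real^3)"
proof -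
  have "(\<lambda>x. vector [f x, g x, h x] :: real^3) = (\<lambda>x. \<chi> i. if i = 1 then f x else if i = 2 then g x else h x)"
    by (auto simp: fun_eq_iff vec_eq_iff forall_3)
  moreover have "continuous_on S \<dots>"
    by (intro continuous_on_vec_lambda) (rename_tac i, case_tac "i = 1"; case_tac "i = 2"; simp add: assms)
  ultimately show ?thesis by metis
qed

lemma continuous_on_vector2:
  assumes "continuous_on S f" "continuous_on S (g :: 'a::topological_space \<Rightarrow> real)"
  shows "continuous_on S (\<lambda>x. vector [f x, g x] :: real^2)"
proof -
  have "(\<lambda>x. vector [f x, g x] :: real^2) = (\<lambda>x. \<chi> i. if i = 1 then f x else g x)"
    by (auto simp: fun_eq_iff vec_eq_iff forall_2)
  moreover have "continuous_on S \<dots>"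
    by (intro continuous_on_vec_lambda) (rename_tac i, case_tac "i = 1"; case_tac "i = 2"; simp add: assms)
  ultimately show ?thesis by metis
qed

lemma chart_param_spsi:
  assumes s: "s = 1 \<or> s = - 1" shows "chart_param (spsi s) (stereo s)"
proof
  have nz: "1 + (cmod z)\<^sup>2 \<noteq> 0" for z using one_plus_sq_pos[of z] by simp
  show "continuous_on UNIV (spsi s)"
    unfolding spsi_def[abs_def] by (intro continuous_on_vector3 continuous_intros) (auto simp: nz)
  have ne: "1 - s * x $ 3 \<noteq> 0" if "x \<in> range (spsi s)" for x
  proof
    assume "1 - s * x $ 3 = 0"
    then have x3: "x $ 3 = s" using s by auto
    have "(norm x)\<^sup>2 = 1" using that norm_spsi[OF s] by auto
    then have "(x $ 1)\<^sup>2 + (x $ 2)\<^sup>2 + (x $ 3)\<^sup>2 = 1" by (simp add: norm_vec_def L2_set_def sum_3)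
    moreover have "(x $ 3)\<^sup>2 = 1" using x3 s by auto
    ultimately have "x $ 1 = 0 \<and> x $ 2 = 0" by (simp add: sum_power2_eq_zero_iff)
    then have "x = axis 3 s" using x3 by (simp add: vec_eq_iff forall_3 axis_def)
    then show False using that range_spsi[OF s] by blast
  qed
  show "continuous_on (range (spsi s)) (stereo s)"
    unfolding stereo_def[abs_def] by (intro continuous_on_vector2 continuous_intros) (use ne in auto)
qed (rule stereo_spsi[OF s])

definition schart :: "real \<Rightarrow> (real^3, 2) chart" where "schart s = (range (spsi s), stereo s)"

lemma sphere2_eq: "sphere2 = \<lparr>mtop = top_of_set (sphere 0 1), atlas = {schart 1, schart (- 1)}\<rparr>"
  by (simp add: sphere2_def schart_def range_spsi)

lemma spsi_eq_opposite_iff: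
  assumes "s = 1 \<or> s = - 1" shows "spsi s z \<in> range (spsi (- s)) \<longleftrightarrow> z \<noteq> 0"
proof
  assume "spsi s z \<in> range (spsi (- s))"
  then have "spsi s z \<noteq> axis 3 (- s)" using range_spsi[of "- s"] assms by auto
  moreover have "spsi s 0 = axis 3 (- s)" by (simp add: vec_eq_iff forall_3 axis_def)
  ultimately show "z \<noteq> 0" by auto
qed (metis rangeI spsi_inversion)

definition inversion_diff :: "complex \<Rightarrow> complex \<Rightarrow> complex" where
  "inversion_diff z v = - cnj v / (cnj z)\<^sup>2"

lemma inversion_has_derivative:
  assumes "z \<noteq> 0" shows "((\<lambda>z. 1 / cnj z) has_derivative inversion_diff z) (at z within S)"
proof -
  have "((\<lambda>z. inverse (cnj z)) has_derivative (\<lambda>h. - (inverse (cnj z) * cnj h * inverse (cnj z)))) (at z within S)"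
    by (rule Deriv.has_derivative_inverse) (use assms in \<open>auto intro!: derivative_intros bounded_linear_imp_has_derivative bounded_linear_cnj\<close>)
  moreover have "inversion_diff z = (\<lambda>h. - (inverse (cnj z) * cnj h * inverse (cnj z)))"
    by (simp add: inversion_diff_def fun_eq_iff power2_eq_square divide_inverse)
  ultimately show ?thesis by (simp only: divide_inverse mult_1_left)
qed

lemma inversion_diff_inverse: "z \<noteq> 0 \<Longrightarrow> inversion_diff (1 / cnj z) (inversion_diff z v) = v"
  by (simp add: inversion_diff_def power2_eq_square)

lemma smooth_inversion:
  assumes "0 \<notin> S" shows "smooth_on S (\<lambda>x. toV (1 / cnj (toC x)))"
proof -
  let ?g = "\<lambda>x::real^2. toV (1 / cnj (toC x))"
  have g: "?g x $ i = x $ i * inverse ((x $ 1)\<^sup>2 + (x $ 2)\<^sup>2)" if "i = 1 \<or> i = 2" for x i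
    using that by (auto simp: Re_divide Im_divide divide_inverse)
  have "Ck_on k ?g (- {0})" for k
  proof (rule Ck_on_rational2)
    have r: "rational2 (\<lambda>x. x $ i * inverse ((x $ 1)\<^sup>2 + (x $ 2)\<^sup>2))" for i
      by (intro rational2.intros)
    show "rational2 (\<lambda>x. ?g x $ 1)" by (subst g) (simp_all add: r)
    show "rational2 (\<lambda>x. ?g x $ 2)" by (subst g) (simp_all add: r)
  qed
  then show ?thesis unfolding smooth_on_def using assms
    by (intro ballI exI[of _ "- {0}"] exI[of _ ?g]) auto
qed

lemma spsi_compatible:
  assumes s: "s = 1 \<or> s = - 1" and t: "t = 1 \<or> t = - 1"
  shows "compatible (spsi s ` G, stereo s) (spsi t ` H, stereo t)"
proof (cases "s = t")
  case True
  then show ?thesis using chart_param.compatible_\<psi>[OF chart_param_spsi[OF s]] by simp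
next
  case False
  then have st: "t = - s" using s t by auto
  have "smooth_on (transition_dom (spsi s ` G, stereo s) (spsi (- s) ` H, stereo (- s)))
     (transition (spsi s ` G, stereo s) (spsi (- s) ` H, stereo (- s)))" if s: "s = 1 \<or> s = - 1" for s G H
  proof (subst smooth_on_cong)
    let ?S = "transition_dom (spsi s ` G, stereo s) (spsi (- s) ` H, stereo (- s))"
    have ex: "\<exists>z. z \<in> G \<and> z \<noteq> 0 \<and> x = toV z" if "x \<in> ?S" for x
    proof -
      have "x \<in> stereo s ` (spsi s ` G \<inter> spsi (- s) ` H)" using that by (simp add: transition_dom_def)
      then obtain w where w: "w \<in> spsi s ` G" "w \<in> spsi (- s) ` H" "x = stereo s w" by blast
      then obtain z where z: "z \<in> G" "w = spsi s z" by blast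
      then have z: "z \<in> G" "spsi s z \<in> spsi (- s) ` H" "x = toV z" using w stereo_spsi[OF s] by auto
      then have "z \<noteq> 0" using spsi_eq_opposite_iff[OF s, of z] by blast
      then show ?thesis using z by blast
    qed
    show "transition (spsi s ` G, stereo s) (spsi (- s) ` H, stereo (- s)) x = toV (1 / cnj (toC x))" if "x \<in> ?S" for x
      using ex[OF that] chart_param.inv_into_\<phi>[OF chart_param_spsi[OF s]] stereo_minus_spsi[OF s] by (auto simp: transition_def)
    have "0 \<notin> ?S" using ex[of 0] by (metis toC_toV toC_eq_0_iff)
    then show "smooth_on ?S (\<lambda>x. toV (1 / cnj (toC x)))" by (rule smooth_inversion)
  qed
  from this[OF s] this[of "- s"] s show ?thesis unfolding st compatible_def by auto
qed

lemma openin_spsi: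
  assumes s: "s = 1 \<or> s = - 1" and G: "open G"
  shows "openin (top_of_set (sphere 0 1)) (spsi s ` G)"
proof -
  have r: "openin (top_of_set (sphere 0 1)) (range (spsi s))"
    unfolding range_spsi[OF s] by (metis Diff_eq openin_open_Int open_Compl closed_singleton)
  have "continuous_on (range (spsi s)) (\<lambda>x. toC (stereo s x))"
    by (intro continuous_on_toC chart_param.\<phi>_continuous[OF chart_param_spsi[OF s]])
  from continuous_openin_preimage_gen[OF this G]
  have "openin (top_of_set (range (spsi s))) (range (spsi s) \<inter> (\<lambda>x. toC (stereo s x)) -` G)" .
  moreover have "range (spsi s) \<inter> (\<lambda>x. toC (stereo s x)) -` G = spsi s ` G"
    using stereo_spsi[OF s] by auto
  ultimately show ?thesis using openin_trans r by metis
qed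

lemma sphere_cover: "sphere 0 1 = range (spsi 1) \<union> range (spsi (- 1))"
proof -
  have "axis 3 1 \<noteq> (axis 3 (- 1) :: real^3)" by (simp add: vec_eq_iff forall_3 axis_def)
  then show ?thesis unfolding range_spsi[OF disjI1[OF refl]] range_spsi[OF disjI2[OF refl]] by blast
qed

lemma manifold_sphere2: "manifold sphere2"
proof -
  have "is_chart (top_of_set (sphere 0 1)) (schart s)" if "s = 1 \<or> s = - 1" for s
    unfolding schart_def by (rule chart_param.is_chart_\<psi>[OF chart_param_spsi[OF that] open_UNIV openin_spsi[OF that open_UNIV]])
  moreover have "compatible (schart s) (schart t)" if "s = 1 \<or> s = - 1" "t = 1 \<or> t = - 1" for s t
    unfolding schart_def by (rule spsi_compatible[OF that])
  ultimately show ?thesis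
    unfolding manifold_def sphere2_eq using second_countable_top_of_set sphere_cover
    by (auto simp: Hausdorff_space_subtopology Hausdorff_space_euclidean schart_def)
qed

lemma schart_neq: "s = 1 \<or> s = - 1 \<Longrightarrow> schart (- s) \<noteq> schart s"
proof
  assume s: "s = 1 \<or> s = - 1" and "schart (- s) = schart s"
  then have "range (spsi (- s)) = range (spsi s)" by (simp add: schart_def)
  then show False using spsi_eq_opposite_iff[OF s, of 0] by blast
qed

text \<open>A tangent vector has one representative in each chart that contains its base point. The
  point with coordinate 0 is the pole that the other chart omits, so there only one remains.\<close>

lemma tvec_sphere2:
  assumes s: "s = 1 \<or> s = - 1" and G: "open G" "z \<in> G"
  shows "tvec sphere2 (spsi s ` G, stereo s) (spsi s z) v =
    (spsi s z, insert (schart s, v) (if z = 0 then {} else {(schart (- s), toV (inversion_diff z (toC v)))}))"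
proof -
  have at: "atlas sphere2 = {schart s, schart (- s)}" using s by (auto simp: sphere2_eq)
  have vim: "spsi s -` fst (schart s) = UNIV" "spsi s -` fst (schart (- s)) = - {0}"
    using spsi_eq_opposite_iff[OF s] by (auto simp: schart_def)
  have 1: "(snd (schart s) \<circ> spsi s \<circ> toC has_derivative D) (at x) \<longleftrightarrow> D = (\<lambda>v. v)" for D x
  proof -
    have "snd (schart s) \<circ> spsi s \<circ> toC = (\<lambda>x. x)" using stereo_spsi[OF s] by (auto simp: schart_def fun_eq_iff)
    then show ?thesis using has_derivative_unique has_derivative_ident by metis
  qed
  have 2: "(snd (schart (- s)) \<circ> spsi s \<circ> toC has_derivative D) (at (toV z)) \<longleftrightarrow> D = (\<lambda>v. toV (inversion_diff z (toC v)))"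
    if "z \<noteq> 0" for D
  proof -
    have eq: "snd (schart (- s)) \<circ> spsi s \<circ> toC = (\<lambda>x. toV (1 / cnj (toC x)))"
      using stereo_minus_spsi[OF s] by (auto simp: schart_def fun_eq_iff)
    have "((\<lambda>z. 1 / cnj z) has_derivative inversion_diff z) (at (toC (toV z)))"
      using inversion_has_derivative[OF that] by simp
    from has_derivative_compose[OF has_derivative_toC[OF has_derivative_ident] this]
    have "((\<lambda>x. toV (1 / cnj (toC x))) has_derivative (\<lambda>v. toV (inversion_diff z (toC v)))) (at (toV z))"
      by (rule has_derivative_toV)
    then show ?thesis unfolding eq using has_derivative_unique by metis
  qed
  have "tvec sphere2 (spsi s ` G, stereo s) (spsi s z) v = (spsi s z, {(c', v'). c' \<in> atlas sphere2 \<and> spsi s z \<in> fst c' \<and>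
      (\<exists>D. (snd c' \<circ> spsi s \<circ> toC has_derivative D) (at (toV z)) \<and> v' = D v)})"
  proof (rule chart_param.tvec_\<psi>[OF chart_param_spsi[OF s] G])
    show "open (spsi s -` fst c)" if "c \<in> atlas sphere2" for c
      using that unfolding at by (auto simp: vim)
  qed
  moreover have "spsi s z \<in> fst (schart s)" "spsi s z \<in> fst (schart (- s)) \<longleftrightarrow> z \<noteq> 0"
    using spsi_eq_opposite_iff[OF s] by (auto simp: schart_def)
  ultimately show ?thesis unfolding at using schart_neq[OF s] 1 2 by (auto simp del: comp_apply)
qed

lemma tvec_sphere2_change:
  assumes s: "s = 1 \<or> s = - 1" and z: "z \<noteq> 0"
  shows "tvec sphere2 (schart (- s)) (spsi (- s) (1 / cnj z)) (toV (inversion_diff z v)) = tvec sphere2 (schart s) (spsi s z) (toV v)"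
proof -
  have s': "- s = 1 \<or> - s = - 1" using s by auto
  have "spsi (- s) (1 / cnj z) = spsi s z" by (rule spsi_inversion[OF z])
  then show ?thesis
    using tvec_sphere2[OF s' open_UNIV, of "1 / cnj z" "toV (inversion_diff z v)"] tvec_sphere2[OF s open_UNIV, of z "toV v"] z
      inversion_diff_inverse[OF z, of v]
    by (simp add: schart_def insert_commute)
qed

section \<open>Consequences of monotonicity\<close>

lemma borel_sets_top_of_set:
  assumes "S \<in> sets borel"
  shows "borel_sets (top_of_set S) = {X. X \<in> sets borel \<and> X \<subseteq> S}"
proof -
  have "borel_sets (top_of_set S) = sigma_sets S ((\<inter>) S ` {U. open U})"
    unfolding borel_sets_def by (rule arg_cong2[where f = sigma_sets]) (auto simp: openin_open)
  also have "\<dots> = (\<inter>) S ` sets borel"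
    using sigma_sets_Int[of S UNIV "{U. open U}"] assms by (simp add: borel_def)
  also have "\<dots> = {X. X \<in> sets borel \<and> X \<subseteq> S}"
    using assms by (auto simp: image_iff)
  finally show ?thesis .
qed

section \<open>The sup-norm plane in coordinates\<close>

definition ppsi :: "complex \<Rightarrow> real^3" where "ppsi z = vector [Re z, Im z, 0]"
definition pphi :: "real^3 \<Rightarrow> real^2" where "pphi x = vector [x $ 1, x $ 2]"
definition sup_norm :: "complex \<Rightarrow> complex \<Rightarrow> real" where "sup_norm z v = infnorm (toV v)"

lemma ppsi_nth [simp]: "ppsi z $ 1 = Re z" "ppsi z $ 2 = Im z" "ppsi z $ 3 = 0"
  by (simp_all add: ppsi_def)

lemma range_ppsi: "range ppsi = {x. x $ 3 = 0}"
proof -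
  have "x = ppsi (Complex (x $ 1) (x $ 2))" if "x $ 3 = 0" for x
    using that by (simp add: vec_eq_iff forall_3)
  then show ?thesis by auto
qed

lemma sup_norm_eq: "sup_norm z v = max \<bar>Re v\<bar> \<bar>Im v\<bar>"
  by (simp add: sup_norm_def infnorm_2)

interpretation pl: chart_param ppsi pphi
proof
  show "continuous_on UNIV ppsi" unfolding ppsi_def[abs_def] by (intro continuous_on_vector3 continuous_intros)
  show "continuous_on (range ppsi) pphi" unfolding pphi_def[abs_def] by (intro continuous_on_vector2 continuous_intros)
  show "pphi (ppsi z) = toV z" for z by (simp add: pphi_def toV_def)
qed

interpretation sn: plane_finsler sup_norm
proof
  show "continuous_on UNIV (\<lambda>(z, v). sup_norm z v)"
    unfolding sup_norm_eq split_beta by (intro continuous_intros)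
  have "infnorm (r *\<^sub>R x) = r * infnorm x" if "0 < r" for r and x :: "real^2"
    using that infnorm_mul[of r x] by simp
  then show "asymmetric_norm (sup_norm z)" for z
    unfolding asymmetric_norm_def sup_norm_def linear_add[OF linear_toV] linear_cmul[OF linear_toV]
    using infnorm_pos_le infnorm_triangle by (auto simp: infnorm_eq_0 vec_eq_iff forall_2 complex_eq_iff)
  show "sup_norm z (- v) = sup_norm z v" for z v by (simp add: sup_norm_eq)
qed

lemma seg_sup_norm: "seg sup_norm p q = max \<bar>Re (q - p)\<bar> \<bar>Im (q - p)\<bar>"
  by (simp add: seg_def sup_norm_eq)

lemma plane_eq: "plane = open_mfd ppsi pphi UNIV" and plane_chart_eq: "plane_chart = (range ppsi, pphi)"
  by (simp_all add: plane_def open_mfd_def plane_chart_def range_ppsi pphi_def[abs_def])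

lemma sup_metric_tvec:
  "open G \<Longrightarrow> z \<in> G \<Longrightarrow> sup_metric (tvec plane (ppsi ` G, pphi) (ppsi z) v) = sup_norm z (toC v)"
  unfolding plane_eq by (subst pl.tvec_open_mfd) (auto simp: sup_metric_def plane_chart_eq sup_norm_def)

lemma sup_metric_eq: "sup_metric (tvec plane plane_chart (ppsi z) v) = chart_metric pphi sup_norm (tvec plane plane_chart (ppsi z) v)"
  using sup_metric_tvec[of UNIV z v] pl.chart_metric_tvec[of UNIV z UNIV sup_norm v] by (simp add: plane_eq plane_chart_eq)

lemma plane_reversible_finsler_manifold: "reversible_finsler_manifold plane sup_metric"
proof -
  have r: "reversible_finsler_manifold plane (chart_metric pphi sup_norm)"
    unfolding plane_eq by (rule pl.open_mfd_reversible_finsler_manifold[OF sn.plane_finsler_axioms open_UNIV])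
  have at: "atlas plane = {(range ppsi, pphi)}" by (simp add: plane_eq open_mfd_def)
  note eq = sup_metric_eq[unfolded plane_chart_eq]
  have c: "continuous_on (toV ` UNIV \<times> UNIV) (\<lambda>(x, v). sup_metric (tvec plane (range ppsi, pphi) (inv_into (range ppsi) pphi x) v))"
  proof (rule continuous_on_eq)
    show "continuous_on (toV ` UNIV \<times> UNIV) (\<lambda>(x, v). chart_metric pphi sup_norm (tvec plane (range ppsi, pphi) (inv_into (range ppsi) pphi x) v))"
      using r by (auto simp: reversible_finsler_manifold_def finsler_metric_def at)
  qed (auto simp: eq)
  have "(\<lambda>v. sup_metric (tvec plane (range ppsi, pphi) (ppsi z) v)) = (\<lambda>v. chart_metric pphi sup_norm (tvec plane (range ppsi, pphi) (ppsi z) v))" for z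
    by (rule ext) (rule eq)
  then show ?thesis using r c by (auto simp: reversible_finsler_manifold_def finsler_metric_def reversible_def at eq)
qed

lemma (in chart_param) open_mfd_points: "points (open_mfd \<psi> \<phi> G) = \<psi> ` G"
  by (simp add: open_mfd_def)

section \<open>Null sets and area bounds from monotonicity\<close>

locale sphere_volume =
  fixes \<Phi> :: "(real^3, 2) tangent \<Rightarrow> real"
    and \<A> :: "(real^3, 2) mfd \<Rightarrow> ((real^3, 2) tangent \<Rightarrow> real) \<Rightarrow> (real^3) measure"
    and c :: real
  assumes fm: "finsler_metric sphere2 \<Phi>" and rev: "reversible sphere2 \<Phi>"
    and vol: "finsler_volume \<A>" and c: "c > 0"
    and rect: "\<And>d1 d2. d1 > 0 \<Longrightarrow> d2 > 0 \<Longrightarrow> measure (\<A> plane sup_metric) (rectangle d1 d2) = c * d1 * d2"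
begin

lemma volume_sets:
  "reversible_finsler_manifold M \<Psi> \<Longrightarrow> space (\<A> M \<Psi>) = points M \<and> sets (\<A> M \<Psi>) = borel_sets (mtop M)"
  using vol unfolding finsler_volume_def by blast

lemma volume_restrict:
  "reversible_finsler_manifold M \<Psi> \<Longrightarrow> reversible_finsler_manifold N \<Psi>' \<Longrightarrow> subdomain N M \<Longrightarrow>
    restricts_to M \<Psi> N \<Psi>' \<Longrightarrow> A \<in> borel_sets (mtop N) \<Longrightarrow> emeasure (\<A> N \<Psi>') A = emeasure (\<A> M \<Psi>) A"
  using vol unfolding finsler_volume_def by blast

lemma volume_mono:
  "reversible_finsler_manifold M \<Psi> \<Longrightarrow> reversible_finsler_manifold N \<Psi>' \<Longrightarrow> short_map M \<Psi> N \<Psi>' f \<Longrightarrow>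
    emeasure (\<A> N \<Psi>') (f ` points M) \<le> emeasure (\<A> M \<Psi>) (points M)"
  using vol unfolding finsler_volume_def by blast

lemma volume_plane_open:
  assumes "open G" "A \<in> borel_sets (top_of_set (ppsi ` G))"
  shows "emeasure (\<A> (open_mfd ppsi pphi G) (chart_metric pphi sup_norm)) A = emeasure (\<A> plane sup_metric) A"
proof (rule volume_restrict[OF plane_reversible_finsler_manifold
      pl.open_mfd_reversible_finsler_manifold[OF sn.plane_finsler_axioms assms(1)]])
  show "subdomain (open_mfd ppsi pphi G) plane"
    unfolding subdomain_def plane_eq
    using pl.compatible_\<psi>[of G UNIV] by (auto simp: open_mfd_def subtopology_subtopology inf_absorb2 image_mono)
  show "restricts_to plane sup_metric (open_mfd ppsi pphi G) (chart_metric pphi sup_norm)"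
    unfolding restricts_to_def using sup_metric_tvec[OF assms(1)] pl.chart_metric_tvec[OF assms(1) _ assms(1)]
    by (auto simp: open_mfd_def)
qed (use assms(2) in \<open>simp add: open_mfd_def\<close>)

lemma closed_rectangle: "closed (rectangle d1 d2)"
proof -
  have "rectangle d1 d2 = {x. 0 \<le> x $ 1} \<inter> {x. x $ 1 \<le> d1} \<inter> {x. 0 \<le> x $ 2} \<inter> {x. x $ 2 \<le> d2} \<inter> {x. x $ 3 = 0}"
    by (auto simp: rectangle_def)
  moreover have "closed \<dots>" by (intro closed_Int closed_Collect_le closed_Collect_eq continuous_intros)
  ultimately show ?thesis by simp
qed

lemma borel_sets_plane: "borel_sets (mtop plane) = {X. X \<in> sets borel \<and> X \<subseteq> range ppsi}"
proof -
  have "closed {x::real^3. x $ 3 = 0}" by (intro closed_Collect_eq continuous_intros)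
  then show ?thesis unfolding plane_eq open_mfd_def by (simp add: borel_sets_top_of_set range_ppsi)
qed

lemma rectangle_sets: "rectangle d1 d2 \<in> sets (\<A> plane sup_metric)"
  using volume_sets[OF plane_reversible_finsler_manifold] closed_rectangle
  by (auto simp: borel_sets_plane range_ppsi rectangle_def)

lemma emeasure_rectangle:
  assumes "0 < d1" "0 < d2"
  shows "emeasure (\<A> plane sup_metric) (rectangle d1 d2) = ennreal (c * d1 * d2)"
proof -
  have "measure (\<A> plane sup_metric) (rectangle d1 d2) \<noteq> 0" using rect[OF assms] c assms by simp
  then have "emeasure (\<A> plane sup_metric) (rectangle d1 d2) \<noteq> \<infinity>" by (auto simp: measure_def)
  then show ?thesis using rect[OF assms] by (simp add: emeasure_eq_ennreal_measure)
qed

text \<open>Distances in the target are bounded by segments, those in the source from below by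
  Lipschitz functions. The function \<open>h\<close> may depend on the pair of points: for a target
  with the sup norm one of two coordinates always serves.\<close>

lemma short_map_to_chart:
  assumes "chart_param \<psi> \<phi>" "chart_param \<psi>' \<phi>'" "plane_finsler F" "plane_finsler F'" and G: "open G"
    and f: "\<And>x y. x \<in> G \<Longrightarrow> y \<in> G \<Longrightarrow> \<exists>h. plane_finsler.seg_lipschitz F G h \<and> seg F' (k x) (k y) \<le> \<bar>h y - h x\<bar>"
  shows "short_map (open_mfd \<psi> \<phi> G) (chart_metric \<phi> F) (open_mfd \<psi>' \<phi>' UNIV) (chart_metric \<phi>' F') (\<lambda>x. \<psi>' (k (toC (\<phi> x))))"
proof -
  interpret a: chart_param \<psi> \<phi> by fact
  interpret b: chart_param \<psi>' \<phi>' by fact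
  have "finsler_dist (open_mfd \<psi>' \<phi>' UNIV) (chart_metric \<phi>' F') (\<psi>' (k x)) (\<psi>' (k y))
      \<le> finsler_dist (open_mfd \<psi> \<phi> G) (chart_metric \<phi> F) (\<psi> x) (\<psi> y)" if xy: "x \<in> G" "y \<in> G" for x y
  proof -
    obtain h where h: "plane_finsler.seg_lipschitz F G h" "seg F' (k x) (k y) \<le> \<bar>h y - h x\<bar>" using f[OF xy] by (elim exE conjE)
    have "finsler_dist (open_mfd \<psi>' \<phi>' UNIV) (chart_metric \<phi>' F') (\<psi>' (k x)) (\<psi>' (k y)) \<le> ennreal (seg F' (k x) (k y))"
      by (rule b.finsler_dist_le_seg[OF assms(4) open_UNIV]) simp
    also have "\<dots> \<le> ennreal \<bar>h y - h x\<bar>" using h(2) by (rule ennreal_leI)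
    also have "\<dots> \<le> finsler_dist (open_mfd \<psi> \<phi> G) (chart_metric \<phi> F) (\<psi> x) (\<psi> y)"
      by (rule a.finsler_dist_geI[OF assms(3) G xy h(1)])
    finally show ?thesis .
  qed
  then show ?thesis unfolding short_map_def a.open_mfd_points b.open_mfd_points by auto
qed

lemma cmod_le_sup: "cmod v \<le> 2 * max \<bar>Re v\<bar> \<bar>Im v\<bar>"
  using cmod_le[of v] by auto

text \<open>Scaling a sup-norm rectangle by \<open>1 / (2 * K)\<close> gives a short map onto the rotated box.\<close>

lemma volume_box_le:
  assumes ch: "chart_param \<psi> \<phi>" and F: "plane_finsler F" and u: "cmod u = 1" and r: "0 < r1" "0 < r2" and K: "0 < K"
    and bound: "\<And>x v. x \<in> cbox 0 (Complex r1 r2) \<Longrightarrow> F (a + u * x) v \<le> K * cmod v"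
  shows "emeasure (\<A> (open_mfd \<psi> \<phi> UNIV) (chart_metric \<phi> F)) (\<psi> ` (\<lambda>x. a + u * x) ` box 0 (Complex r1 r2))
    \<le> ennreal (c * (2 * K * r1) * (2 * K * r2))"
proof -
  interpret plane_finsler F by fact
  \<comment> \<open>The metric is at most \<open>K\<close> times the Euclidean norm, which is at
    most twice the sup norm; shrinking by \<open>2 * K\<close> makes the map short.\<close>
  define L where "L = 2 * K"
  have L: "0 < L" using K by (simp add: L_def)
  define B where "B = box 0 (Complex (L * r1) (L * r2))"
  define k where "k x = a + u * (x / of_real L)" for x
  have oB: "open B" unfolding B_def by (rule open_box)
  have Bmem: "x \<in> B \<longleftrightarrow> x / of_real L \<in> box 0 (Complex r1 r2)" for x
    using L by (auto simp: B_def in_box_complex_iff field_simps)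
  have kB: "k ` B = (\<lambda>x. a + u * x) ` box 0 (Complex r1 r2)"
  proof
    have "k x = (\<lambda>x. a + u * x) (x / of_real L)" for x by (simp add: k_def)
    then show "k ` B \<subseteq> (\<lambda>x. a + u * x) ` box 0 (Complex r1 r2)" using Bmem by blast
    show "(\<lambda>x. a + u * x) ` box 0 (Complex r1 r2) \<subseteq> k ` B"
    proof safe
      fix x assume "x \<in> box 0 (Complex r1 r2)"
      then have "of_real L * x \<in> B" "k (of_real L * x) = a + u * x" using L Bmem by (auto simp: k_def)
      then show "a + u * x \<in> k ` B" by (metis image_eqI)
    qed
  qed
  have short: "short_map (open_mfd ppsi pphi B) (chart_metric pphi sup_norm) (open_mfd \<psi> \<phi> UNIV) (chart_metric \<phi> F)
      (\<lambda>x. \<psi> (k (toC (pphi x))))"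
  proof (rule short_map_to_chart[OF pl.chart_param_axioms ch sn.plane_finsler_axioms F oB])
    fix x y assume xy: "x \<in> B" "y \<in> B"
    have seg: "seg F (k x) (k y) \<le> K * cmod (k y - k x)"
    proof (rule seg_bounds(2)[where m = 0])
      fix z assume z: "z \<in> closed_segment (k x) (k y)"
      show "0 * cmod (k y - k x) \<le> F z (k y - k x)" using F_nonneg by simp
      have "convex ((\<lambda>x. a + u * x) ` box 0 (Complex r1 r2))"
        using convex_translation[OF convex_linear_image[OF _ convex_box(2), of "\<lambda>x. u * x" 0 "Complex r1 r2"], of a]
        by (simp add: image_image linear_times)
      then have "closed_segment (k x) (k y) \<subseteq> (\<lambda>x. a + u * x) ` box 0 (Complex r1 r2)"
        using xy kB by (intro closed_segment_subset) blast+
      then obtain w where "w \<in> box 0 (Complex r1 r2)" "z = a + u * w" using z by blast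
      then show "F z (k y - k x) \<le> K * cmod (k y - k x)" using bound box_subset_cbox by blast
    qed
    have "k y - k x = u * ((y - x) / of_real L)" by (simp add: k_def algebra_simps diff_divide_distrib)
    then have "cmod (k y - k x) = cmod (y - x) / L" using u L by (simp add: norm_mult norm_divide)
    then have "seg F (k x) (k y) \<le> cmod (y - x) / 2" using seg K by (simp add: L_def)
    also have "\<dots> \<le> max \<bar>Re (y - x)\<bar> \<bar>Im (y - x)\<bar>" using cmod_le_sup[of "y - x"] by simp
    finally have le: "seg F (k x) (k y) \<le> \<bar>Re y - Re x\<bar> \<or> seg F (k x) (k y) \<le> \<bar>Im y - Im x\<bar>" by auto
    have "sn.seg_lipschitz B Re" "sn.seg_lipschitz B Im" by (auto simp: sn.seg_lipschitz_def seg_sup_norm)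
    then show "\<exists>h. sn.seg_lipschitz B h \<and> seg F (k x) (k y) \<le> \<bar>h y - h x\<bar>" using le by blast
  qed
  have "(\<lambda>x. \<psi> (k (toC (pphi x)))) ` points (open_mfd ppsi pphi B) = \<psi> ` k ` B"
    by (simp add: pl.open_mfd_points image_image)
  with volume_mono[OF pl.open_mfd_reversible_finsler_manifold[OF sn.plane_finsler_axioms oB]
      chart_param.open_mfd_reversible_finsler_manifold[OF ch F open_UNIV] short]
  have "emeasure (\<A> (open_mfd \<psi> \<phi> UNIV) (chart_metric \<phi> F)) (\<psi> ` k ` B)
      \<le> emeasure (\<A> (open_mfd ppsi pphi B) (chart_metric pphi sup_norm)) (ppsi ` B)"
    by (simp add: pl.open_mfd_points)
  also have "\<dots> = emeasure (\<A> plane sup_metric) (ppsi ` B)"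
  proof (rule volume_plane_open[OF oB])
    have "openin (top_of_set (ppsi ` B)) (ppsi ` B)" by simp
    then show "ppsi ` B \<in> borel_sets (top_of_set (ppsi ` B))" unfolding borel_sets_def by (intro sigma_sets.Basic) simp
  qed
  also have "\<dots> \<le> emeasure (\<A> plane sup_metric) (rectangle (L * r1) (L * r2))"
  proof (rule emeasure_mono[OF _ rectangle_sets])
    show "ppsi ` B \<subseteq> rectangle (L * r1) (L * r2)" by (auto simp: B_def rectangle_def in_box_complex_iff)
  qed
  also have "\<dots> = ennreal (c * (L * r1) * (L * r2))" using L r by (intro emeasure_rectangle) auto
  finally show ?thesis unfolding kB L_def .
qed

text \<open>The segment lies in rotated boxes of bounded length and width \<open>2 * e\<close>,
  whose area is at most a constant times \<open>e\<close>. A point is part of a longer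
  segment.\<close>

lemma volume_segment_zero:
  assumes ch: "chart_param \<psi> \<phi>" and F: "plane_finsler F"
    and borel: "\<And>X. compact X \<Longrightarrow> \<psi> ` X \<in> sets (\<A> (open_mfd \<psi> \<phi> UNIV) (chart_metric \<phi> F))"
      "\<And>X. open X \<Longrightarrow> \<psi> ` X \<in> sets (\<A> (open_mfd \<psi> \<phi> UNIV) (chart_metric \<phi> F))"
  shows "emeasure (\<A> (open_mfd \<psi> \<phi> UNIV) (chart_metric \<phi> F)) (\<psi> ` closed_segment p q) = 0"
proof -
  interpret plane_finsler F by fact
  let ?\<mu> = "\<A> (open_mfd \<psi> \<phi> UNIV) (chart_metric \<phi> F)"
  have main: "emeasure ?\<mu> (\<psi> ` closed_segment p q) = 0" if pq: "p \<noteq> q" for p q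
  proof -
    define l where "l = cmod (q - p)"
    have l: "0 < l" using pq by (simp add: l_def)
    define u where "u = (q - p) / of_real l"
    have u: "cmod u = 1" "u * of_real l = q - p" using l by (auto simp: u_def norm_divide l_def)
    obtain m M where "0 < m" and M: "0 < M" "\<And>z v. z \<in> cball p (2 * l + 8) \<Longrightarrow> m * cmod v \<le> F z v"
      "\<And>z v. z \<in> cball p (2 * l + 8) \<Longrightarrow> F z v \<le> M * cmod v"
      by (rule F_bounds[OF compact_cball[of p "2 * l + 8"]]) (rule that; assumption)
    have le: "emeasure ?\<mu> (\<psi> ` closed_segment p q) \<le> ennreal (c * (2 * M * (l + 2 * e)) * (2 * M * (2 * e)))"
      if e: "0 < e" "e \<le> 1" for e
    proof -
      \<comment> \<open>This corner leaves a margin \<open>e\<close> around the segment, which runs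
        along the midline of the box.\<close>
      define a where "a = p - u * Complex e e"
      have "\<psi> ` closed_segment p q \<subseteq> \<psi> ` (\<lambda>x. a + u * x) ` box 0 (Complex (l + 2 * e) (2 * e))"
      proof (intro image_mono subsetI)
        fix x assume "x \<in> closed_segment p q"
        then obtain t where t: "0 \<le> t" "t \<le> 1" "x = (1 - t) *\<^sub>R p + t *\<^sub>R q" by (auto simp: closed_segment_def)
        have "x = p + of_real t * (q - p)" unfolding t(3) by (simp add: scaleR_conv_of_real algebra_simps)
        also have "\<dots> = a + u * Complex (t * l + e) e"
        proof -
          have "Complex (t * l + e) e = of_real t * of_real l + Complex e e" by (simp add: complex_eq_iff)
          then show ?thesis unfolding u(2)[symmetric] by (simp add: a_def algebra_simps)
        qed
        finally have x: "x = a + u * Complex (t * l + e) e" .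
        have "0 \<le> t * l" "t * l \<le> l" using t l by (auto simp: mult_left_le_one_le)
        then have "Complex (t * l + e) e \<in> box 0 (Complex (l + 2 * e) (2 * e))" using e by (simp add: in_box_complex_iff)
        then show "x \<in> (\<lambda>x. a + u * x) ` box 0 (Complex (l + 2 * e) (2 * e))" using x by blast
      qed
      moreover have "open ((\<lambda>x. a + u * x) ` box 0 (Complex (l + 2 * e) (2 * e)))"
      proof -
        have "open ((*) u ` box 0 (Complex (l + 2 * e) (2 * e)))"
        proof (rule open_surjective_linear_image[OF open_box linear_times])
          show "surj ((*) u)" by (rule surjI[of _ "\<lambda>x. x / u"]) (use u(1) in auto)
        qed
        then show ?thesis using open_translation[of "(*) u ` box 0 (Complex (l + 2 * e) (2 * e))" a] by (simp add: image_image)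
      qed
      ultimately have "emeasure ?\<mu> (\<psi> ` closed_segment p q) \<le> emeasure ?\<mu> (\<psi> ` (\<lambda>x. a + u * x) ` box 0 (Complex (l + 2 * e) (2 * e)))"
        using borel(2) by (intro emeasure_mono) auto
      also have "\<dots> \<le> ennreal (c * (2 * M * (l + 2 * e)) * (2 * M * (2 * e)))"
      proof (rule volume_box_le[OF ch F u(1) _ _ M(1)])
        fix x v assume x: "x \<in> cbox 0 (Complex (l + 2 * e) (2 * e))"
        have "cmod (a + u * x - p) = cmod (x - Complex e e)"
        proof -
          have "a + u * x - p = u * (x - Complex e e)" by (simp add: a_def algebra_simps)
          then show ?thesis using u(1) by (simp add: norm_mult)
        qed
        also have "\<dots> \<le> \<bar>Re (x - Complex e e)\<bar> + \<bar>Im (x - Complex e e)\<bar>" by (rule cmod_le)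
        also have "\<dots> \<le> 2 * l + 8" using x e l by (auto simp: in_cbox_complex_iff)
        finally show "F (a + u * x) v \<le> M * cmod v" using M(3) by (simp add: dist_norm norm_minus_commute)
      qed (use l e in auto)
      finally show ?thesis .
    qed
    define C where "C = c * (2 * M * (l + 2)) * (2 * M * 2)"
    have C: "0 \<le> C" using c M l by (simp add: C_def)
    have Ce: "emeasure ?\<mu> (\<psi> ` closed_segment p q) \<le> ennreal (C * e)" if e: "0 < e" "e \<le> 1" for e
    proof -
      have "c * (2 * M * (l + 2 * e)) * (2 * M * (2 * e)) \<le> c * (2 * M * (l + 2)) * (2 * M * (2 * e))"
        using c M l e by (intro mult_right_mono mult_left_mono) auto
      also have "\<dots> = C * e" by (simp add: C_def)
      finally show ?thesis using le[OF e] by (meson ennreal_leI order_trans)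
    qed
    have small: "emeasure ?\<mu> (\<psi> ` closed_segment p q) \<le> ennreal (C * (1 / real (Suc n)))" for n
      by (rule Ce) auto
    have "(\<lambda>n. C * (1 / real (Suc n))) \<longlonglongrightarrow> C * 0"
      by (intro tendsto_mult tendsto_const LIMSEQ_inverse_real_of_nat[unfolded inverse_eq_divide])
    then have "(\<lambda>n. ennreal (C * (1 / real (Suc n)))) \<longlonglongrightarrow> ennreal (C * 0)" by (rule tendsto_ennrealI)
    then have "emeasure ?\<mu> (\<psi> ` closed_segment p q) \<le> ennreal (C * 0)"
      by (rule LIMSEQ_le_const) (use small in auto)
    then show ?thesis by simp
  qed
  show ?thesis
  proof (cases "p = q")
    case True
    have "emeasure ?\<mu> (\<psi> ` closed_segment p q) \<le> emeasure ?\<mu> (\<psi> ` closed_segment p (p + 1))"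
      using True borel(1)[OF compact_segment] by (intro emeasure_mono image_mono) auto
    then show ?thesis using main[of p "p + 1"] by simp
  qed (rule main)
qed

text \<open>The coordinate expression of the given metric in the stereographic chart that omits the
  pole of height \<open>s\<close>.\<close>

definition fin :: "real \<Rightarrow> complex \<Rightarrow> complex \<Rightarrow> real" where
  "fin s z v = \<Phi> (tvec sphere2 (schart s) (spsi s z) (toV v))"

lemma sphere2_reversible_finsler_manifold: "reversible_finsler_manifold sphere2 \<Phi>"
  using fm rev manifold_sphere2 by (simp add: reversible_finsler_manifold_def)

lemma schart_atlas: "s = 1 \<or> s = - 1 \<Longrightarrow> schart s \<in> atlas sphere2"
  by (auto simp: sphere2_eq)

lemma plane_finsler_fin:
  assumes s: "s = 1 \<or> s = - 1" shows "plane_finsler (fin s)"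
proof
  note ch = chart_param_spsi[OF s]
  have at: "(range (spsi s), stereo s) \<in> atlas sphere2" using schart_atlas[OF s] by (simp add: schart_def)
  have "continuous_on (stereo s ` range (spsi s) \<times> UNIV)
      (\<lambda>(x, v). \<Phi> (tvec sphere2 (range (spsi s), stereo s) (inv_into (range (spsi s)) (stereo s) x) v))"
    using fm at unfolding finsler_metric_def by fast
  moreover have "continuous_on UNIV (\<lambda>p::complex \<times> complex. (toV (fst p), toV (snd p)))"
    by (intro continuous_intros)
  ultimately have "continuous_on UNIV (\<lambda>p::complex \<times> complex. case (toV (fst p), toV (snd p)) of (x, v) \<Rightarrow>
      \<Phi> (tvec sphere2 (range (spsi s), stereo s) (inv_into (range (spsi s)) (stereo s) x) v))"
    by (rule continuous_on_compose2) (auto simp: chart_param.\<phi>_image[OF ch])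
  then have "continuous_on UNIV (\<lambda>p. \<Phi> (tvec sphere2 (range (spsi s), stereo s) (inv_into (range (spsi s)) (stereo s) (toV (fst p))) (toV (snd p))))"
    by simp
  then show "continuous_on UNIV (\<lambda>(z, v). fin s z v)"
    by (simp add: fin_def split_beta schart_def chart_param.inv_into_\<phi>[OF ch])
  have "\<forall>p\<in>range (spsi s). asymmetric_norm (\<lambda>v. \<Phi> (tvec sphere2 (range (spsi s), stereo s) p v))"
    using fm at unfolding finsler_metric_def by fast
  then have n: "asymmetric_norm (\<lambda>v. \<Phi> (tvec sphere2 (schart s) (spsi s z) v))" for z
    by (simp add: schart_def)
  have t0: "toV v = 0 \<longleftrightarrow> v = 0" for v by (metis toC_toV toC_eq_0_iff)
  show "asymmetric_norm (fin s z)" for z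
    using n[of z] unfolding asymmetric_norm_def fin_def
      linear_add[OF linear_toV] linear_cmul[OF linear_toV] by (auto simp: t0)
  show "fin s z (- v) = fin s z v" for z v
    using rev schart_atlas[OF s] unfolding reversible_def fin_def linear_neg[OF linear_toV]
    by (auto simp: schart_def)
qed

lemma fin_change: "s = 1 \<or> s = - 1 \<Longrightarrow> z \<noteq> 0 \<Longrightarrow> fin (- s) (1 / cnj z) (inversion_diff z v) = fin s z v"
  unfolding fin_def by (subst tvec_sphere2_change) auto

lemma volume_sphere_open:
  assumes s: "s = 1 \<or> s = - 1" and G: "open G" and A: "A \<in> borel_sets (top_of_set (spsi s ` G))"
  shows "emeasure (\<A> (open_mfd (spsi s) (stereo s) G) (chart_metric (stereo s) (fin s))) A = emeasure (\<A> sphere2 \<Phi>) A"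
proof (rule volume_restrict[OF sphere2_reversible_finsler_manifold
      chart_param.open_mfd_reversible_finsler_manifold[OF chart_param_spsi[OF s] plane_finsler_fin[OF s] G]])
  have sub: "spsi s ` G \<subseteq> sphere 0 1" using norm_spsi[OF s] by auto
  show "subdomain (open_mfd (spsi s) (stereo s) G) sphere2"
    unfolding subdomain_def sphere2_eq schart_def
    using spsi_compatible[OF s, of 1 G UNIV] spsi_compatible[OF s, of "- 1" G UNIV] sub
    by (auto simp: open_mfd_def subtopology_subtopology inf_absorb2)
  have "tvec sphere2 (spsi s ` G, stereo s) (spsi s z) v = tvec sphere2 (schart s) (spsi s z) v" if "z \<in> G" for z v
    using tvec_sphere2[OF s G that] tvec_sphere2[OF s open_UNIV UNIV_I, of z v] by (simp add: schart_def)
  then show "restricts_to sphere2 \<Phi> (open_mfd (spsi s) (stereo s) G) (chart_metric (stereo s) (fin s))"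
    unfolding restricts_to_def using chart_param.chart_metric_tvec[OF chart_param_spsi[OF s] G _ G order_refl]
    by (auto simp: open_mfd_def fin_def)
qed (use A in \<open>simp add: open_mfd_def\<close>)

end

section \<open>The area of the sphere as a measure on the plane\<close>

context sphere_volume begin

abbreviation "\<mu> \<equiv> \<A> sphere2 \<Phi>"

lemma sets_\<mu>: "sets \<mu> = {X. X \<in> sets borel \<and> X \<subseteq> sphere 0 1}" and space_\<mu>: "space \<mu> = sphere 0 1"
  using volume_sets[OF sphere2_reversible_finsler_manifold]
  by (simp_all add: sphere2_eq borel_sets_top_of_set)

lemma spsi_borel:
  assumes s: "s = 1 \<or> s = - 1" and X: "X \<in> sets borel"
  shows "spsi s ` X \<in> sets borel"
proof -
  have "range (spsi s) \<in> sets borel" unfolding range_spsi[OF s] by auto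
  moreover have "(\<lambda>x. toC (stereo s x)) \<in> borel_measurable (restrict_space borel (range (spsi s)))"
    by (intro borel_measurable_continuous_on_restrict continuous_on_toC chart_param.\<phi>_continuous chart_param_spsi[OF s])
  ultimately have "(\<lambda>x. toC (stereo s x)) -` X \<inter> range (spsi s) \<in> sets borel"
    using measurable_sets[OF _ X, of "\<lambda>x. toC (stereo s x)" "restrict_space borel (range (spsi s))"]
    by (auto simp: space_restrict_space sets_restrict_space_iff)
  moreover have "(\<lambda>x. toC (stereo s x)) -` X \<inter> range (spsi s) = spsi s ` X"
    using stereo_spsi[OF s] by auto
  ultimately show ?thesis by simp
qed

lemma spsi_sets: "s = 1 \<or> s = - 1 \<Longrightarrow> X \<in> sets borel \<Longrightarrow> spsi s ` X \<in> sets \<mu>"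
  using spsi_borel norm_spsi by (auto simp: sets_\<mu>)

lemma volume_chart:
  assumes s: "s = 1 \<or> s = - 1" and X: "X \<in> sets borel" "open G" "X \<subseteq> G"
  shows "emeasure (\<A> (open_mfd (spsi s) (stereo s) G) (chart_metric (stereo s) (fin s))) (spsi s ` X) = emeasure \<mu> (spsi s ` X)"
proof (rule volume_sphere_open[OF s X(2)])
  show "spsi s ` X \<in> borel_sets (top_of_set (spsi s ` G))"
    using X spsi_borel[OF s] by (subst borel_sets_top_of_set) auto
qed

lemma chart_sets:
  assumes s: "s = 1 \<or> s = - 1" and X: "X \<in> sets borel"
  shows "spsi s ` X \<in> sets (\<A> (open_mfd (spsi s) (stereo s) UNIV) (chart_metric (stereo s) (fin s)))"
proof -
  have "spsi s ` X \<in> borel_sets (top_of_set (spsi s ` UNIV))"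
    using X spsi_borel[OF s] by (subst borel_sets_top_of_set) auto
  then show ?thesis
    using volume_sets[OF chart_param.open_mfd_reversible_finsler_manifold[OF chart_param_spsi[OF s] plane_finsler_fin[OF s] open_UNIV]]
    by (simp add: open_mfd_def)
qed

lemma segment_null:
  assumes s: "s = 1 \<or> s = - 1" shows "emeasure \<mu> (spsi s ` closed_segment p q) = 0"
proof -
  have "emeasure (\<A> (open_mfd (spsi s) (stereo s) UNIV) (chart_metric (stereo s) (fin s))) (spsi s ` closed_segment p q) = 0"
    by (rule volume_segment_zero[OF chart_param_spsi[OF s] plane_finsler_fin[OF s]])
      (rule chart_sets[OF s], simp add: borel_compact)+
  then show ?thesis using volume_chart[OF s _ open_UNIV, of "closed_segment p q"] by (simp add: borel_closed)
qed

text \<open>A point is a degenerate segment of the sup-norm plane. This permits the map in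
  Besicovitch's inequality to miss one value.\<close>

lemma plane_point_null: "emeasure (\<A> plane sup_metric) {ppsi p} = 0"
proof -
  have borel: "ppsi ` X \<in> sets borel" if "closed X" for X
  proof -
    have "closedin (top_of_set (range ppsi)) (range ppsi \<inter> (\<lambda>x. toC (pphi x)) -` X)"
      by (intro continuous_closedin_preimage that continuous_on_toC pl.\<phi>_continuous)
    moreover have "range ppsi \<inter> (\<lambda>x. toC (pphi x)) -` X = ppsi ` X" by (auto simp: pl.\<phi>_\<psi>)
    moreover have "closed (range ppsi)" unfolding range_ppsi by (intro closed_Collect_eq continuous_intros)
    ultimately have "closed (ppsi ` X)" using closedin_closed_trans by metis
    then show ?thesis by auto
  qed
  have bs: "ppsi ` X \<in> borel_sets (top_of_set (ppsi ` UNIV))" if "ppsi ` X \<in> sets borel" for X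
    using that borel[of UNIV] by (subst borel_sets_top_of_set) auto
  have op: "ppsi ` X \<in> sets borel" if "open X" for X
  proof -
    have "ppsi ` X = range ppsi - ppsi ` (- X)" by auto
    then show ?thesis using borel[of UNIV] borel[of "- X"] that by auto
  qed
  have st: "sets (\<A> (open_mfd ppsi pphi UNIV) (chart_metric pphi sup_norm)) = borel_sets (top_of_set (ppsi ` UNIV))"
    using volume_sets[OF pl.open_mfd_reversible_finsler_manifold[OF sn.plane_finsler_axioms open_UNIV]]
    by (simp add: open_mfd_def)
  have "emeasure (\<A> (open_mfd ppsi pphi UNIV) (chart_metric pphi sup_norm)) (ppsi ` closed_segment p p) = 0"
  proof (rule volume_segment_zero[OF pl.chart_param_axioms sn.plane_finsler_axioms], unfold st)
    show "ppsi ` X \<in> borel_sets (top_of_set (range ppsi))" if "compact X" for X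
      by (rule bs[OF borel[OF compact_imp_closed[OF that]]])
    show "ppsi ` X \<in> borel_sets (top_of_set (range ppsi))" if "open X" for X
      by (rule bs[OF op[OF that]])
  qed
  then show ?thesis using volume_plane_open[OF open_UNIV bs[of "{p}"]] borel[of "{p}"] by simp
qed

text \<open>The half side 2 makes the box contain the closed unit disc. The unit discs of the two
  charts cover the sphere, so two such bounds give finite total area.\<close>

lemma ball_finite:
  assumes s: "s = 1 \<or> s = - 1"
  shows "emeasure \<mu> (spsi s ` box (Complex (-2) (-2)) (Complex 2 2)) < \<infinity>"
proof -
  interpret plane_finsler "fin s" by (rule plane_finsler_fin[OF s])
  obtain m M where "0 < m" and M: "0 < M" "\<And>z v. z \<in> cball 0 8 \<Longrightarrow> m * cmod v \<le> fin s z v"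
    "\<And>z v. z \<in> cball 0 8 \<Longrightarrow> fin s z v \<le> M * cmod v"
    by (rule F_bounds[OF compact_cball[of 0 8]]) (rule that; assumption)
  have eq: "(\<lambda>x. Complex (-2) (-2) + 1 * x) ` box 0 (Complex 4 4) = box (Complex (-2) (-2)) (Complex 2 2)"
  proof
    show "box (Complex (-2) (-2)) (Complex 2 2) \<subseteq> (\<lambda>x. Complex (-2) (-2) + 1 * x) ` box 0 (Complex 4 4)"
    proof
      fix x assume "x \<in> box (Complex (-2) (-2)) (Complex 2 2)"
      then show "x \<in> (\<lambda>x. Complex (-2) (-2) + 1 * x) ` box 0 (Complex 4 4)"
        by (intro image_eqI[of _ _ "x - Complex (-2) (-2)"]) (auto simp: in_box_complex_iff)
    qed
  qed (auto simp: in_box_complex_iff)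
  have "emeasure (\<A> (open_mfd (spsi s) (stereo s) UNIV) (chart_metric (stereo s) (fin s)))
      (spsi s ` (\<lambda>x. Complex (-2) (-2) + 1 * x) ` box 0 (Complex 4 4)) \<le> ennreal (c * (2 * M * 4) * (2 * M * 4))"
  proof (rule volume_box_le[OF chart_param_spsi[OF s] plane_finsler_axioms _ _ _ M(1)])
    fix x v assume "x \<in> cbox 0 (Complex 4 4)"
    then have "cmod (Complex (-2) (-2) + 1 * x) \<le> 8"
      using cmod_le[of "Complex (-2) (-2) + 1 * x"] by (auto simp: in_cbox_complex_iff)
    then show "fin s (Complex (-2) (-2) + 1 * x) v \<le> M * cmod v" using M(3) by simp
  qed auto
  then show ?thesis unfolding eq
    using volume_chart[OF s _ open_UNIV, of "box (Complex (-2) (-2)) (Complex 2 2)"]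
    by (simp add: less_top[symmetric]) (metis ennreal_less_top infinity_ennreal_def linorder_not_less order_le_less_trans top.extremum_uniqueI)
qed

lemma finite_measure_\<mu>: "finite_measure \<mu>"
proof
  let ?B = "box (Complex (-2) (-2)) (Complex 2 2)"
  have inB: "z \<in> ?B" if "cmod z \<le> 1" for z
    using that abs_Re_le_cmod[of z] abs_Im_le_cmod[of z] by (auto simp: in_box_complex_iff)
  have "x \<in> spsi 1 ` ?B \<union> spsi (- 1) ` ?B" if x: "x \<in> sphere 0 1" for x
  proof -
    have "\<exists>z. x = spsi 1 z \<or> x = spsi (- 1) z" using x sphere_cover by blast
    moreover have "spsi s z \<in> spsi s ` ?B \<union> spsi (- s) ` ?B" for s z
    proof (cases "cmod z \<le> 1")
      case False
      then have "z \<noteq> 0" "cmod (1 / cnj z) \<le> 1" by (auto simp: norm_divide divide_le_eq_1)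
      then show ?thesis using spsi_inversion[of z s] inB[of "1 / cnj z"] by (metis UnI2 image_eqI)
    qed (use inB in blast)
    from this[of 1] this[of "- 1"] calculation show ?thesis by auto
  qed
  then have sub: "sphere 0 1 \<subseteq> spsi 1 ` ?B \<union> spsi (- 1) ` ?B" by blast
  have st: "spsi 1 ` ?B \<in> sets \<mu>" "spsi (- 1) ` ?B \<in> sets \<mu>" by (auto intro!: spsi_sets)
  have "emeasure \<mu> (space \<mu>) \<le> emeasure \<mu> (spsi 1 ` ?B \<union> spsi (- 1) ` ?B)"
    unfolding space_\<mu> by (intro emeasure_mono[OF sub] sets.Un st)
  also have "\<dots> \<le> emeasure \<mu> (spsi 1 ` ?B) + emeasure \<mu> (spsi (- 1) ` ?B)"
    by (intro emeasure_subadditive st)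
  also have "\<dots> < \<infinity>" using ball_finite[of 1] ball_finite[of "- 1"] by (simp add: less_top)
  finally show "emeasure \<mu> (space \<mu>) \<noteq> \<infinity>" by simp
qed

text \<open>\<^term>\<open>stereo 1\<close> sends the pole to \<open>0\<close> (division by zero), which is harmless as the pole is a null set.\<close>

definition \<nu> :: "complex measure" where "\<nu> = distr \<mu> borel (\<lambda>x. toC (stereo 1 x))"

lemma pole_null: "{axis 3 1} \<in> null_sets \<mu>"
proof -
  have "spsi (- 1) ` closed_segment 0 0 = {axis 3 1 :: real^3}" by (simp add: vec_eq_iff forall_3 axis_def)
  then show ?thesis using segment_null[of "- 1" 0 0] spsi_sets[of "- 1" "closed_segment 0 0"] by (simp add: null_sets_def)
qed

lemma measurable_stereo: "(\<lambda>x. toC (stereo 1 x)) \<in> measurable \<mu> borel"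
proof -
  have nth: "(\<lambda>x::real^3. x $ i) \<in> borel_measurable borel" for i
    by (intro borel_measurable_continuous_onI continuous_intros)
  have "(\<lambda>x::real^3. complex_of_real (x $ 1 / (1 - 1 * x $ 3)) + \<i> * complex_of_real (x $ 2 / (1 - 1 * x $ 3))) \<in> borel_measurable borel"
  proof -
    have "(\<lambda>x::real^3. x $ i / (1 - 1 * x $ 3)) \<in> borel_measurable borel" for i
      by (intro borel_measurable_divide borel_measurable_diff borel_measurable_times borel_measurable_const nth)
    moreover have "complex_of_real \<in> borel_measurable borel"
      by (intro borel_measurable_continuous_onI continuous_intros)
    ultimately have "(\<lambda>x::real^3. complex_of_real (x $ i / (1 - 1 * x $ 3))) \<in> borel_measurable borel" for i
      by (rule measurable_compose)
    then show ?thesis by (intro borel_measurable_add borel_measurable_times borel_measurable_const)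
  qed
  moreover have "(\<lambda>x. toC (stereo 1 x)) = (\<lambda>x::real^3. complex_of_real (x $ 1 / (1 - 1 * x $ 3)) + \<i> * complex_of_real (x $ 2 / (1 - 1 * x $ 3)))"
    by (auto simp: stereo_def complex_eq_iff)
  ultimately have "(\<lambda>x. toC (stereo 1 x)) \<in> borel_measurable (restrict_space borel (sphere 0 1))"
    by (intro measurable_restrict_space1) simp
  moreover have "sets \<mu> = sets (restrict_space borel (sphere 0 1))"
    by (auto simp: sets_\<mu> sets_restrict_space image_iff)
  ultimately show ?thesis using measurable_cong_sets by blast
qed

lemma emeasure_\<nu>:
  assumes "X \<in> sets borel" shows "emeasure \<nu> X = emeasure \<mu> (spsi 1 ` X)"
proof -
  have e: "emeasure \<nu> X = emeasure \<mu> ((\<lambda>x. toC (stereo 1 x)) -` X \<inter> sphere 0 1)"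
    unfolding \<nu>_def using emeasure_distr[OF measurable_stereo, of X] assms by (simp add: space_\<mu>)
  let ?Y = "(\<lambda>x. toC (stereo 1 x)) -` X \<inter> sphere 0 1"
  have Y: "?Y \<in> sets \<mu>" using measurable_sets[OF measurable_stereo assms] by (simp add: space_\<mu>)
  have s: "sphere 0 1 = insert (axis 3 1) (range (spsi 1))"
    using range_spsi[of 1] by (auto simp: norm_axis_1)
  have "?Y \<union> {axis 3 1} = spsi 1 ` X \<union> {axis 3 1}"
    using stereo_spsi[of 1] unfolding s by auto
  then have "emeasure \<mu> (?Y \<union> {axis 3 1}) = emeasure \<mu> (spsi 1 ` X \<union> {axis 3 1})" by simp
  then show ?thesis
    unfolding e using emeasure_Un_null_set[OF Y pole_null] emeasure_Un_null_set[OF spsi_sets[OF _ assms] pole_null] by simp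
qed

lemma measure_\<nu>: "X \<in> sets borel \<Longrightarrow> measure \<nu> X = measure \<mu> (spsi 1 ` X)"
  by (simp add: measure_def emeasure_\<nu>)

lemma measure_\<nu>_UNIV: "measure \<nu> UNIV = measure \<mu> (sphere 0 1)"
proof -
  have "measure \<nu> UNIV = measure \<mu> (range (spsi 1) \<union> {axis 3 1})"
    using measure_\<nu>[of UNIV] measure_Un_null_set[OF spsi_sets[of 1 UNIV] pole_null] by simp
  moreover have "range (spsi 1) \<union> {axis 3 1} = sphere 0 1"
    using range_spsi[of 1] by (auto simp: norm_axis_1)
  ultimately show ?thesis by simp
qed

text \<open>Translated by \<open>a\<close>, the map \<open>(h1, h2)\<close> is short into the
  sup-norm plane and covers the rectangle of sides \<open>e\<close> up to one null point.
  Monotonicity and the normalization of the area of rectangles give the inequality.\<close>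

lemma besicovitch_\<nu>:
  assumes D: "open D" and h: "plane_finsler.seg_lipschitz (fin 1) D h1" "plane_finsler.seg_lipschitz (fin 1) D h2" and e: "0 < e"
    and cover: "\<And>z. Re z \<in> {a..a + e} \<Longrightarrow> Im z \<in> {a..a + e} \<Longrightarrow> z \<noteq> w \<Longrightarrow> z \<in> (\<lambda>x. Complex (h1 x) (h2 x)) ` D"
  shows "c * e\<^sup>2 \<le> measure \<nu> D"
proof -
  have s: "(1::real) = 1 \<or> (1::real) = - 1" by simp
  interpret plane_finsler "fin 1" by (rule plane_finsler_fin[OF s])
  define k where "k x = Complex (h1 x - a) (h2 x - a)" for x
  let ?f = "\<lambda>x. ppsi (k (toC (stereo 1 x)))"
  let ?M = "open_mfd (spsi 1) (stereo 1) D" and ?\<Phi> = "chart_metric (stereo 1) (fin 1)"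
  let ?N = "open_mfd ppsi pphi UNIV" and ?\<Psi> = "chart_metric pphi sup_norm"
  have short: "short_map ?M ?\<Phi> ?N ?\<Psi> ?f"
  proof (rule short_map_to_chart[OF chart_param_spsi[OF s] pl.chart_param_axioms plane_finsler_axioms sn.plane_finsler_axioms D])
    fix x y
    have "seg sup_norm (k x) (k y) \<le> \<bar>h1 y - h1 x\<bar> \<or> seg sup_norm (k x) (k y) \<le> \<bar>h2 y - h2 x\<bar>"
      unfolding seg_sup_norm by (auto simp: k_def)
    then show "\<exists>h. seg_lipschitz D h \<and> seg sup_norm (k x) (k y) \<le> \<bar>h y - h x\<bar>" using h by blast
  qed
  have pM: "points ?M = spsi 1 ` D" by (simp add: open_mfd_def)
  have img: "?f ` points ?M = ppsi ` k ` D" unfolding pM by (simp add: image_image stereo_spsi)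
  have contk: "continuous_on D k"
    unfolding k_def[abs_def] using seg_lipschitz_continuous[OF h(1) D] seg_lipschitz_continuous[OF h(2) D]
    by (intro continuous_intros)
  \<comment> \<open>An open set is a countable union of compact sets, so its continuous image is one
    too and in particular Borel.\<close>
  have borel: "ppsi ` k ` D \<in> sets borel"
  proof -
    obtain C :: "nat \<Rightarrow> complex set" where C: "\<And>n. compact (C n)" "\<And>n. C n \<subseteq> D" "(\<Union>n. C n) = D"
      by (rule open_Union_compact_subsets[OF D]) (rule that; assumption)
    have eq: "ppsi ` k ` D = (\<Union>n::nat. ppsi ` k ` C n)" using C(3) by blast
    have "compact (ppsi ` k ` C n)" for n
      using C continuous_on_subset[OF contk] continuous_on_subset[OF pl.\<psi>_continuous]
      by (intro compact_continuous_image) auto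
    then have "ppsi ` k ` C n \<in> sets borel" for n by (simp add: borel_compact)
    then show ?thesis unfolding eq by (intro sets.countable_nat_UN) blast
  qed
  have cl: "closed (range ppsi)" unfolding range_ppsi by (intro closed_Collect_eq continuous_intros)
  have bs: "ppsi ` k ` D \<in> borel_sets (top_of_set (ppsi ` UNIV))"
    using borel cl by (subst borel_sets_top_of_set) auto
  define w' where "w' = ppsi (w - Complex a a)"
  have np: "{w'} \<in> null_sets (\<A> plane sup_metric)"
    using plane_point_null[of "w - Complex a a"] volume_sets[OF plane_reversible_finsler_manifold]
    by (auto simp: null_sets_def w'_def borel_sets_plane)
  have Pset: "ppsi ` k ` D \<in> sets (\<A> plane sup_metric)"
    using volume_sets[OF plane_reversible_finsler_manifold] borel by (auto simp: borel_sets_plane)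
  have sub: "rectangle e e \<subseteq> ppsi ` k ` D \<union> {w'}"
  proof
    fix x assume x: "x \<in> rectangle e e"
    define z where "z = Complex (x $ 1 + a) (x $ 2 + a)"
    have xz: "x = ppsi (z - Complex a a)" using x by (simp add: rectangle_def z_def vec_eq_iff forall_3)
    show "x \<in> ppsi ` k ` D \<union> {w'}"
    proof (cases "z = w")
      case False
      then have "z \<in> (\<lambda>x. Complex (h1 x) (h2 x)) ` D"
        using x by (intro cover) (auto simp: z_def rectangle_def)
      then obtain y where "y \<in> D" "z = Complex (h1 y) (h2 y)" by blast
      then have "y \<in> D" "x = ppsi (k y)" unfolding xz k_def by (auto simp: complex_eq_iff)
      then show ?thesis by blast
    qed (simp add: xz w'_def)
  qed
  have "emeasure (\<A> plane sup_metric) (rectangle e e) \<le> emeasure (\<A> plane sup_metric) (ppsi ` k ` D \<union> {w'})"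
    by (intro emeasure_mono[OF sub] sets.Un Pset null_setsD2[OF np])
  also have "\<dots> = emeasure (\<A> plane sup_metric) (ppsi ` k ` D)" by (rule emeasure_Un_null_set[OF Pset np])
  also have "\<dots> = emeasure (\<A> ?N ?\<Psi>) (ppsi ` k ` D)" by (rule volume_plane_open[OF open_UNIV bs, symmetric])
  also have "\<dots> \<le> emeasure (\<A> ?M ?\<Phi>) (points ?M)"
    using volume_mono[OF chart_param.open_mfd_reversible_finsler_manifold[OF chart_param_spsi[OF s] plane_finsler_axioms D]
      pl.open_mfd_reversible_finsler_manifold[OF sn.plane_finsler_axioms open_UNIV] short] unfolding img .
  also have "\<dots> = emeasure \<nu> D"
    unfolding pM using volume_chart[OF s _ D order_refl] D emeasure_\<nu>[of D] by simp
  finally have "ennreal (c * e * e) \<le> emeasure \<nu> D" using emeasure_rectangle[OF e e] by simp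
  moreover have "emeasure \<nu> D = ennreal (measure \<nu> D)"
  proof -
    interpret f: finite_measure \<mu> by (rule finite_measure_\<mu>)
    show ?thesis using D by (simp add: emeasure_\<nu> measure_\<nu> f.emeasure_eq_measure)
  qed
  ultimately show ?thesis by (simp add: ennreal_le_iff power2_eq_square mult.assoc)
qed

text \<open>In the opposite chart, \<open>h\<close> is Lipschitz on a punctured disc, hence extends over the puncture.\<close>

lemma limit_at_infinity_fin:
  assumes D: "open D" and h: "plane_finsler.seg_lipschitz (fin 1) D h" and R: "\<And>z. R < cmod z \<Longrightarrow> z \<in> D"
  shows "\<exists>l. (h \<longlongrightarrow> l) at_infinity"
proof -
  interpret p: plane_finsler "fin 1" by (rule plane_finsler_fin) simp
  interpret q: plane_finsler "fin (- 1)" by (rule plane_finsler_fin) simp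
  \<comment> \<open>At least 1, so that the punctured disc in the opposite chart lies in the unit
    disc, where the bound \<open>K\<close> holds.\<close>
  define R1 where "R1 = max R 1"
  have R1: "1 \<le> R1" "R \<le> R1" by (auto simp: R1_def)
  define r where "r = 1 / R1"
  have r: "0 < r" "r \<le> 1" using R1 by (auto simp: r_def)
  define H where "H \<eta> = h (1 / cnj \<eta>)" for \<eta>
  have inD: "1 / cnj \<eta> \<in> D" if "\<eta> \<noteq> 0" "cmod \<eta> < r" for \<eta>
  proof -
    have "R1 < 1 / cmod \<eta>" using that R1(1) by (simp add: r_def field_simps)
    then show ?thesis using R1(2) by (intro R) (simp add: norm_divide)
  qed
  obtain m K where "0 < m" and K: "0 < K" "\<And>z v. z \<in> cball 0 1 \<Longrightarrow> m * cmod v \<le> fin (- 1) z v"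
    "\<And>z v. z \<in> cball 0 1 \<Longrightarrow> fin (- 1) z v \<le> K * cmod v"
    by (rule q.F_bounds[OF compact_cball[of 0 1]]) (rule that; assumption)
  \<comment> \<open>A segment that misses the puncture is moved to the first chart by the inversion.
    The length of its image is measured in the opposite chart, whose metric is bounded near 0,
    unlike the inversion.\<close>
  have lip: "\<bar>H y - H x\<bar> \<le> K * cmod (y - x)" if xy: "x \<in> ball 0 r" "y \<in> ball 0 r" "0 \<notin> closed_segment x y" for x y
  proof -
    define z where "z = linepath x y"
    have z: "z t \<noteq> 0" "cmod (z t) < r" if "t \<in> {0..1}" for t
    proof -
      have "z t \<in> closed_segment x y" using linepath_in_path[OF that] by (simp add: z_def)
      moreover have "closed_segment x y \<subseteq> ball 0 r" using xy by (intro closed_segment_subset) auto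
      ultimately show "z t \<noteq> 0" "cmod (z t) < r" using xy(3) by auto
    qed
    define g where "g t = 1 / cnj (z t)" for t
    define g' where "g' t = inversion_diff (z t) (y - x)" for t
    have cz: "continuous_on {0..1} z" unfolding z_def by (rule continuous_on_linepath)
    have "\<bar>h (g 1) - h (g 0)\<bar> \<le> integral {0..1} (\<lambda>t. fin 1 (g t) (g' t))"
    proof (rule p.seg_lipschitz_curve[OF h D])
      fix t :: real assume t: "t \<in> {0..1}"
      have dz: "(z has_derivative (\<lambda>u. u *\<^sub>R (y - x))) (at t within {0..1})"
        unfolding z_def using has_vector_derivative_linepath_within[of x y t] by (simp add: has_vector_derivative_def)
      from has_derivative_compose[OF dz inversion_has_derivative[OF z(1)[OF t]]]
      have "((\<lambda>t. 1 / cnj (z t)) has_derivative (\<lambda>u. inversion_diff (z t) (u *\<^sub>R (y - x)))) (at t within {0..1})" .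
      moreover have "inversion_diff (z t) (u *\<^sub>R (y - x)) = u *\<^sub>R g' t" for u
        by (simp add: inversion_diff_def g'_def scaleR_conv_of_real del: complex_cnj_diff)
      ultimately show "(g has_vector_derivative g' t) (at t within {0..1})"
        by (simp add: has_vector_derivative_def g_def[abs_def])
    next
      show "continuous_on {0..1} g'"
        unfolding g'_def[abs_def] inversion_diff_def using z cz by (intro continuous_intros) auto
      show "g ` {0..1} \<subseteq> D" using z inD by (auto simp: g_def)
    qed simp
    also have "\<dots> \<le> integral {0..1} (\<lambda>t::real. K * cmod (y - x))"
    proof (rule integral_le)
      have "continuous_on {0..1} g" "continuous_on {0..1} g'"
        unfolding g_def[abs_def] g'_def[abs_def] inversion_diff_def using z cz by (auto intro!: continuous_intros)
      then show "(\<lambda>t. fin 1 (g t) (g' t)) integrable_on {0..1}"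
        by (intro integrable_continuous_real p.continuous_on_F)
      fix t :: real assume t: "t \<in> {0..1}"
      have "fin 1 (g t) (g' t) = fin (- 1) (z t) (y - x)"
        using fin_change[of "- 1" "z t" "y - x"] z[OF t] by (simp add: g_def g'_def)
      then show "fin 1 (g t) (g' t) \<le> K * cmod (y - x)" using K(3)[of "z t"] z[OF t] r by simp
    qed (rule integrable_const_ivl)
    finally show ?thesis by (simp add: H_def g_def z_def linepath_0' linepath_1')
  qed
  have lip2: "\<bar>H y - H x\<bar> \<le> 4 * K * cmod (y - x)" if xy: "x \<in> ball 0 r - {0}" "y \<in> ball 0 r - {0}" for x y
  proof (cases "0 \<in> closed_segment x y")
    case False
    then have "\<bar>H y - H x\<bar> \<le> K * cmod (y - x)" using lip xy by blast
    moreover have "0 \<le> K * cmod (y - x)" using K(1) by simp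
    ultimately show ?thesis by simp
  next
    case True
    then obtain t where t: "0 \<le> t" "t \<le> 1" "0 = (1 - t) *\<^sub>R x + t *\<^sub>R y" by (auto simp: closed_segment_def)
    have t0: "t \<noteq> 0" "t \<noteq> 1" using t xy by auto
    define b where "b = (1 - t) / t"
    have b: "0 < b" using t t0 by (simp add: b_def)
    have y: "y = - b *\<^sub>R x"
    proof -
      have "t *\<^sub>R y = - ((1 - t) *\<^sub>R x)" using t(3) by (metis add.commute eq_neg_iff_add_eq_0)
      then have "y = (1 / t) *\<^sub>R (- ((1 - t) *\<^sub>R x))" using t0 by (metis nonzero_divide_eq_eq one_neq_zero scaleR_one scaleR_scaleR)
      then show ?thesis by (simp add: b_def)
    qed
    \<comment> \<open>If the puncture lies between \<open>x\<close> and \<open>y\<close>, a detour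
      through \<open>x\<close> turned by a right angle avoids it. Both legs are at most twice as
      long as the segment, hence the constant \<open>4 * K\<close>.\<close>
    define w where "w = \<i> * x"
    have dist: "cmod (y - x) = (1 + b) * cmod x"
    proof -
      have "y - x = - ((1 + b) *\<^sub>R x)" by (simp add: y algebra_simps)
      then show ?thesis using b by (simp only: norm_minus_cancel norm_scaleR)
    qed
    have "0 \<notin> closed_segment x w"
    proof
      assume "0 \<in> closed_segment x w"
      then obtain u where u: "0 = (1 - u) *\<^sub>R x + u *\<^sub>R w" by (auto simp: closed_segment_def)
      have "(1 - u) *\<^sub>R x + u *\<^sub>R w = (of_real (1 - u) + \<i> * of_real u) * x"
        by (simp add: w_def scaleR_conv_of_real algebra_simps)
      then have "complex_of_real (1 - u) + \<i> * of_real u = 0" using u xy by simp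
      then show False by (auto simp: complex_eq_iff)
    qed
    moreover have "0 \<notin> closed_segment w y"
    proof
      assume "0 \<in> closed_segment w y"
      then obtain u where u: "0 = (1 - u) *\<^sub>R w + u *\<^sub>R y" by (auto simp: closed_segment_def)
      have "(1 - u) *\<^sub>R w + u *\<^sub>R y = (of_real (- u * b) + \<i> * of_real (1 - u)) * x"
        by (simp add: w_def y scaleR_conv_of_real algebra_simps)
      then have "complex_of_real (- u * b) + \<i> * of_real (1 - u) = 0" using u xy by simp
      then show False using b by (auto simp: complex_eq_iff)
    qed
    moreover have "cmod w = cmod x" by (simp add: w_def norm_mult)
    ultimately have "\<bar>H w - H x\<bar> \<le> K * cmod (w - x)" "\<bar>H y - H w\<bar> \<le> K * cmod (y - w)"
      using lip[of x w] lip[of w y] xy by auto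
    moreover have "cmod (w - x) \<le> 2 * cmod (y - x)" "cmod (y - w) \<le> 2 * cmod (y - x)"
    proof -
      have le: "cmod x \<le> cmod (y - x)" "cmod y \<le> cmod (y - x)" using dist b by (auto simp: y algebra_simps)
      then show "cmod (w - x) \<le> 2 * cmod (y - x)" "cmod (y - w) \<le> 2 * cmod (y - x)"
        using norm_triangle_ineq4[of w x] norm_triangle_ineq4[of y w] \<open>cmod w = cmod x\<close> by auto
    qed
    then have "K * cmod (w - x) \<le> K * (2 * cmod (y - x))" "K * cmod (y - w) \<le> K * (2 * cmod (y - x))"
      using K(1) by (auto intro: mult_left_mono)
    ultimately show ?thesis by linarith
  qed
  have "uniformly_continuous_on (ball 0 r - {0}) H"
    unfolding uniformly_continuous_on_def
  proof (intro allI impI)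
    fix e :: real assume e: "0 < e"
    show "\<exists>d>0. \<forall>x\<in>ball 0 r - {0}. \<forall>x'\<in>ball 0 r - {0}. dist x' x < d \<longrightarrow> dist (H x') (H x) < e"
    proof (intro exI[of _ "e / (4 * K)"] conjI ballI impI)
      show "0 < e / (4 * K)" using e K(1) by simp
      fix x x' :: complex assume x: "x \<in> ball 0 r - {0}" "x' \<in> ball 0 r - {0}" "dist x' x < e / (4 * K)"
      have "4 * K * cmod (x' - x) < e" using x(3) K(1) by (simp add: dist_norm field_simps)
      then show "dist (H x') (H x) < e" using lip2[OF x(1,2)] by (simp add: dist_real_def)
    qed
  qed
  moreover have "0 \<in> closure (ball 0 r - {0::complex})"
    unfolding closure_approachable
  proof (intro allI impI)
    fix e :: real assume "0 < e"
    then show "\<exists>y\<in>ball 0 r - {0::complex}. dist y 0 < e"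
      using r by (intro bexI[of _ "of_real (min e r / 2)"]) auto
  qed
  ultimately obtain l where l: "(H \<longlongrightarrow> l) (at 0 within ball 0 r - {0})"
    using uniformly_continuous_on_extension_at_closure by blast
  have "(h \<longlongrightarrow> l) at_infinity"
    unfolding Lim_at_infinity
  proof (intro allI impI)
    fix e :: real assume "0 < e"
    then obtain d where d: "0 < d" "\<And>\<eta>. \<eta> \<in> ball 0 r - {0} \<Longrightarrow> cmod \<eta> < d \<Longrightarrow> dist (H \<eta>) l < e"
      using l unfolding Lim_within by (auto simp: dist_norm)
    define m where "m = min r d"
    have m: "0 < m" "m \<le> r" "m \<le> d" using r d by (auto simp: m_def)
    \<comment> \<open>\<open>2 / m\<close> instead of \<open>1 / m\<close> turns the weak inequality
      for \<open>z\<close> into a strict one for \<open>1 / cnj z\<close>.\<close>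
    have "dist (h z) l < e" if z: "2 / m \<le> cmod z" for z
    proof -
      have "0 < 2 / m" using m(1) by simp
      then have z0: "0 < cmod z" using z by linarith
      have "2 \<le> cmod z * m" using z m(1) by (simp add: divide_le_eq)
      then have "1 / cmod z < m" using z0 by (simp add: divide_less_eq mult.commute)
      then have "cmod (1 / cnj z) < m" by (simp add: norm_divide)
      then show ?thesis using d(2)[of "1 / cnj z"] m z0 by (auto simp: H_def)
    qed
    then show "\<exists>b. \<forall>x. b \<le> cmod x \<longrightarrow> dist (h x) l < e" by blast
  qed
  then show ?thesis by blast
qed

lemma finsler_area_\<nu>: "finsler_area (fin 1) \<nu> c"
proof -
  have "emeasure \<nu> (closed_segment p q) = 0" for p q
    using emeasure_\<nu>[of "closed_segment p q"] segment_null[of 1] by (simp add: borel_closed)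
  moreover have "finite_measure \<nu>"
    unfolding \<nu>_def by (rule finite_measure.finite_measure_distr[OF finite_measure_\<mu> measurable_stereo])
  moreover have "sets \<nu> = sets borel" by (simp add: \<nu>_def)
  ultimately have "finsler_area_axioms (fin 1) \<nu> c"
    by (intro finsler_area_axioms.intro besicovitch_\<nu> limit_at_infinity_fin)
  moreover have "plane_finsler (fin 1)" by (rule plane_finsler_fin) simp
  ultimately show ?thesis by (intro finsler_area.intro)
qed

end

section \<open>The dividing curve\<close>

text \<open>The parametrization by length is given up for one that is affine on each edge, for which
  differentiability is immediate. Only the vertices, the trace and the total length are
  kept.\<close>

lemma (in plane_finsler) uarc_vertices:
  "uarc g a b \<Longrightarrow> \<exists>V n. 0 < n \<and> V 0 = g a \<and> V n = g b \<and> (\<Union>i<n. closed_segment (V i) (V (Suc i))) = g ` {a..b} \<and>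
    (\<Sum>i<n. seg F (V i) (V (Suc i))) = b - a"
proof (induction rule: uarc.induct)
  case (uarc_segI a b g)
  show ?case
    using uarc_segI(3)[of a b] uarc_segI(1)
    by (intro exI[of _ "\<lambda>i. if i = 0 then g a else g b"] exI[of _ "Suc 0"]) (simp add: lessThan_Suc)
next
  case (uarc_trans g a b c)
  obtain V n where V: "0 < n" "V 0 = g a" "V n = g b" "(\<Union>i<n. closed_segment (V i) (V (Suc i))) = g ` {a..b}"
    "(\<Sum>i<n. seg F (V i) (V (Suc i))) = b - a" using uarc_trans(3) by metis
  obtain W m where W: "0 < m" "W 0 = g b" "W m = g c" "(\<Union>i<m. closed_segment (W i) (W (Suc i))) = g ` {b..c}"
    "(\<Sum>i<m. seg F (W i) (W (Suc i))) = c - b" using uarc_trans(4) by metis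
  define U where "U i = (if i \<le> n then V i else W (i - n))" for i
  have U1: "U i = V i" if "i \<le> n" for i using that by (simp add: U_def)
  have U2: "U (n + i) = W i" for i using V(3) W(2) by (cases "i = 0") (simp_all add: U_def)
  have U3: "U (Suc (n + i)) = W (Suc i)" for i using U2[of "Suc i"] by simp
  have split: "{..<n + m} = {..<n} \<union> (+) n ` {..<m}"
  proof -
    have "(+) n ` {..<m} = {n..<n + m}" by (simp add: lessThan_atLeast0 image_add_atLeastLessThan add.commute)
    then show ?thesis by auto
  qed
  have "(\<Union>i<n + m. closed_segment (U i) (U (Suc i))) = g ` {a..b} \<union> g ` {b..c}"
    unfolding split UN_Un using V(4) W(4) by (simp add: U1 U2 U3)
  moreover have "{a..c} = {a..b} \<union> {b..c}" using uarc_le[OF uarc_trans(1)] uarc_le[OF uarc_trans(2)] by auto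
  moreover have "(\<Sum>i<n + m. seg F (U i) (U (Suc i))) = (b - a) + (c - b)"
  proof -
    have "(\<Sum>i<n + m. seg F (U i) (U (Suc i))) = (\<Sum>i<n. seg F (U i) (U (Suc i))) + (\<Sum>i\<in>(+) n ` {..<m}. seg F (U i) (U (Suc i)))"
      unfolding split by (rule sum.union_disjoint) auto
    also have "(\<Sum>i\<in>(+) n ` {..<m}. seg F (U i) (U (Suc i))) = (\<Sum>i<m. seg F (W i) (W (Suc i)))"
      by (subst sum.reindex) (simp_all add: U2 U3)
    finally show ?thesis using V(5) W(5) by (simp add: U1)
  qed
  ultimately show ?case using V(1,2) W(3) U1[of 0] U2[of m]
    by (intro exI[of _ U] exI[of _ "n + m"]) (simp add: image_Un)
qed

text \<open>Edge \<open>i\<close> is traversed while \<open>real n * t\<close> runs from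
  \<open>i\<close> to \<open>i + 1\<close>; by truncation earlier edges contribute fully and later
  ones nothing. As a single formula it is continuous without gluing.\<close>

definition polyline :: "(nat \<Rightarrow> complex) \<Rightarrow> nat \<Rightarrow> real \<Rightarrow> complex" where
  "polyline V n t = V 0 + (\<Sum>i<n. max 0 (min 1 (real n * t - real i)) *\<^sub>R (V (Suc i) - V i))"

lemma polyline_piece:
  assumes i: "i < n" and t: "real i \<le> real n * t" "real n * t \<le> real (Suc i)"
  shows "polyline V n t = linepath (V i) (V (Suc i)) (real n * t - real i)"
proof -
  let ?k = "\<lambda>j. max 0 (min 1 (real n * t - real j))"
  have "(\<Sum>j<n. ?k j *\<^sub>R (V (Suc j) - V j)) = (\<Sum>j<Suc i. ?k j *\<^sub>R (V (Suc j) - V j))"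
  proof (rule sum.mono_neutral_right)
    show "\<forall>j\<in>{..<n} - {..<Suc i}. ?k j *\<^sub>R (V (Suc j) - V j) = 0"
    proof
      fix j assume "j \<in> {..<n} - {..<Suc i}"
      then have "real (Suc i) \<le> real j" by simp
      then have "?k j = 0" using t(2) by simp
      then show "?k j *\<^sub>R (V (Suc j) - V j) = 0" by simp
    qed
  qed (use i in auto)
  also have "\<dots> = (\<Sum>j<i. ?k j *\<^sub>R (V (Suc j) - V j)) + ?k i *\<^sub>R (V (Suc i) - V i)" by simp
  also have "(\<Sum>j<i. ?k j *\<^sub>R (V (Suc j) - V j)) = (\<Sum>j<i. V (Suc j) - V j)"
  proof (rule sum.cong)
    fix j assume "j \<in> {..<i}"
    then have "real (Suc j) \<le> real i" by simp
    then have "?k j = 1" using t(1) by simp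
    then show "?k j *\<^sub>R (V (Suc j) - V j) = V (Suc j) - V j" by simp
  qed simp
  also have "\<dots> = V i - V 0" by (rule sum_lessThan_telescope)
  also have "?k i = real n * t - real i" using t by simp
  finally show ?thesis by (simp add: polyline_def linepath_def algebra_simps)
qed

lemma unit_interval_pieces:
  assumes n: "0 < (n::nat)" and t: "t \<in> {0..1::real}"
  obtains i where "i < n" "real i \<le> real n * t" "real n * t \<le> real (Suc i)"
proof (cases "t = 1")
  case True
  \<comment> \<open>The floor would give \<open>i = n\<close>; the right end belongs to the last
    piece.\<close>
  then show ?thesis using that[of "n - 1"] n by simp
next
  case False
  define i where "i = nat \<lfloor>real n * t\<rfloor>"
  have nt: "0 \<le> real n * t" "real n * t < real n" using n t False by auto
  have i: "real i = of_int \<lfloor>real n * t\<rfloor>" using nt(1) by (simp add: i_def)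
  have "real i \<le> real n * t" "real n * t < real i + 1" unfolding i by linarith+
  moreover from this have "i < n" using nt by simp
  ultimately show ?thesis using that[of i] by simp
qed

lemma polyline_image:
  assumes n: "0 < n" shows "polyline V n ` {0..1} = (\<Union>i<n. closed_segment (V i) (V (Suc i)))"
proof
  show "polyline V n ` {0..1} \<subseteq> (\<Union>i<n. closed_segment (V i) (V (Suc i)))"
  proof
    fix x assume "x \<in> polyline V n ` {0..1}"
    then obtain t where t: "t \<in> {0..1}" "x = polyline V n t" by blast
    obtain i where i: "i < n" "real i \<le> real n * t" "real n * t \<le> real (Suc i)"
      using unit_interval_pieces[OF n t(1)] .
    have "linepath (V i) (V (Suc i)) (real n * t - real i) \<in> closed_segment (V i) (V (Suc i))"
      by (rule linepath_in_path) (use i in auto)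
    then show "x \<in> (\<Union>i<n. closed_segment (V i) (V (Suc i)))" using i(1) t(2) polyline_piece[OF i] by auto
  qed
  show "(\<Union>i<n. closed_segment (V i) (V (Suc i))) \<subseteq> polyline V n ` {0..1}"
  proof
    fix x assume "x \<in> (\<Union>i<n. closed_segment (V i) (V (Suc i)))"
    then obtain i where i: "i < n" "x \<in> closed_segment (V i) (V (Suc i))" by blast
    then obtain u where u: "u \<in> {0..1}" "x = linepath (V i) (V (Suc i)) u"
      by (metis imageE path_image_def path_image_linepath)
    define t where "t = (real i + u) / real n"
    have nt: "real n * t = real i + u" using n by (simp add: t_def)
    have "x = polyline V n t" using polyline_piece[OF i(1), of t V] u nt by simp
    moreover have "real i + u \<le> real n" using i(1) u(1) by auto
    then have "t \<in> {0..1}" using u(1) n by (simp add: t_def)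
    ultimately show "x \<in> polyline V n ` {0..1}" by blast
  qed
qed

lemma polyline_ends:
  assumes "0 < n" shows "polyline V n 0 = V 0" "polyline V n 1 = V n"
proof -
  show "polyline V n 0 = V 0" using polyline_piece[of 0 n 0 V] assms by (simp add: linepath_0')
  have "real (n - 1) \<le> real n * 1" "real n * 1 \<le> real (Suc (n - 1))" "n - 1 < n" using assms by auto
  from polyline_piece[OF this(3,1,2), of V] assms show "polyline V n 1 = V n"
    by (simp add: linepath_1' of_nat_diff)
qed

lemma continuous_on_polyline: "continuous_on S (polyline V n)"
  unfolding polyline_def[abs_def] by (intro continuous_intros)

lemma polyline_derivative:
  assumes i: "i < n" and t: "t \<in> {real i / real n..real (Suc i) / real n}"
  shows "(polyline V n has_vector_derivative real n *\<^sub>R (V (Suc i) - V i)) (at t within {real i / real n..real (Suc i) / real n})"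
proof -
  have n: "0 < real n" using i by simp
  let ?f = "\<lambda>t. V i + (real n * t - real i) *\<^sub>R (V (Suc i) - V i)"
  have "(?f has_vector_derivative real n *\<^sub>R (V (Suc i) - V i)) (at t within {real i / real n..real (Suc i) / real n})"
    by (auto intro!: derivative_eq_intros)
  moreover have "?f s = polyline V n s" if "s \<in> {real i / real n..real (Suc i) / real n}" for s
    using polyline_piece[OF i, of s V] that n by (simp add: linepath_def field_simps)
  ultimately show ?thesis using t by (rule_tac has_vector_derivative_transform) auto
qed

lemma consecutive_grid_points:
  assumes n: "0 < (n::nat)" and ab: "a \<in> (\<lambda>i. real i / real n) ` {..n}" "b \<in> (\<lambda>i. real i / real n) ` {..n}" "a < b"
    and no: "{a<..<b} \<inter> (\<lambda>i. real i / real n) ` {..n} = {}"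
  obtains i where "i < n" "a = real i / real n" "b = real (Suc i) / real n"
proof -
  obtain i j where ij: "i \<le> n" "j \<le> n" "a = real i / real n" "b = real j / real n" using ab by auto
  have "i < j" using ab(3) ij n by (simp add: divide_less_cancel)
  moreover have "\<not> Suc i < j"
  proof
    assume "Suc i < j"
    then have "real (Suc i) / real n \<in> {a<..<b}" using ij n by (simp add: divide_strict_right_mono)
    moreover have "Suc i \<le> n" using \<open>Suc i < j\<close> ij(2) by simp
    ultimately show False using no by blast
  qed
  ultimately have "j = Suc i" by simp
  then show ?thesis using that[of i] ij \<open>i < j\<close> by simp
qed

lemma inversion_vector_derivative:
  assumes z: "(z has_vector_derivative v) (at t within S)" and nz: "z t \<noteq> 0"
  shows "((\<lambda>t. 1 / cnj (z t)) has_vector_derivative inversion_diff (z t) v) (at t within S)"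
proof -
  have dz: "(z has_derivative (\<lambda>u. u *\<^sub>R v)) (at t within S)" using z by (simp add: has_vector_derivative_def)
  from has_derivative_compose[OF dz inversion_has_derivative[OF nz]]
  have "((\<lambda>t. 1 / cnj (z t)) has_derivative (\<lambda>u. inversion_diff (z t) (u *\<^sub>R v))) (at t within S)" .
  moreover have "inversion_diff (z t) (u *\<^sub>R v) = u *\<^sub>R inversion_diff (z t) v" for u
    by (simp add: inversion_diff_def scaleR_conv_of_real)
  ultimately show ?thesis by (simp add: has_vector_derivative_def)
qed

context sphere_volume begin

text \<open>The velocity is a definite description over both charts. It is meaningful because the
  differential of the inversion identifies the two coordinate vectors as one tangent vector.\<close>

lemma velocity_spsi:
  assumes z: "(z has_vector_derivative v) (at t)"
  shows "\<Phi> (velocity sphere2 (\<lambda>t. spsi 1 (z t)) t) = fin 1 (z t) v"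
proof -
  let ?\<gamma> = "\<lambda>t. spsi 1 (z t)"
  have d1: "((stereo 1 \<circ> ?\<gamma>) has_vector_derivative toV v) (at t)"
    using bounded_linear.has_vector_derivative[OF bounded_linear_toV z] by (simp add: o_def stereo_spsi)
  have d2: "((stereo (- 1) \<circ> ?\<gamma>) has_vector_derivative toV (inversion_diff (z t) v)) (at t)" if "z t \<noteq> 0"
    using bounded_linear.has_vector_derivative[OF bounded_linear_toV inversion_vector_derivative[OF z that]]
      stereo_minus_spsi[of 1] by (simp add: o_def)
  have at: "atlas sphere2 = {schart 1, schart (- 1)}" by (simp add: sphere2_eq)
  have "velocity sphere2 ?\<gamma> t = tvec sphere2 (schart 1) (?\<gamma> t) (toV v)"
    unfolding velocity_def
  proof (rule the_equality)
    show "\<exists>c\<in>atlas sphere2. ?\<gamma> t \<in> fst c \<and> (\<exists>v'. ((snd c \<circ> ?\<gamma>) has_vector_derivative v') (at t) \<and>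
        tvec sphere2 (schart 1) (?\<gamma> t) (toV v) = tvec sphere2 c (?\<gamma> t) v')"
      using d1 unfolding at by (intro bexI[of _ "schart 1"]) (auto simp: schart_def)
    fix w assume "\<exists>c\<in>atlas sphere2. ?\<gamma> t \<in> fst c \<and> (\<exists>v'. ((snd c \<circ> ?\<gamma>) has_vector_derivative v') (at t) \<and> w = tvec sphere2 c (?\<gamma> t) v')"
    then obtain c v' where c: "c = schart 1 \<or> c = schart (- 1)" "?\<gamma> t \<in> fst c"
      "((snd c \<circ> ?\<gamma>) has_vector_derivative v') (at t)" "w = tvec sphere2 c (?\<gamma> t) v'"
      unfolding at by blast
    from c(1) show "w = tvec sphere2 (schart 1) (?\<gamma> t) (toV v)"
    proof
      assume "c = schart 1"
      then show ?thesis using c(3,4) vector_derivative_unique_at[OF d1, of v'] by (simp add: schart_def)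
    next
      assume c': "c = schart (- 1)"
      then have z0: "z t \<noteq> 0" using c(2) spsi_eq_opposite_iff[of 1 "z t"] by (simp add: schart_def)
      have "v' = toV (inversion_diff (z t) v)"
        using c(3) c' vector_derivative_unique_at[OF d2[OF z0], of v'] by (simp add: schart_def)
      then show ?thesis using c(4) c' tvec_sphere2_change[of 1 "z t" v] z0 spsi_inversion[OF z0, of 1] by simp
    qed
  qed
  then show ?thesis by (simp add: fin_def)
qed

lemma polyline_piecewise_C1:
  assumes n: "0 < n"
  shows "piecewise_C1_curve sphere2 (\<lambda>t. spsi 1 (polyline V n t))"
proof -
  let ?\<gamma> = "\<lambda>t. spsi 1 (polyline V n t)"
  let ?T = "(\<lambda>i. real i / real n) ` {..n}"
  have contS: "continuous_on S ?\<gamma>" for S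
    by (rule continuous_on_compose2[OF chart_param.\<psi>_continuous[OF chart_param_spsi] continuous_on_polyline]) auto
  have cm: "continuous_map (top_of_set S) (mtop sphere2) ?\<gamma>" for S
    using contS[of S] norm_spsi[of 1] by (auto simp: sphere2_eq continuous_map_in_subtopology)
  have "C1_curve_on sphere2 (real i / real n) (real (Suc i) / real n) ?\<gamma>" if i: "i < n" for i
  proof -
    define a b where "a = real i / real n" and "b = real (Suc i) / real n"
    define v where "v = real n *\<^sub>R (V (Suc i) - V i)"
    let ?z = "polyline V n"
    have dz: "(?z has_vector_derivative v) (at t within {a..b})" if "t \<in> {a..b}" for t
      using polyline_derivative[OF i, of t V] that by (simp add: a_def b_def v_def)
    have d1: "((stereo 1 \<circ> ?\<gamma>) has_vector_derivative toV v) (at t within {a..b})" if "t \<in> {a..b}" for t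
      using bounded_linear.has_vector_derivative[OF bounded_linear_toV dz[OF that]] by (simp add: o_def stereo_spsi)
    have d2: "((stereo (- 1) \<circ> ?\<gamma>) has_vector_derivative toV (inversion_diff (?z t) v)) (at t within {a..b})"
      if t: "t \<in> {a..b}" "?z t \<noteq> 0" for t
      using bounded_linear.has_vector_derivative[OF bounded_linear_toV inversion_vector_derivative[where z = ?z, OF dz[OF t(1)] t(2)]]
        stereo_minus_spsi[of 1] by (simp add: o_def)
    have z0: "?z t \<noteq> 0" if "?\<gamma> t \<in> range (spsi (- 1))" for t
      using that spsi_eq_opposite_iff[of 1 "?z t"] by simp
    have c1: "\<exists>\<gamma>'. continuous_on ({a..b} \<inter> ?\<gamma> -` range (spsi 1)) \<gamma>' \<and>
      (\<forall>t\<in>{a..b} \<inter> ?\<gamma> -` range (spsi 1). ((stereo 1 \<circ> ?\<gamma>) has_vector_derivative \<gamma>' t) (at t within {a..b}))"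
      using d1 by (intro exI[of _ "\<lambda>_. toV v"]) auto
    \<comment> \<open>Wherever the curve meets the second chart the polygon avoids 0, so the
      derivative transformed by the inversion is continuous there.\<close>
    have c2: "\<exists>\<gamma>'. continuous_on ({a..b} \<inter> ?\<gamma> -` range (spsi (- 1))) \<gamma>' \<and>
      (\<forall>t\<in>{a..b} \<inter> ?\<gamma> -` range (spsi (- 1)). ((stereo (- 1) \<circ> ?\<gamma>) has_vector_derivative \<gamma>' t) (at t within {a..b}))"
    proof (intro exI[of _ "\<lambda>t. toV (inversion_diff (?z t) v)"] conjI ballI)
      show "continuous_on ({a..b} \<inter> ?\<gamma> -` range (spsi (- 1))) (\<lambda>t. toV (inversion_diff (?z t) v))"
        unfolding inversion_diff_def using z0
        by (intro continuous_intros continuous_on_polyline) auto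
    qed (use d2 z0 in auto)
    show ?thesis
      unfolding C1_curve_on_def a_def[symmetric] b_def[symmetric]
      using cm[of "{a..b}"] c1 c2 by (auto simp: sphere2_eq schart_def)
  qed
  then have "C1_curve_on sphere2 a b ?\<gamma>" if "a \<in> ?T" "b \<in> ?T" "a < b" "{a<..<b} \<inter> ?T = {}" for a b
    using consecutive_grid_points[OF n that] by metis
  moreover have "finite ?T" "{0, 1} \<subseteq> ?T" "?T \<subseteq> {0..1}"
    using n by (auto simp: image_iff intro: bexI[of _ 0] bexI[of _ n])
  ultimately show ?thesis unfolding piecewise_C1_curve_def using cm by blast
qed

lemma polyline_length:
  assumes n: "0 < n"
  shows "curve_length sphere2 \<Phi> (\<lambda>t. spsi 1 (polyline V n t)) = (\<Sum>i<n. seg (fin 1) (V i) (V (Suc i)))"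
proof -
  interpret plane_finsler "fin 1" by (rule plane_finsler_fin) simp
  let ?f = "\<lambda>t. \<Phi> (velocity sphere2 (\<lambda>t. spsi 1 (polyline V n t)) t)"
  have nn: "real n \<noteq> 0" "0 < real n" using n by auto
  have piece: "(?f has_integral seg (fin 1) (V i) (V (Suc i))) {real i / real n..real (Suc i) / real n}" if i: "i < n" for i
  proof -
    define a b where "a = real i / real n" and "b = real (Suc i) / real n"
    have ab: "a < b" "real n * a = real i" "real n * b = real (Suc i)" using nn by (auto simp: a_def b_def divide_strict_right_mono)
    let ?p = "V i" and ?q = "V (Suc i)"
    let ?k = "\<lambda>\<tau>. fin 1 (linepath ?p ?q \<tau>) (?q - ?p)"
    have ran: "real i \<le> real n * t" "real n * t \<le> real (Suc i)" if "t \<in> {a..b}" for t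
      using that mult_left_mono[of a t "real n"] mult_left_mono[of t b "real n"] ab by auto
    have "((\<lambda>t. real n *\<^sub>R ?k (real n * t - real i)) has_integral (integral {real n * a - real i..real n * b - real i} ?k)) {a..b}"
    proof (rule has_integral_substitution[where c = 0 and d = 1])
      show "continuous_on {0..1} ?k" by (intro continuous_on_F continuous_on_linepath continuous_intros)
      show "(\<lambda>t. real n * t - real i) ` {a..b} \<subseteq> {0..1}" using ran by fastforce
    qed (use ab in \<open>auto intro!: derivative_eq_intros\<close>)
    then have I: "((\<lambda>t. real n *\<^sub>R ?k (real n * t - real i)) has_integral seg (fin 1) ?p ?q) {a..b}"
      using ab by (simp add: seg_def)
    have "(?f has_integral seg (fin 1) ?p ?q) {a..b}"
    proof (rule has_integral_spike[OF _ _ I])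
      show "negligible {a, b}" by simp
      fix t assume t: "t \<in> {a..b} - {a, b}"
      have "(polyline V n has_vector_derivative real n *\<^sub>R (?q - ?p)) (at t within {a..b})"
        using polyline_derivative[OF i, of t V] t by (simp add: a_def b_def)
      then have "(polyline V n has_vector_derivative real n *\<^sub>R (?q - ?p)) (at t)"
        using t at_within_interior[of t "{a..b}"] by auto
      from velocity_spsi[OF this] show "?f t = real n *\<^sub>R ?k (real n * t - real i)"
        using polyline_piece[OF i ran] t F_scaleR by simp
    qed
    then show ?thesis by (simp add: a_def b_def)
  qed
  have "(?f has_integral (\<Sum>i<m. seg (fin 1) (V i) (V (Suc i)))) {0..real m / real n}" if "m \<le> n" for m
    using that
  proof (induction m)
    case 0
    show ?case using has_integral_refl(2)[of ?f 0] by simp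
  next
    case (Suc m)
    have "(?f has_integral (\<Sum>i<m. seg (fin 1) (V i) (V (Suc i))) + seg (fin 1) (V m) (V (Suc m))) {0..real (Suc m) / real n}"
      using Suc nn by (intro has_integral_combine[where c = "real m / real n"] piece) (auto simp: divide_right_mono)
    then show ?case by simp
  qed
  from this[of n] show ?thesis unfolding curve_length_def using nn by (simp add: integral_unique)
qed

end

section \<open>The two discs on the sphere\<close>

lemma homeomorphic_complex_disc: "ball (0::complex) 1 homeomorphic ball (0::real^2) 1"
proof -
  have n: "norm (toV z) = cmod z" for z
    by (simp add: norm_vec_def L2_set_def sum_2 cmod_def)
  have n': "cmod (toC v) = norm v" for v using n[of "toC v"] by simp
  have "homeomorphism (ball (0::complex) 1) (ball (0::real^2) 1) toV toC"
    by (rule homeomorphismI) (auto simp: n n' continuous_on_toV[OF continuous_on_id] continuous_on_toC[OF continuous_on_id])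
  then show ?thesis unfolding homeomorphic_def by blast
qed

text \<open>The closed inside is compact, so an injective continuous map is a homeomorphism onto its
  image there. Compactness of this image also serves to show that the complementary disc is open in
  the sphere.\<close>

lemma homeomorphic_disc_of_jordan_inside:
  fixes c :: "real \<Rightarrow> complex" and G :: "complex \<Rightarrow> real^3"
  assumes c: "simple_path c" "pathfinish c = pathstart c"
    and G: "continuous_on UNIV G" "inj G"
  shows "G ` inside (path_image c) homeomorphic ball (0::real^2) 1" "compact (G ` (inside (path_image c) \<union> path_image c))"
proof -
  let ?I = "inside (path_image c)"
  note j = Jordan_inside_outside[OF c]
  have "?I \<union> path_image c = closure ?I" using j closure_Un_frontier[of ?I] by auto
  then have comp: "compact (?I \<union> path_image c)" using j compact_closure by metis
  then show "compact (G ` (?I \<union> path_image c))"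
    by (rule compact_continuous_image[OF continuous_on_subset[OF G(1) subset_UNIV]])
  obtain H where "homeomorphism (?I \<union> path_image c) (G ` (?I \<union> path_image c)) G H"
    using homeomorphism_compact[OF comp continuous_on_subset[OF G(1)] refl inj_on_subset[OF G(2)]] by auto
  then have "homeomorphism ?I (G ` ?I) G H" by (rule homeomorphism_of_subsets) auto
  then have "?I homeomorphic G ` ?I" unfolding homeomorphic_def by blast
  then show "G ` ?I homeomorphic ball (0::real^2) 1"
    using homeomorphic_trans[OF homeomorphic_trans[OF _ jordan_inside_homeomorphic_disc[OF c]] homeomorphic_complex_disc]
      homeomorphic_sym by metis
qed

text \<open>In this chart the side of a curve containing the pole becomes the inside of a Jordan curve.\<close>

definition pole_chart :: "complex \<Rightarrow> complex \<Rightarrow> real^3" where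
  "pole_chart a \<zeta> = (if \<zeta> = 0 then axis 3 1 else spsi 1 (a + 1 / \<zeta>))"

lemma pole_chart_minv: "z \<noteq> a \<Longrightarrow> pole_chart a (minv a z) = spsi 1 z"
  by (simp add: pole_chart_def minv_def)

lemma inj_pole_chart: "inj (pole_chart a)"
proof (rule injI)
  have ne: "spsi 1 z \<noteq> axis 3 1" for z using range_spsi[of 1] by (metis DiffD2 insertI1 rangeI)
  have inj: "spsi 1 z = spsi 1 w \<longleftrightarrow> z = w" for z w by (rule chart_param.\<psi>_inj[OF chart_param_spsi]) simp
  fix x y assume "pole_chart a x = pole_chart a y"
  then show "x = y" using ne[of "a + 1 / x"] ne[of "a + 1 / y"] by (auto simp: pole_chart_def inj split: if_splits)
qed

text \<open>Off 0 the defining formula is continuous. Near 0 the point is close to the pole and is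
  written in the opposite stereographic chart, where its coordinate is
  \<open>cnj \<zeta> / cnj (1 + a * \<zeta>)\<close>. The two open domains cover the plane.\<close>

lemma continuous_pole_chart: "continuous_on UNIV (pole_chart a)"
proof -
  have cs: "continuous_on UNIV (spsi s)" if "s = 1 \<or> s = - 1" for s
    by (rule chart_param.\<psi>_continuous[OF chart_param_spsi[OF that]])
  let ?f = "\<lambda>\<zeta>. spsi 1 (a + 1 / \<zeta>)" and ?g = "\<lambda>\<zeta>. spsi (- 1) (cnj \<zeta> / cnj (1 + a * \<zeta>))"
  let ?U = "- {0 :: complex}" and ?V = "- {\<zeta>. 1 + a * \<zeta> = 0}"
  have oV: "open ?V" by (intro open_Compl closed_Collect_eq continuous_intros)
  have "continuous_on ?U (\<lambda>\<zeta>. a + 1 / \<zeta>)" by (intro continuous_intros) auto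
  from continuous_on_compose2[OF cs[OF disjI1[OF refl]] this] have "continuous_on ?U ?f" by simp
  then have U: "continuous_on ?U (pole_chart a)"
    by (rule continuous_on_eq) (auto simp: pole_chart_def)
  have nz: "cnj (1 + a * \<zeta>) \<noteq> 0" if "\<zeta> \<in> ?V" for \<zeta>
    using that by (simp only: complex_cnj_zero_iff) simp
  have "continuous_on ?V (\<lambda>\<zeta>. cnj \<zeta> / cnj (1 + a * \<zeta>))"
    by (intro continuous_intros) (use nz in blast)
  from continuous_on_compose2[OF cs[OF disjI2[OF refl]] this] have "continuous_on ?V ?g" by simp
  then have V: "continuous_on ?V (pole_chart a)"
  proof (rule continuous_on_eq)
    fix \<zeta> assume \<zeta>: "\<zeta> \<in> ?V"
    show "?g \<zeta> = pole_chart a \<zeta>"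
    proof (cases "\<zeta> = 0")
      case True
      have "spsi (- 1) 0 = axis 3 1" by (simp add: vec_eq_iff forall_3 axis_def)
      then show ?thesis using True by (simp add: pole_chart_def)
    next
      case False
      define \<eta> where "\<eta> = cnj \<zeta> / cnj (1 + a * \<zeta>)"
      have "\<eta> \<noteq> 0" unfolding \<eta>_def using nz[OF \<zeta>] False by (simp only: divide_eq_0_iff complex_cnj_zero_iff) simp
      moreover have "1 / cnj \<eta> = a + 1 / \<zeta>" using False by (simp add: \<eta>_def field_simps)
      ultimately have "spsi (- 1) \<eta> = pole_chart a \<zeta>" using spsi_inversion[of \<eta> "- 1"] False by (simp add: pole_chart_def)
      then show ?thesis by (simp only: \<eta>_def)
    qed
  qed
  have "continuous_on (?U \<union> ?V) (pole_chart a)"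
    by (rule continuous_on_open_Un[OF _ oV U V]) auto
  moreover have "?U \<union> ?V = UNIV" by auto
  ultimately show ?thesis by simp
qed

text \<open>The disc without the pole is parametrized by the inside of the curve. The other one
  becomes the inside of \<open>J\<close> after an inversion at a point of the inside of
  \<open>C\<close>, with 0 standing for the pole.\<close>

lemma jordan_curve_divides_sphere:
  assumes c: "simple_path c" "pathfinish c = pathstart c" and C: "C = path_image c"
    and \<gamma>: "\<gamma> ` {0..1} = spsi 1 ` C"
  shows "divides_into_disks \<gamma> (spsi 1 ` inside C) (spsi 1 ` outside C \<union> {axis 3 1})"
proof -
  note j = Jordan_inside_outside[OF c, folded C]
  have inj: "spsi 1 z = spsi 1 w \<longleftrightarrow> z = w" for z w by (rule chart_param.\<psi>_inj[OF chart_param_spsi]) simp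
  have ne: "spsi 1 z \<noteq> axis 3 1" for z using range_spsi[of 1] by (metis DiffD2 insertI1 rangeI)
  have sph: "sphere 0 1 = insert (axis 3 1) (range (spsi 1))" using range_spsi[of 1] by (auto simp: norm_axis_1)
  have un: "inside C \<union> outside C = - C" and dis: "inside C \<inter> outside C = {}" using j by simp_all
  let ?D1 = "spsi 1 ` inside C" and ?D2 = "spsi 1 ` outside C \<union> {axis 3 1}"
  have inj1: "inj (spsi 1)" using inj by (simp add: inj_def)
  have cov: "sphere 0 1 - spsi 1 ` C = ?D1 \<union> ?D2"
  proof -
    have "range (spsi 1) - spsi 1 ` C = spsi 1 ` (- C)"
      using image_set_diff[OF inj1, of UNIV C] by (simp add: Compl_eq_Diff_UNIV)
    moreover have "spsi 1 ` (- C) = ?D1 \<union> spsi 1 ` outside C" unfolding un[symmetric] by (rule image_Un)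
    moreover have "axis 3 1 \<notin> spsi 1 ` C" using ne by (metis imageE)
    ultimately show ?thesis unfolding sph by (simp add: insert_Diff_if)
  qed
  have "?D1 \<inter> spsi 1 ` outside C = {}" using dis image_Int[OF inj1, of "inside C" "outside C"] by simp
  moreover have "axis 3 1 \<notin> ?D1" using ne by (metis imageE)
  ultimately have disj: "?D1 \<inter> ?D2 = {}" by simp
  obtain a where a: "a \<in> inside C" using j by blast
  have aC: "a \<notin> C" "a \<notin> outside C" using a un dis by blast+
  define J where "J = minv a ` C"
  have c': "simple_path (minv a \<circ> c)" "pathfinish (minv a \<circ> c) = pathstart (minv a \<circ> c)" "path_image (minv a \<circ> c) = J"
    using c C aC(1) simple_path_continuous_image[of c "minv a"] continuous_on_minv[OF aC(1)] inj_on_minv[of a C]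
    by (auto simp: J_def pathfinish_compose pathstart_compose path_image_compose)
  note j' = Jordan_inside_outside[OF c'(1,2), unfolded c'(3)]
  have side: "minv a ` outside C = inside J - {0}"
    using minv_jordan_side(1)[OF c C, of "outside C" "inside C" a] a by (simp add: J_def insert_commute)
  \<comment> \<open>The outside of \<open>C\<close> has points arbitrarily far away, and their
    images come arbitrarily close to 0; hence 0 cannot be outside \<open>J\<close>.\<close>
  have zero: "0 \<in> inside J"
  proof (rule ccontr)
    assume "0 \<notin> inside J"
    moreover have "0 \<notin> J" using aC by (auto simp: J_def minv_def)
    ultimately have "0 \<in> outside J" by (simp add: outside_inside)
    then obtain r where r: "0 < r" "ball 0 r \<subseteq> outside J" using j' by (meson open_contains_ball)
    have "\<not> outside C \<subseteq> cball a (1 / r)" using j bounded_subset[OF bounded_cball] by blast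
    then obtain z where "z \<in> outside C" "z \<notin> cball a (1 / r)" by blast
    then have z: "z \<in> outside C" "1 / r < cmod (z - a)" by (simp_all add: dist_norm norm_minus_commute)
    have "0 < 1 / r" using r(1) by simp
    then have pos: "0 < cmod (z - a)" using z(2) by linarith
    then have "1 / cmod (z - a) < r" using z(2) r(1) by (simp add: field_simps)
    then have "minv a z \<in> outside J" using r(2) by (auto simp: minv_def norm_divide)
    moreover have "minv a z \<in> inside J" using side z(1) by blast
    ultimately show False using j' by blast
  qed
  have img: "pole_chart a ` inside J = ?D2"
  proof -
    have "inside J = minv a ` outside C \<union> {0}" using side zero by blast
    moreover have "pole_chart a 0 = axis 3 1" by (simp add: pole_chart_def)
    ultimately have "pole_chart a ` inside J = pole_chart a ` minv a ` outside C \<union> {axis 3 1}"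
      by (simp only: image_Un image_insert image_empty)
    moreover have "pole_chart a ` minv a ` outside C = spsi 1 ` outside C"
      unfolding image_image by (intro image_cong refl pole_chart_minv) (use aC in blast)
    ultimately show ?thesis by simp
  qed
  have imgC: "pole_chart a ` J = spsi 1 ` C"
    unfolding J_def image_image by (intro image_cong refl pole_chart_minv) (use aC in blast)
  note h1 = homeomorphic_disc_of_jordan_inside[OF c, folded C, of "spsi 1"]
  note h2 = homeomorphic_disc_of_jordan_inside[OF c'(1,2), unfolded c'(3), OF continuous_pole_chart inj_pole_chart, of a]
  have cs: "continuous_on UNIV (spsi 1)" by (rule chart_param.\<psi>_continuous[OF chart_param_spsi]) simp
  \<comment> \<open>Each disc is the complement in the sphere of the other disc together with the
    curve, which is compact.\<close>
  have op: "openin (top_of_set (sphere 0 1)) D" if "D = sphere 0 1 - K" "compact K" for D K :: "(real^3) set"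
    unfolding that(1) using that(2) by (metis Diff_eq openin_open_Int open_Compl compact_imp_closed)
  have "openin (top_of_set (sphere 0 1)) ?D1"
  proof (rule op)
    show "compact (pole_chart a ` (inside J \<union> J))" by (rule h2(2))
    show "?D1 = sphere 0 1 - pole_chart a ` (inside J \<union> J)"
      unfolding image_Un img imgC using cov disj by blast
  qed
  moreover have "openin (top_of_set (sphere 0 1)) ?D2"
  proof (rule op)
    show "compact (spsi 1 ` (inside C \<union> C))" by (rule h1(2)[OF cs inj1])
    show "?D2 = sphere 0 1 - spsi 1 ` (inside C \<union> C)"
      unfolding image_Un using cov disj by blast
  qed
  ultimately show ?thesis
    unfolding divides_into_disks_def \<gamma> using cov disj h1(1)[OF cs inj1] h2(1)[unfolded img] by auto
qed

theorem proposition3p6: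
  fixes \<Phi> :: "(real^3, 2) tangent \<Rightarrow> real"
    and \<A> :: "(real^3, 2) mfd \<Rightarrow> ((real^3, 2) tangent \<Rightarrow> real) \<Rightarrow> (real^3) measure"
    and c \<epsilon> :: real
  assumes "finsler_metric sphere2 \<Phi>" and "reversible sphere2 \<Phi>"
    and "finsler_volume \<A>"
    and "c > 0"
    and "\<And>d1 d2. d1 > 0 \<Longrightarrow> d2 > 0 \<Longrightarrow>
           measure (\<A> plane sup_metric) (rectangle d1 d2) = c * d1 * d2"
    and "\<epsilon> > 0"
  shows "\<exists>\<gamma> D1 D2.
           piecewise_C1_curve sphere2 \<gamma> \<and> \<gamma> 0 = \<gamma> 1 \<and>
           divides_into_disks \<gamma> D1 D2 \<and>
           measure (\<A> sphere2 \<Phi>) D1 \<ge> measure (\<A> sphere2 \<Phi>) (sphere 0 1) / 4 \<and>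
           measure (\<A> sphere2 \<Phi>) D2 \<ge> measure (\<A> sphere2 \<Phi>) (sphere 0 1) / 4 \<and>
           curve_length sphere2 \<Phi> \<gamma> \<le> 2 * sqrt (3 / c * measure (\<A> sphere2 \<Phi>) (sphere 0 1)) + \<epsilon>"
proof -
  interpret sphere_volume \<Phi> \<A> c
    using assms by unfold_locales auto
  interpret area: finsler_area "fin 1" \<nu> c by (rule finsler_area_\<nu>)
  obtain g L where g: "area.cut g L" "L \<le> 2 * sqrt (3 / c * measure \<nu> UNIV) + \<epsilon>"
    using area.short_cut_exists[OF \<open>c > 0\<close> \<open>\<epsilon> > 0\<close>] by blast
  define C where "C = g ` {0..L}"
  have cp: "area.closedp g L" and area: "measure \<nu> UNIV / 4 \<le> measure \<nu> (inside C)" "measure \<nu> UNIV / 4 \<le> measure \<nu> (outside C)"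
    using g(1) by (auto simp: area.cut_def C_def)
  obtain p where p: "simple_path p" "pathfinish p = pathstart p" "path_image p = C"
    using area.closedp_simple_path[OF cp] C_def by metis
  have "area.uarc g 0 L" "g 0 = g L" using cp by (auto simp: area.closedp_def)
  then obtain V n where V: "0 < n" "V 0 = g 0" "V n = g 0" "(\<Union>i<n. closed_segment (V i) (V (Suc i))) = C"
    "(\<Sum>i<n. seg (fin 1) (V i) (V (Suc i))) = L"
    using area.uarc_vertices[of g 0 L] by (auto simp: C_def)
  define \<gamma> where "\<gamma> t = spsi 1 (polyline V n t)" for t
  \<comment> \<open>The pole, absent from the plane, is adjoined to the unbounded side; being null,
    it does not change the area.\<close>
  let ?D1 = "spsi 1 ` inside C" and ?D2 = "spsi 1 ` outside C \<union> {axis 3 1}"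
  have "\<gamma> ` {0..1} = spsi 1 ` polyline V n ` {0..1}" by (simp add: \<gamma>_def image_image)
  then have img: "\<gamma> ` {0..1} = spsi 1 ` C" using polyline_image[OF V(1)] V(4) by simp
  note j = jordan_sides[OF p(1,2) p(3)[symmetric] refl]
  have "piecewise_C1_curve sphere2 \<gamma>" unfolding \<gamma>_def by (rule polyline_piecewise_C1[OF V(1)])
  moreover have "\<gamma> 0 = \<gamma> 1" using polyline_ends[OF V(1), of V] V(2,3) by (simp add: \<gamma>_def)
  moreover have "divides_into_disks \<gamma> ?D1 ?D2"
    by (rule jordan_curve_divides_sphere[OF p(1,2) p(3)[symmetric] img])
  moreover have "measure \<mu> ?D1 \<ge> measure \<mu> (sphere 0 1) / 4"
    using area(1) measure_\<nu>[of "inside C"] j(1) measure_\<nu>_UNIV by simp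
  moreover have "measure \<mu> ?D2 \<ge> measure \<mu> (sphere 0 1) / 4"
    using area(2) measure_\<nu>[of "outside C"] j(2) measure_\<nu>_UNIV
      measure_Un_null_set[OF spsi_sets[of 1 "outside C"] pole_null] by simp
  moreover have "curve_length sphere2 \<Phi> \<gamma> = L"
    unfolding \<gamma>_def using polyline_length[OF V(1), of V] V(5) by simp
  ultimately show ?thesis using g(2) measure_\<nu>_UNIV by (intro exI[of _ \<gamma>] exI[of _ ?D1] exI[of _ ?D2]) simp
qed

end
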